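(* Let $X$ be a topological space, $\ell$ a kernel on $X$ and $s$ a normalized complete Pick kernel on $X$ with $\ell/s$ positive semi-definite, and assume: (Q1) $\ell:X\times X\to\mathbb{C}$ is continuous; (Q2) if $\{\lambda_i\}\subset X$ satisfies $\|\ell_{\lambda_i}\|\to\infty$, then $\|\ell_{\lambda_i}\|^{-1}\ell(\lambda_i,\mu)\to0$ for every $\mu\in X$; (Q3) for every sequence $\{\lambda_i\}\subset X$, either $\|\ell_{\lambda_i}\|\to\infty$ or $\{\lambda_i\}$ has a subsequence converging to a point of $X$; (Q4) if $\|\ell_{\lambda_i}\|\to\infty$ then $\|s_{\lambda_i}\|\to\infty$. Then the following are equivalent: (i) for every sequence $\{\lambda_i\}\subset X$, $\{\lambda_i\}$ is interpolating for $\mathrm{Mult}(\mathcal{H}_s,\mathcal{H}_\ell)$ if and only if it satisfies the Carleson measure condition for $\mathcal{H}_s$ and is weakly separated by $\ell$; (ii) $\ell$ has the automatic separation property.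
   Context: A kernel on $X$ is a positive semi-definite function $k:X\times X\to\mathbb{C}$; $\mathcal{H}_k$ its reproducing kernel Hilbert space, $k_w=k(\cdot,w)$, $\|k_w\|^2=k(w,w)$, $\hat k_w=k_w/\|k_w\|$ (assume $\ell_z\ne0$ for all $z$). A normalized complete Pick kernel is $s(z,w)=\frac{1}{1-\langle b(z),b(w)\rangle_{\mathcal K}}$ with $b$ into the open unit ball of a Hilbert space $\mathcal K$ and $b(w_0)=0$ for some $w_0$. "$\ell/s$ positive semi-definite" means $\ell=sg$ with $g$ a positive semi-definite kernel. $d_k(z,w)=\sqrt{1-|\langle\hat k_z,\hat k_w\rangle|^2}$; $\{\lambda_i\}$ is weakly separated by $k$ if $d_k(\lambda_i,\lambda_j)\ge\epsilon>0$ for all $i\ne j$. For $n\ge2$, $\{\lambda_i\}$ is $n$-weakly separated by $k$ if there is $\epsilon>0$ such that for every $n$-point subset $\{\mu_1,\dots,\mu_n\}$ of $\{\lambda_i\}$, $\mathrm{dist}(\hat k_{\mu_1},\mathrm{span}\{\hat k_{\mu_2},\dots,\hat k_{\mu_n}\})\ge\epsilon$. $k$ has the automatic separation property if every sequence weakly separated by $k$ is $n$-weakly separated by $k$ for every $n\ge3$. Interpolating for $\mathrm{Mult}(\mathcal{H}_s,\mathcal{H}_\ell)$: for every bounded $\{w_i\}$ there is $\phi$ with $f\mapsto\phi f$ bounded $\mathcal{H}_s\to\mathcal{H}_\ell$ and $\phi(\lambda_i)=w_i\|\ell_{\lambda_i}\|/\|s_{\lambda_i}\|$. Carleson measure condition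 for $\mathcal{H}_s$: $\sum_i|f(\lambda_i)|^2/\|s_{\lambda_i}\|^2\le C\|f\|^2$ for all $f\in\mathcal{H}_s$, some $C>0$. *)

theory Defs
  imports "HOL-Analysis.Analysis"
begin

definition psd_kernel :: "('a \<Rightarrow> 'a \<Rightarrow> complex) \<Rightarrow> bool" where
  "psd_kernel k \<longleftrightarrow>
     (\<forall>(n::nat) (x::nat \<Rightarrow> 'a) (c::nat \<Rightarrow> complex).
        let q = (\<Sum>i<n. \<Sum>j<n. c i * cnj (c j) * k (x i) (x j)) in Im q = 0 \<and> Re q \<ge> 0)"

definition kfun_norm :: "('a \<Rightarrow> 'a \<Rightarrow> complex) \<Rightarrow> 'a \<Rightarrow> real" where
  "kfun_norm k w = sqrt (Re (k w w))"

text \<open>Squared norm in H_k of the finite combination sum_i a_i k_{x_i}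
  (using the convention k_w = k(.,w), so <k_u, k_v> = k(v,u)).\<close>
definition combo_norm2 :: "('a \<Rightarrow> 'a \<Rightarrow> complex) \<Rightarrow> nat \<Rightarrow> (nat \<Rightarrow> 'a) \<Rightarrow> (nat \<Rightarrow> complex) \<Rightarrow> real" where
  "combo_norm2 k n x a = Re (\<Sum>i<n. \<Sum>j<n. a i * cnj (a j) * k (x j) (x i))"

text \<open>Inner product of a function f with sum_i a_i k_{x_i}, via the reproducing property.\<close>
definition combo_pairing :: "('a \<Rightarrow> complex) \<Rightarrow> nat \<Rightarrow> (nat \<Rightarrow> 'a) \<Rightarrow> (nat \<Rightarrow> complex) \<Rightarrow> complex" where
  "combo_pairing f n x a = (\<Sum>i<n. cnj (a i) * f (x i))"

text \<open>f belongs to H_k iff the functional g \<mapsto> <f,g>, defined on the dense span of the kernel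
  functions, is bounded; the norm of f is the norm of this functional.\<close>
definition in_rkhs :: "('a \<Rightarrow> 'a \<Rightarrow> complex) \<Rightarrow> ('a \<Rightarrow> complex) \<Rightarrow> bool" where
  "in_rkhs k f \<longleftrightarrow> (\<exists>C. \<forall>n x a. cmod (combo_pairing f n x a) \<le> C * sqrt (combo_norm2 k n x a))"

definition rkhs_norm :: "('a \<Rightarrow> 'a \<Rightarrow> complex) \<Rightarrow> ('a \<Rightarrow> complex) \<Rightarrow> real" where
  "rkhs_norm k f = Inf {C. C \<ge> 0 \<and> (\<forall>n x a. cmod (combo_pairing f n x a) \<le> C * sqrt (combo_norm2 k n x a))}"

text \<open>The auxiliary Hilbert space is represented as l^2('i) (every complex Hilbert space is
  isometrically isomorphic to some l^2('i)); inner product linear in the first slot.\<close>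
definition l2_inner :: "('i \<Rightarrow> complex) \<Rightarrow> ('i \<Rightarrow> complex) \<Rightarrow> complex" where
  "l2_inner u v = infsum (\<lambda>i. u i * cnj (v i)) UNIV"

definition l2_vec :: "('i \<Rightarrow> complex) \<Rightarrow> bool" where
  "l2_vec u \<longleftrightarrow> (\<lambda>i. (cmod (u i))\<^sup>2) summable_on UNIV"

definition normalized_cnp_kernel_via ::
  "('a \<Rightarrow> 'i \<Rightarrow> complex) \<Rightarrow> ('a \<Rightarrow> 'a \<Rightarrow> complex) \<Rightarrow> bool" where
  "normalized_cnp_kernel_via b s \<longleftrightarrow>
     (\<forall>z. l2_vec (b z) \<and> Re (l2_inner (b z) (b z)) < 1) \<and>
     (\<exists>w0. b w0 = (\<lambda>_. 0)) \<and>
     (\<forall>z w. s z w = 1 / (1 - l2_inner (b z) (b w)))"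

definition kdist :: "('a \<Rightarrow> 'a \<Rightarrow> complex) \<Rightarrow> 'a \<Rightarrow> 'a \<Rightarrow> real" where
  "kdist k z w = sqrt (1 - (cmod (k z w))\<^sup>2 / (Re (k z z) * Re (k w w)))"

definition weakly_separated :: "('a \<Rightarrow> 'a \<Rightarrow> complex) \<Rightarrow> (nat \<Rightarrow> 'a) \<Rightarrow> bool" where
  "weakly_separated k lam \<longleftrightarrow> (\<exists>\<epsilon>>0. \<forall>i j. i \<noteq> j \<longrightarrow> kdist k (lam i) (lam j) \<ge> \<epsilon>)"

definition dist_to_span :: "('a \<Rightarrow> 'a \<Rightarrow> complex) \<Rightarrow> nat \<Rightarrow> (nat \<Rightarrow> 'a) \<Rightarrow> real" where
  "dist_to_span k n mu =
     Inf (range (\<lambda>c::nat \<Rightarrow> complex.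
        sqrt (combo_norm2 k n mu
          (\<lambda>j. (if j = 0 then 1 else - c j) / complex_of_real (kfun_norm k (mu j))))))"

definition n_weakly_separated :: "('a \<Rightarrow> 'a \<Rightarrow> complex) \<Rightarrow> nat \<Rightarrow> (nat \<Rightarrow> 'a) \<Rightarrow> bool" where
  "n_weakly_separated k n lam \<longleftrightarrow>
     (\<exists>\<epsilon>>0. \<forall>mu::nat \<Rightarrow> 'a. inj_on mu {..<n} \<and> mu ` {..<n} \<subseteq> range lam \<longrightarrow>
        dist_to_span k n mu \<ge> \<epsilon>)"

definition automatic_separation :: "('a \<Rightarrow> 'a \<Rightarrow> complex) \<Rightarrow> bool" where
  "automatic_separation k \<longleftrightarrow>
     (\<forall>lam. weakly_separated k lam \<longrightarrow> (\<forall>n\<ge>3. n_weakly_separated k n lam))"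

definition is_multiplier :: "('a \<Rightarrow> 'a \<Rightarrow> complex) \<Rightarrow> ('a \<Rightarrow> 'a \<Rightarrow> complex) \<Rightarrow> ('a \<Rightarrow> complex) \<Rightarrow> bool" where
  "is_multiplier s l phi \<longleftrightarrow>
     (\<exists>M. \<forall>f. in_rkhs s f \<longrightarrow>
        in_rkhs l (\<lambda>z. phi z * f z) \<and> rkhs_norm l (\<lambda>z. phi z * f z) \<le> M * rkhs_norm s f)"

definition interpolating_mult :: "('a \<Rightarrow> 'a \<Rightarrow> complex) \<Rightarrow> ('a \<Rightarrow> 'a \<Rightarrow> complex) \<Rightarrow> (nat \<Rightarrow> 'a) \<Rightarrow> bool" where
  "interpolating_mult s l lam \<longleftrightarrow>
     (\<forall>w::nat \<Rightarrow> complex. (\<exists>B. \<forall>i. cmod (w i) \<le> B) \<longrightarrow>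
        (\<exists>phi. is_multiplier s l phi \<and>
           (\<forall>i. phi (lam i) = w i * complex_of_real (kfun_norm l (lam i) / kfun_norm s (lam i)))))"

definition carleson_condition :: "('a \<Rightarrow> 'a \<Rightarrow> complex) \<Rightarrow> (nat \<Rightarrow> 'a) \<Rightarrow> bool" where
  "carleson_condition s lam \<longleftrightarrow>
     (\<exists>C>0. \<forall>f. in_rkhs s f \<longrightarrow>
        summable (\<lambda>i. (cmod (f (lam i)))\<^sup>2 / (kfun_norm s (lam i))\<^sup>2) \<and>
        (\<Sum>i. (cmod (f (lam i)))\<^sup>2 / (kfun_norm s (lam i))\<^sup>2) \<le> C * (rkhs_norm s f)\<^sup>2)"

end

theory Submission
  imports Defs "HOL-Library.Complex_Order"
begin

text \<open>
  Interpolation gives, by a gliding hump and a choice of signs, that the normalized Gram matrix of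
  \<open>s\<close> along the sequence is bounded (the Carleson condition) and that each normalized kernel function
  of \<open>l\<close> stays away from the span of all the others; the latter contains weak and
  \<open>n\<close>-weak separation. Conversely, by a one-point Pick extension for the pair and Zorn's lemma,
  it suffices to bound the normalized Gram matrix of \<open>l\<close> from below. The Marcus-Spielman-Srivastava theorem
  is avoided: for each point \<open>x\<close> there is a contractive row of
  multipliers of \<open>s\<close>, split into a part that is bounded below at \<open>x\<close> and a part of squared norm
  at least \<open>1 - 3/4 * |<s_x, s_k>|\<^sup>2 / (|s_x|\<^sup>2 |s_k|\<^sup>2)\<close> at every \<open>k\<close> with
  \<open>|s_k| \<le> |s_x|\<close>. Composing these rows in the order of decreasing \<open>|s_x|\<close>, and multiplying by
  Moebius factors that vanish at the points far from \<open>x\<close>, decouples the sequence into clusters of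
  bounded size, on which \<open>N\<close>-weak separation applies.
  For the necessity of automatic separation, blocks that violate \<open>n\<close>-weak separation can be chosen
  so sparse that their union satisfies the Carleson condition.
\<close>

section \<open>Positive semi-definite kernels\<close>

text \<open>No Hilbert space is constructed. Norms are values of \<open>hform\<close>: with k_w =
  k(.,w), the form of k at \<open>c\<close> is the squared norm of the combination of kernel
  functions with coefficients \<open>cnj (c i)\<close>. A row of multipliers of s with Gram kernel K
  is contractive exactly when (1 - K) * s is positive semi-definite; a Schur product with g carries
  this over to l, so rows built from s alone act on both spaces. The obstacle to the lower bound is
  that the Carleson condition speaks about s, while l is only separated in batches of bounded size.
  It enters through t_i = |<s_i, s_k>|^2 / (|s_i|^2 |s_k|^2), whose sum over i is at most C. Hence a
  factor attached to i may cost at k only an amount linear in t_i. The 3/4 is 1/2 + 1/4: half of the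
  Moebius loss t_i, and the peak at k, which is t_i / 4 times |s_k|^2 / |s_i|^2 and is harmless only
  in the chosen order. Since 1 - 3/4 * t >= 4^(-t) on [0,1], a product of any number of copeaks
  stays above 4^(-C).\<close>

definition hform :: "'i set \<Rightarrow> ('i \<Rightarrow> 'i \<Rightarrow> complex) \<Rightarrow> ('i \<Rightarrow> complex) \<Rightarrow> complex" where
  "hform F K c = (\<Sum>i\<in>F. \<Sum>j\<in>F. c i * cnj (c j) * K i j)"

text \<open>The order on the complex numbers makes \<open>0 \<le> hform F K c\<close> say that the
  form is real as well as nonnegative, and reality for all \<open>c\<close> already forces Hermitian
  symmetry. Finite subsets of an arbitrary index type serve points of the space and indices of a
  sequence alike.\<close>

definition psd_on :: "'i set \<Rightarrow> ('i \<Rightarrow> 'i \<Rightarrow> complex) \<Rightarrow> bool" where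
  "psd_on A K \<longleftrightarrow> (\<forall>F c. finite F \<longrightarrow> F \<subseteq> A \<longrightarrow> 0 \<le> hform F K c)"

lemma psd_onD: "psd_on A K \<Longrightarrow> finite F \<Longrightarrow> F \<subseteq> A \<Longrightarrow> 0 \<le> hform F K c"
  by (simp add: psd_on_def)

lemma psd_on_subset: "psd_on A K \<Longrightarrow> B \<subseteq> A \<Longrightarrow> psd_on B K"
  by (auto simp: psd_on_def)

lemma hform_cong:
  assumes "\<And>i j. i \<in> F \<Longrightarrow> j \<in> F \<Longrightarrow> K i j = L i j" "\<And>i. i \<in> F \<Longrightarrow> c i = d i"
  shows "hform F K c = hform F L d"
  unfolding hform_def using assms by (intro sum.cong) auto

lemma psd_on_cong:
  assumes "\<And>i j. i \<in> A \<Longrightarrow> j \<in> A \<Longrightarrow> K i j = L i j"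
  shows "psd_on A K \<longleftrightarrow> psd_on A L"
proof -
  have "hform F K c = hform F L c" if "F \<subseteq> A" for F c
    using that assms by (intro hform_cong) auto
  then show ?thesis by (simp add: psd_on_def)
qed

lemma hform_restrict:
  assumes "finite F" "E \<subseteq> F"
    "\<And>i j. i \<in> F \<Longrightarrow> j \<in> F \<Longrightarrow> i \<notin> E \<or> j \<notin> E \<Longrightarrow> c i * cnj (c j) * K i j = 0"
  shows "hform F K c = hform E K c"
proof -
  have "(\<Sum>i\<in>F. \<Sum>j\<in>F. c i * cnj (c j) * K i j) = (\<Sum>i\<in>E. \<Sum>j\<in>F. c i * cnj (c j) * K i j)"
    by (rule sum.mono_neutral_right) (use assms in \<open>auto intro!: sum.neutral\<close>)
  also have "\<dots> = (\<Sum>i\<in>E. \<Sum>j\<in>E. c i * cnj (c j) * K i j)"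
    by (rule sum.cong[OF refl], rule sum.mono_neutral_right) (use assms in auto)
  finally show ?thesis by (simp add: hform_def)
qed

lemma psd_on_finiteI:
  assumes "finite A" "\<And>c. 0 \<le> hform A K c"
  shows "psd_on A K"
  unfolding psd_on_def
proof (intro allI impI)
  fix F and c :: "'a \<Rightarrow> complex" assume F: "finite F" "F \<subseteq> A"
  let ?d = "\<lambda>i. if i \<in> F then c i else 0"
  have "hform A K ?d = hform F K ?d"
    using assms F by (intro hform_restrict) auto
  also have "\<dots> = hform F K c" by (rule hform_cong) auto
  finally show "0 \<le> hform F K c" using assms(2) by metis
qed

lemma hform_insert:
  assumes "finite F" "x \<notin> F"
  shows "hform (insert x F) K c = c x * cnj (c x) * K x x + (\<Sum>j\<in>F. c x * cnj (c j) * K x j)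
     + (\<Sum>i\<in>F. c i * cnj (c x) * K i x) + hform F K c"
  using assms by (simp add: hform_def sum.distrib algebra_simps)

lemma psd_diag: "psd_on A K \<Longrightarrow> i \<in> A \<Longrightarrow> 0 \<le> K i i"
  using psd_onD[of A K "{i}" "\<lambda>_. 1"] by (simp add: hform_def)

lemma psd_diag_real: "psd_on A K \<Longrightarrow> i \<in> A \<Longrightarrow> K i i = complex_of_real (Re (K i i))"
  using psd_diag[of A K i] by (simp add: less_eq_complex_def complex_eq_iff)

lemma psd_hermitian:
  assumes "psd_on A K" "i \<in> A" "j \<in> A"
  shows "K j i = cnj (K i j)"
proof (cases "i = j")
  case True
  then show ?thesis using psd_diag[OF assms(1,2)] by (simp add: complex_eq_iff less_eq_complex_def)
next
  case False
  have h: "0 \<le> hform {i,j} K c" for c using assms by (intro psd_onD) auto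
  \<comment> \<open>Reality of the form at the coefficients (1, 1) and (1, \<i>) determines
    \<open>K j i\<close> from \<open>K i j\<close>.\<close>
  have "Im (K i j + K j i) = 0"
    using h[of "\<lambda>_. 1"] psd_diag[OF assms(1,2)] psd_diag[OF assms(1,3)] False
    by (simp add: hform_def less_eq_complex_def)
  moreover have "Re (K i j) = Re (K j i)"
    using h[of "\<lambda>x. if x = i then 1 else \<i>"] psd_diag[OF assms(1,2)] psd_diag[OF assms(1,3)] False
    by (simp add: hform_def less_eq_complex_def)
  ultimately show ?thesis by (simp add: complex_eq_iff)
qed

section \<open>Algebra of the form, closure properties and Gram factorization\<close>

lemma complex_nonneg_iff: "(0::complex) \<le> z \<longleftrightarrow> Im z = 0 \<and> 0 \<le> Re z"
  by (auto simp: less_eq_complex_def)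

lemma mult_cnj_nonneg: "0 \<le> z * cnj z"
  by (simp add: complex_nonneg_iff)

lemma hform_add: "hform F (\<lambda>i j. K i j + L i j) c = hform F K c + hform F L c"
  by (simp add: hform_def sum.distrib algebra_simps)

lemma hform_diff: "hform F (\<lambda>i j. K i j - L i j) c = hform F K c - hform F L c"
  by (simp add: hform_def sum_subtractf algebra_simps)

lemma hform_scale: "hform F (\<lambda>i j. r * K i j) c = r * hform F K c"
  by (simp add: hform_def sum_distrib_left algebra_simps)

lemma hform_rescale: "hform F (\<lambda>i j. v i * cnj (v j) * K i j) c = hform F K (\<lambda>i. c i * v i)"
  by (simp add: hform_def algebra_simps)

lemma hform_rank1: "hform F (\<lambda>i j. v i * cnj (v j)) c = (\<Sum>i\<in>F. c i * v i) * cnj (\<Sum>i\<in>F. c i * v i)"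
  by (simp add: hform_def sum_product cnj_sum algebra_simps)

lemma psd_add: "psd_on A K \<Longrightarrow> psd_on A L \<Longrightarrow> psd_on A (\<lambda>i j. K i j + L i j)"
  by (simp add: psd_on_def hform_add)

lemma psd_scale: "psd_on A K \<Longrightarrow> 0 \<le> r \<Longrightarrow> psd_on A (\<lambda>i j. r * K i j)"
  by (simp add: psd_on_def hform_scale)

lemma psd_rescale: "psd_on A K \<Longrightarrow> psd_on A (\<lambda>i j. v i * cnj (v j) * K i j)"
  by (simp add: psd_on_def hform_rescale)

lemma psd_rank1: "psd_on A (\<lambda>i j. v i * cnj (v j))"
  unfolding psd_on_def hform_rank1 using mult_cnj_nonneg by blast

lemma psd_one: "psd_on A (\<lambda>i j. 1)"
  using psd_rank1[of A "\<lambda>_. 1"] by simp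

text \<open>The two-point form at \<open>- t * cnj z\<close> and 1 is the real quadratic t^2 |z|^2 a
  - 2 t |z|^2 + b. Its value at t = 1/a gives the inequality; if a = 0 it is affine in t and
  unbounded below unless z = 0.\<close>

lemma psd_cauchy:
  assumes "psd_on A K" "i \<in> A" "j \<in> A"
  shows "(cmod (K i j))\<^sup>2 \<le> Re (K i i) * Re (K j j)"
proof (cases "i = j")
  case True
  then show ?thesis using psd_diag[OF assms(1,2)]
    unfolding cmod_power2 complex_nonneg_iff by (simp add: power2_eq_square)
next
  case False
  define a b z where "a = Re (K i i)" and "b = Re (K j j)" and "z = K i j"
  have ab: "K i i = complex_of_real a" "K j j = complex_of_real b" "0 \<le> a" "0 \<le> b"
    using psd_diag_real[OF assms(1)] psd_diag[OF assms(1)] assms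
    by (auto simp: a_def b_def complex_nonneg_iff)
  have zji: "K j i = cnj z" using psd_hermitian[OF assms] by (simp add: z_def)
  have h: "0 \<le> Re (p * cnj p * a + p * cnj q * z + q * cnj p * cnj z + q * cnj q * b)" for p q
    using psd_onD[OF assms(1), of "{i,j}" "\<lambda>x. if x = i then p else q"] assms False
    by (simp add: hform_def complex_nonneg_iff z_def[symmetric] zji ab algebra_simps)
  have zz: "z * cnj z = complex_of_real ((cmod z)\<^sup>2)" by (simp only: complex_norm_square)
  have h1: "0 \<le> t^2 * (cmod z)^2 * a - 2 * t * (cmod z)\<^sup>2 + b" for t :: real
  proof -
    have "(- t * cnj z) * cnj (- t * cnj z) * a + (- t * cnj z) * cnj 1 * z + 1 * cnj (- t * cnj z) * cnj z + 1 * cnj 1 * b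
       = complex_of_real (t^2 * a) * (z * cnj z) - complex_of_real (2 * t) * (z * cnj z) + b"
      by (simp add: power2_eq_square algebra_simps)
    also have "\<dots> = complex_of_real (t^2 * a * (cmod z)\<^sup>2 - 2 * t * (cmod z)\<^sup>2 + b)"
      unfolding zz by simp
    finally have "Re ((- t * cnj z) * cnj (- t * cnj z) * a + (- t * cnj z) * cnj 1 * z + 1 * cnj (- t * cnj z) * cnj z + 1 * cnj 1 * b)
       = t^2 * a * (cmod z)\<^sup>2 - 2 * t * (cmod z)\<^sup>2 + b" by (simp only: Re_complex_of_real)
    then show ?thesis using h[of "- t * cnj z" 1] by (simp only: mult.assoc mult.commute[of a])
  qed
  show ?thesis
  proof (cases "a = 0")
    case True
    have "(cmod z)\<^sup>2 = 0"
    proof (rule ccontr)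
      assume nz: "(cmod z)\<^sup>2 \<noteq> 0"
      then show False using h1[of "(b+1) / (cmod z)\<^sup>2"] True ab by simp
    qed
    then show ?thesis using ab by (simp add: z_def a_def b_def)
  next
    case False
    then have "0 < a" using ab by simp
    have "(1/a)^2 * (cmod z)\<^sup>2 * a = (cmod z)\<^sup>2 / a" using False by (simp add: power2_eq_square)
    then have "0 \<le> b - (cmod z)\<^sup>2 / a" using h1[of "1/a"] by simp
    then show ?thesis using \<open>0 < a\<close> by (simp add: z_def[symmetric] a_def[symmetric] b_def[symmetric] field_simps)
  qed
qed

lemma psd_zero_row:
  assumes "psd_on A K" "i \<in> A" "j \<in> A" "K i i = 0"
  shows "K i j = 0" "K j i = 0"
proof -
  show "K i j = 0" using psd_cauchy[OF assms(1-3)] assms(4) by simp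
  then show "K j i = 0" using psd_hermitian[OF assms(1-3)] by simp
qed

lemma psd_schur_complement:
  assumes "psd_on A K" "x \<in> A" "K x x \<noteq> 0"
  shows "psd_on A (\<lambda>i j. K i j - K i x * K x j / K x x)"
  unfolding psd_on_def
proof (intro allI impI)
  fix F c assume F: "finite F" "F \<subseteq> A"
  define L where "L = (\<lambda>i j. K i j - K i x * K x j / K x x)"
  define E where "E = F - {x}"
  have E: "finite E" "x \<notin> E" "insert x E \<subseteq> A" using F assms(2) by (auto simp: E_def)
  define s where "s = (\<Sum>i\<in>E. c i * K i x)"
  define d where "d = c(x := - s / K x x)"
  have herm: "cnj (K i x) = K x i" if "i \<in> E" for i
    using psd_hermitian[OF assms(1), of i x] that E(3) assms(2) by auto
  have xr: "cnj (K x x) = K x x" using psd_hermitian[OF assms(1,2,2)] by simp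
  have cs: "cnj s = (\<Sum>j\<in>E. cnj (c j) * K x j)"
    unfolding s_def cnj_sum by (rule sum.cong) (auto simp: herm)
  have dE: "d i = c i" if "i \<in> E" for i using that E by (auto simp: d_def)
  have "hform F L c = hform E L c"
    using F assms(3) by (intro hform_restrict) (auto simp: E_def L_def)
  also have "\<dots> = hform E K c - s * cnj s / K x x"
  proof -
    have "L = (\<lambda>i j. K i j - inverse (K x x) * (K i x * K x j))"
      by (simp add: L_def divide_inverse mult.commute)
    then have "hform E L c = hform E K c - hform E (\<lambda>i j. inverse (K x x) * (K i x * K x j)) c"
      by (simp only: hform_diff)
    also have "hform E (\<lambda>i j. inverse (K x x) * (K i x * K x j)) c = inverse (K x x) * (s * cnj s)"
      unfolding hform_scale cs unfolding s_def hform_def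
      by (simp add: sum_product algebra_simps del: cnj_sum complex_cnj_mult)
    finally show ?thesis by (simp add: field_simps)
  qed
  also have "\<dots> = hform (insert x E) K d"
  proof -
    have 1: "(\<Sum>j\<in>E. d x * cnj (d j) * K x j) = d x * cnj s"
      unfolding cs sum_distrib_left by (rule sum.cong) (auto simp: dE)
    have 2: "(\<Sum>i\<in>E. d i * cnj (d x) * K i x) = s * cnj (d x)"
      unfolding s_def sum_distrib_right by (rule sum.cong) (auto simp: dE)
    have 3: "hform E K d = hform E K c" by (rule hform_cong) (auto simp: dE)
    have dx: "d x = - s / K x x" by (simp add: d_def)
    show ?thesis
      using hform_insert[OF E(1,2), of K d] assms(3) unfolding 1 2 3 unfolding dx by (simp add: xr field_simps)
  qed
  finally show "0 \<le> hform F (\<lambda>i j. K i j - K i x * K x j / K x x) c"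
    using psd_onD[OF assms(1) _ E(3)] E(1) by (simp add: L_def)
qed

text \<open>Cholesky factorization: a point with nonzero diagonal entry contributes one coordinate
  and the Schur complement supplies the others; a zero diagonal entry forces a zero row. On finitely
  many points this finite-dimensional model replaces the Hilbert space.\<close>

lemma psd_gram:
  assumes "finite F" "psd_on F K"
  shows "\<exists>(n::nat) v. \<forall>i\<in>F. \<forall>j\<in>F. K i j = (\<Sum>m<n. v m i * cnj (v m j))"
  using assms
proof (induction F arbitrary: K rule: finite_induct)
  case empty
  then show ?case by auto
next
  case (insert x F)
  show ?case
  proof (cases "K x x = 0")
    case True
    obtain n v where v: "\<forall>i\<in>F. \<forall>j\<in>F. K i j = (\<Sum>m<(n::nat). v m i * cnj (v m j))"
      using insert.IH[OF psd_on_subset[OF insert.prems subset_insertI]] by blast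
    have z: "K x j = 0" "K j x = 0" if "j \<in> insert x F" for j
      using psd_zero_row[OF insert.prems, of x j] that True by auto
    show ?thesis
      by (rule exI[of _ n], rule exI[of _ "\<lambda>m i. if i = x then 0 else v m i"])
        (use v z insert.hyps in \<open>auto intro!: sum.cong\<close>)
  next
    case False
    define L where "L = (\<lambda>i j. K i j - K i x * K x j / K x x)"
    have "psd_on (insert x F) L" unfolding L_def
      by (rule psd_schur_complement[OF insert.prems]) (use False in auto)
    then obtain n v where v: "\<forall>i\<in>F. \<forall>j\<in>F. L i j = (\<Sum>m<(n::nat). v m i * cnj (v m j))"
      using insert.IH[OF psd_on_subset[OF _ subset_insertI]] by blast
    define r where "r = Re (K x x)"
    have r: "K x x = complex_of_real r" "0 < r"
      using psd_diag_real[OF insert.prems, of x] psd_diag[OF insert.prems, of x] False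
      by (auto simp: r_def complex_nonneg_iff complex_eq_iff less_le)
    have rr: "complex_of_real (sqrt r) * complex_of_real (sqrt r) = complex_of_real r"
      using r(2) by (simp flip: of_real_mult)
    define w where "w = (\<lambda>m i. if m = n then K i x / complex_of_real (sqrt r) else if i = x then 0 else v m i)"
    have "K i j = (\<Sum>m<Suc n. w m i * cnj (w m j))" if "i \<in> insert x F" "j \<in> insert x F" for i j
    proof -
      have h: "cnj (K j x) = K x j" using psd_hermitian[OF insert.prems that(2), of x] by simp
      have 1: "w n i * cnj (w n j) = K i x * K x j / K x x"
        using r h by (simp add: w_def rr)
      have 2: "(\<Sum>m<n. w m i * cnj (w m j)) = L i j"
      proof (cases "i = x \<or> j = x")
        case True
        then show ?thesis using False by (auto simp: w_def L_def intro!: sum.neutral)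
      next
        case False
        then have "i \<in> F" "j \<in> F" using that by auto
        then show ?thesis using False v by (auto simp: w_def intro!: sum.cong)
      qed
      show ?thesis using 1 2 by (simp add: L_def)
    qed
    then show ?thesis by blast
  qed
qed

lemma hform_gram:
  assumes "\<And>i j. i \<in> F \<Longrightarrow> j \<in> F \<Longrightarrow> K i j = (\<Sum>m<(n::nat). v m i * cnj (v m j))"
  shows "hform F K c = (\<Sum>m<n. (\<Sum>i\<in>F. c i * v m i) * cnj (\<Sum>i\<in>F. c i * v m i))"
proof -
  have "hform F K c = (\<Sum>i\<in>F. \<Sum>j\<in>F. \<Sum>m<n. c i * cnj (c j) * (v m i * cnj (v m j)))"
    unfolding hform_def by (intro sum.cong refl) (simp add: assms sum_distrib_left)
  also have "\<dots> = (\<Sum>m<n. \<Sum>i\<in>F. \<Sum>j\<in>F. c i * cnj (c j) * (v m i * cnj (v m j)))"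
    by (subst sum.swap, subst sum.swap) (simp add: sum.swap[of _ F "{..<n}"])
  also have "\<dots> = (\<Sum>m<n. (\<Sum>i\<in>F. c i * v m i) * cnj (\<Sum>i\<in>F. c i * v m i))"
    by (intro sum.cong refl) (simp add: sum_product cnj_sum algebra_simps)
  finally show ?thesis .
qed

lemma psd_gramI:
  assumes "\<And>F. finite F \<Longrightarrow> F \<subseteq> A \<Longrightarrow> \<exists>(n::nat) v. \<forall>i\<in>F. \<forall>j\<in>F. K i j = (\<Sum>m<n. v m i * cnj (v m j))"
  shows "psd_on A K"
  unfolding psd_on_def
proof (intro allI impI)
  fix F c assume F: "finite F" "F \<subseteq> A"
  obtain n v where "\<forall>i\<in>F. \<forall>j\<in>F. K i j = (\<Sum>m<(n::nat). v m i * cnj (v m j))" using assms[OF F] by blast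
  then have "hform F K c = (\<Sum>m<n. (\<Sum>i\<in>F. c i * v m i) * cnj (\<Sum>i\<in>F. c i * v m i))"
    by (intro hform_gram) auto
  also have "0 \<le> \<dots>" by (intro sum_nonneg mult_cnj_nonneg)
  finally show "0 \<le> hform F K c" .
qed

text \<open>Schur product theorem: a Gram factorization of \<open>K\<close> writes the form of the
  product as a sum of forms of \<open>L\<close> at rescaled coefficients.\<close>

lemma psd_mult:
  assumes "psd_on A K" "psd_on A L"
  shows "psd_on A (\<lambda>i j. K i j * L i j)"
  unfolding psd_on_def
proof (intro allI impI)
  fix F c assume F: "finite F" "F \<subseteq> A"
  obtain n v where v: "\<forall>i\<in>F. \<forall>j\<in>F. K i j = (\<Sum>m<(n::nat). v m i * cnj (v m j))"
    using psd_gram[OF F(1) psd_on_subset[OF assms(1) F(2)]] by blast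
  have "hform F (\<lambda>i j. K i j * L i j) c
      = (\<Sum>i\<in>F. \<Sum>j\<in>F. \<Sum>m<n. (c i * v m i) * cnj (c j * v m j) * L i j)"
    unfolding hform_def using v
    by (intro sum.cong refl) (simp add: sum_distrib_left sum_distrib_right algebra_simps)
  also have "\<dots> = (\<Sum>m<n. hform F L (\<lambda>i. c i * v m i))"
    unfolding hform_def
    by (subst sum.swap, subst sum.swap) (simp add: sum.swap[of _ F "{..<n}"])
  also have "0 \<le> \<dots>" by (intro sum_nonneg psd_onD[OF assms(2) F])
  finally show "0 \<le> hform F (\<lambda>i j. K i j * L i j) c" .
qed

lemma psd_prod:
  assumes "finite J" "\<And>m. m \<in> J \<Longrightarrow> psd_on A (K m)"
  shows "psd_on A (\<lambda>i j. \<Prod>m\<in>J. K m i j)"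
  using assms by (induction J rule: finite_induct) (auto intro: psd_one psd_mult)

text \<open>Gram vectors are pulled back instead of coefficients, because \<open>f\<close> may
  identify points and then the sums cannot be reindexed.\<close>

lemma psd_pullback:
  assumes "psd_on A K" "f ` B \<subseteq> A"
  shows "psd_on B (\<lambda>i j. K (f i) (f j))"
proof (rule psd_gramI)
  fix F assume F: "finite F" "F \<subseteq> B"
  obtain n v where v: "\<forall>i\<in>f`F. \<forall>j\<in>f`F. K i j = (\<Sum>m<(n::nat). v m i * cnj (v m j))"
    using psd_gram[of "f`F" K] psd_on_subset[OF assms(1), of "f`F"] F assms(2) by blast
  then show "\<exists>(n::nat) v. \<forall>i\<in>F. \<forall>j\<in>F. K (f i) (f j) = (\<Sum>m<n. v m i * cnj (v m j))"
    by (intro exI[of _ n] exI[of _ "\<lambda>m i. v m (f i)"]) auto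
qed

lemma psd_kernel_iff: "psd_kernel k \<longleftrightarrow> psd_on UNIV k"
proof
  assume k: "psd_kernel k"
  show "psd_on UNIV k" unfolding psd_on_def
  proof (intro allI impI)
    fix F :: "'a set" and c assume F: "finite F"
    obtain x where x: "bij_betw x {..<card F} F"
      using ex_bij_betw_nat_finite[OF F] by (auto simp: lessThan_atLeast0)
    have "hform F k c = (\<Sum>i<card F. \<Sum>j<card F. c (x i) * cnj (c (x j)) * k (x i) (x j))"
      unfolding hform_def by (simp add: sum.reindex_bij_betw[OF x, symmetric])
    then show "0 \<le> hform F k c"
      using k[unfolded psd_kernel_def, rule_format, of "\<lambda>i. c (x i)" x "card F"]
      by (simp add: Let_def complex_nonneg_iff)
  qed
next
  assume k: "psd_on UNIV k"
  show "psd_kernel k" unfolding psd_kernel_def Let_def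
  proof (intro allI)
    fix n x c
    show "Im (\<Sum>i<(n::nat). \<Sum>j<n. c i * cnj (c j) * k (x i) (x j)) = 0 \<and>
       0 \<le> Re (\<Sum>i<n. \<Sum>j<n. c i * cnj (c j) * k (x i) (x j))"
      using psd_onD[OF psd_pullback[OF k, of x "{..<n}"], of "{..<n}" c]
      by (simp add: hform_def complex_nonneg_iff)
  qed
qed

text \<open>In terms of Gram vectors, \<open>a\<close> holds the coefficients of the orthogonal
  projection of the vector of \<open>x\<close> onto the span of those of \<open>F\<close>.
  Eliminating one point at a time by Schur complements also covers singular matrices, where
  \<open>a\<close> is not unique.\<close>

lemma psd_row_projection:
  assumes "finite F" "psd_on (insert x F) K"
  shows "\<exists>a. \<forall>j\<in>F. K x j = (\<Sum>i\<in>F. a i * K i j)"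
  using assms
proof (induction F arbitrary: K rule: finite_induct)
  case empty
  then show ?case by auto
next
  case (insert y F)
  show ?case
  proof (cases "K y y = 0")
    case True
    have "psd_on (insert x F) K" by (rule psd_on_subset[OF insert.prems]) auto
    then obtain a where a: "\<forall>j\<in>F. K x j = (\<Sum>i\<in>F. a i * K i j)" using insert.IH by blast
    have z: "K y j = 0" "K j y = 0" if "j \<in> insert x (insert y F)" for j
      using psd_zero_row[OF insert.prems, of y j] that True by auto
    show ?thesis
      by (rule exI[of _ a]) (use a z insert.hyps in auto)
  next
    case False
    define L where "L = (\<lambda>i j. K i j - K i y * K y j / K y y)"
    have "psd_on (insert x (insert y F)) L" unfolding L_def
      by (rule psd_schur_complement[OF insert.prems]) (use False in auto)
    then have "psd_on (insert x F) L" by (rule psd_on_subset) auto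
    then obtain a where a: "\<forall>j\<in>F. L x j = (\<Sum>i\<in>F. a i * L i j)" using insert.IH by blast
    \<comment> \<open>The coefficient at \<open>y\<close> is forced by the equation in column
      \<open>y\<close>; in the other columns it restores exactly what the Schur complement
      subtracted.\<close>
    define b where "b = a(y := (K x y - (\<Sum>i\<in>F. a i * K i y)) / K y y)"
    have bF: "(\<Sum>i\<in>F. b i * K i j) = (\<Sum>i\<in>F. a i * K i j)" for j
      using insert.hyps by (intro sum.cong) (auto simp: b_def)
    have "K x j = (\<Sum>i\<in>insert y F. b i * K i j)" if "j \<in> insert y F" for j
    proof (cases "j = y")
      case True
      then show ?thesis using insert.hyps False by (simp add: bF) (simp add: b_def)
    next
      case neq: False
      then have "L x j = (\<Sum>i\<in>F. a i * L i j)" using a that by auto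
      also have "\<dots> = (\<Sum>i\<in>F. a i * K i j) - (\<Sum>i\<in>F. a i * K i y) * K y j / K y y"
        by (simp add: L_def algebra_simps sum_subtractf sum_distrib_left sum_distrib_right sum_divide_distrib)
      finally have "K x j = (\<Sum>i\<in>F. a i * K i j) + (K x y - (\<Sum>i\<in>F. a i * K i y)) / K y y * K y j"
        using False by (simp add: L_def field_simps)
      then show ?thesis using insert.hyps by (simp add: bF) (simp add: b_def)
    qed
    then show ?thesis by blast
  qed
qed

section \<open>Lower bounds for Gram matrices of complete Pick kernels\<close>

text \<open>The chord of the convex function 4^(-x) over [0,1] joins (0,1) to (1,1/4), hence the
  slope -3/4.\<close>

lemma powr_4_le_three_quarters: "4 powr (- x) \<le> 1 - 3 / 4 * x" if "0 \<le> x" "x \<le> 1" for x :: real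
proof -
  have "convex_on UNIV (\<lambda>x. exp (x::real))" by (rule exp_convex)
  then have "exp ((1 - x) *\<^sub>R 0 + x *\<^sub>R (- ln 4)) \<le> (1 - x) * exp 0 + x * exp (- ln 4 :: real)"
    using that by (intro convex_onD) auto
  then show ?thesis by (simp add: powr_def exp_minus algebra_simps)
qed

text \<open>Same base, shorter chord: over [0,1/2] it ends at (1/2,1/2), which gives slope -1. The
  cutoff 1/2 becomes the threshold between near and far points.\<close>

lemma powr_4_le_half: "4 powr (- x) \<le> 1 - x" if "0 \<le> x" "x \<le> 1 / 2" for x :: real
proof -
  have "convex_on UNIV (\<lambda>x. exp (x::real))" by (rule exp_convex)
  then have "exp ((1 - 2 * x) *\<^sub>R 0 + (2 * x) *\<^sub>R (- ln 2)) \<le> (1 - 2 * x) * exp 0 + (2 * x) * exp (- ln 2 :: real)"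
    using that by (intro convex_onD) auto
  moreover have "ln 4 = 2 * ln (2::real)" using ln_realpow[of 2 2] by simp
  ultimately show ?thesis by (simp add: powr_def exp_minus algebra_simps)
qed

text \<open>\<open>U\<close> is the Gram kernel of the map into the ball, kept without the map: this
  form can be pulled back along any sequence of points.\<close>

locale pick_kernel =
  fixes U s :: "'i \<Rightarrow> 'i \<Rightarrow> complex"
  assumes psd_U: "psd_on UNIV U"
    and U_diag: "\<And>i. Re (U i i) < 1"
    and s_eq: "\<And>i j. s i j = 1 / (1 - U i j)"
begin

lemma cmod_U_square_le: "(cmod (U i j))\<^sup>2 \<le> Re (U i i)"
proof -
  have "(cmod (U i j))\<^sup>2 \<le> Re (U i i) * Re (U j j)" by (rule psd_cauchy[OF psd_U]) auto
  also have "\<dots> \<le> Re (U i i) * 1"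
    using psd_diag[OF psd_U, of i] U_diag[of j] by (intro mult_left_mono) (auto simp: complex_nonneg_iff)
  finally show ?thesis by simp
qed

lemma U_neq_1: "U i j \<noteq> 1"
  using cmod_U_square_le[of i j] U_diag[of i] by auto

lemma s_nonzero: "s i j \<noteq> 0"
  using U_neq_1[of i j] by (simp add: s_eq)

lemma s_hermitian: "s j i = cnj (s i j)"
  using psd_hermitian[OF psd_U, of i j] by (simp add: s_eq)

lemma cnj_s: "cnj (s i j) = s j i"
  by (simp add: s_hermitian[of j i])

lemma s_diag_real: "s i i = complex_of_real (Re (s i i))"
  using arg_cong[OF cnj_s[of i i], of Im] by (simp add: complex_eq_iff)

lemma s_diag_pos: "0 < Re (s i i)"
proof -
  have "U i i = complex_of_real (Re (U i i))" using psd_diag_real[OF psd_U, of i] by simp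
  then have "s i i = complex_of_real (1 / (1 - Re (U i i)))" by (metis s_eq of_real_1 of_real_diff of_real_divide)
  then have "Re (s i i) = 1 / (1 - Re (U i i))" by (metis Re_complex_of_real)
  then show ?thesis using U_diag[of i] by simp
qed

text \<open>If \<open>U\<close> is the Gram kernel of a map \<open>b\<close> into a unit ball, \<open>moebius x\<close> is the Gram kernel of \<open>b\<close>
  followed by the automorphism of the ball that moves \<open>b x\<close> to the origin.\<close>
definition moebius :: "'i \<Rightarrow> 'i \<Rightarrow> 'i \<Rightarrow> complex" where
  "moebius x i j = 1 - s i x * s x j / (s x x * s i j)"

text \<open>With \<open>T i = 1 - s i x / s x x\<close> one has \<open>peak x i j = (1 - T i) * cnj (1 - T j) / 4\<close>, and
  \<open>peak x + copeak x = (1 + moebius x) / 2\<close> says that peak and copeak form a contractive row of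
  multipliers. The peak is \<open>1 / 4\<close> at \<open>x\<close>, and the copeak stays close to \<open>1\<close> away from \<open>x\<close>.\<close>
definition peak :: "'i \<Rightarrow> 'i \<Rightarrow> 'i \<Rightarrow> complex" where
  "peak x i j = s i x * s x j / (4 * (s x x)\<^sup>2)"

definition copeak :: "'i \<Rightarrow> 'i \<Rightarrow> 'i \<Rightarrow> complex" where
  "copeak x i j = (1 + moebius x i j) / 2 - peak x i j"

text \<open>The squared modulus of the inner product of two normalized kernel functions of
  \<open>s\<close>, that is, one minus the squared distance between the points. The Carleson
  condition bounds its column sums.\<close>

definition gsq :: "'i \<Rightarrow> 'i \<Rightarrow> real" where
  "gsq i j = (cmod (s i j))\<^sup>2 / (Re (s i i) * Re (s j j))"

lemma psd_U_centered: "psd_on UNIV (\<lambda>i j. U i j - U i x - U x j + U x x)"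
proof (rule psd_gramI)
  fix F :: "'i set" assume F: "finite F"
  obtain n v where v: "\<forall>i\<in>insert x F. \<forall>j\<in>insert x F. U i j = (\<Sum>m<(n::nat). v m i * cnj (v m j))"
    using psd_gram[of "insert x F" U] psd_on_subset[OF psd_U] F by auto
  have "U i j - U i x - U x j + U x x = (\<Sum>m<n. (v m i - v m x) * cnj (v m j - v m x))"
    if "i \<in> F" "j \<in> F" for i j
    using v that by (simp add: algebra_simps sum.distrib sum_subtractf)
  then show "\<exists>(n::nat) v. \<forall>i\<in>F. \<forall>j\<in>F. U i j - U i x - U x j + U x x = (\<Sum>m<n. v m i * cnj (v m j))"
    by (intro exI[of _ n] exI[of _ "\<lambda>m i. v m i - v m x"]) auto
qed

text \<open>The part of \<open>moebius x\<close> left after splitting off the product for the scalar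
  function \<open>1 - s i x / s x x\<close>; up to rescaling it is the Gram kernel of the
  displacement from \<open>x\<close>. It proves positivity of \<open>moebius\<close> and
  \<open>copeak\<close> without an explicit ball automorphism.\<close>

definition defect :: "'i \<Rightarrow> 'i \<Rightarrow> 'i \<Rightarrow> complex" where
  "defect x i j = s i x * s x j / s x x * (U i j - U i x - U x j + U x x)"

lemma inverse_s_diag_nonneg: "0 \<le> inverse (s x x)"
proof -
  have "inverse (s x x) = complex_of_real (inverse (Re (s x x)))" by (metis s_diag_real of_real_inverse)
  then have "Im (inverse (s x x)) = 0" "Re (inverse (s x x)) = inverse (Re (s x x))"
    by (metis Im_complex_of_real, metis Re_complex_of_real)
  then show ?thesis using s_diag_pos[of x] by (simp only: complex_nonneg_iff) simp
qed

lemma psd_defect: "psd_on UNIV (defect x)"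
proof -
  have "defect x = (\<lambda>i j. inverse (s x x) * (s i x * cnj (s j x) * (U i j - U i x - U x j + U x x)))"
    by (intro ext) (simp add: defect_def cnj_s divide_inverse)
  then show ?thesis
    using psd_scale[OF psd_rescale[OF psd_U_centered[of x], of "\<lambda>i. s i x"] inverse_s_diag_nonneg[of x]] by simp
qed

lemma moebius_eq: "moebius x i j = (1 - s i x / s x x) * cnj (1 - s j x / s x x) + defect x i j"
proof -
  have c: "cnj (1 - s j x / s x x) = 1 - s x j / s x x"
    by (simp add: cnj_s)
  define p q r t where "p = 1 - U i x" and "q = 1 - U x j" and "r = 1 - U x x" and "t = 1 - U i j"
  have nz: "p \<noteq> 0" "q \<noteq> 0" "r \<noteq> 0" "t \<noteq> 0"
    using U_neq_1[of i x] U_neq_1[of x j] U_neq_1[of x x] U_neq_1[of i j] by (auto simp: p_def q_def r_def t_def)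
  have s: "s i x = 1 / p" "s x j = 1 / q" "s x x = 1 / r" "s i j = 1 / t"
    by (auto simp: s_eq p_def q_def r_def t_def)
  have u: "U i j - U i x - U x j + U x x = p + q - t - r"
    by (simp add: p_def q_def r_def t_def)
  show ?thesis unfolding c unfolding moebius_def defect_def u s using nz by (simp add: field_simps)
qed

lemma psd_moebius: "psd_on UNIV (moebius x)"
proof -
  have "moebius x = (\<lambda>i j. (1 - s i x / s x x) * cnj (1 - s j x / s x x) + defect x i j)"
    by (intro ext moebius_eq)
  then show ?thesis
    using psd_add[OF psd_rank1[of UNIV "\<lambda>i. 1 - s i x / s x x"] psd_defect[of x]] by simp
qed

lemma moebius_zero: "moebius x x j = 0" "moebius x i x = 0"
  by (simp_all add: moebius_def s_nonzero)

text \<open>The right-hand side is the kernel of the line spanned by s_x. The Moebius row thus maps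
  onto the orthogonal complement of that line, the functions vanishing at \<open>x\<close>, and is
  contractive.\<close>

lemma moebius_complement: "(1 - moebius x i j) * s i j = inverse (s x x) * (s i x * cnj (s j x))"
  using s_nonzero[of i j] by (simp add: moebius_def cnj_s divide_inverse)

lemma psd_moebius_complement: "psd_on UNIV (\<lambda>i j. (1 - moebius x i j) * s i j)"
  unfolding moebius_complement by (intro psd_scale psd_rank1 inverse_s_diag_nonneg)

lemma moebius_diag: "moebius x k k = complex_of_real (1 - gsq x k)"
proof -
  have "s k x * s x k = complex_of_real ((cmod (s x k))\<^sup>2)"
    using complex_norm_square[of "s x k"] by (simp add: cnj_s mult.commute)
  moreover have "s x x * s k k = complex_of_real (Re (s x x) * Re (s k k))"
    by (metis s_diag_real of_real_mult)
  ultimately show ?thesis by (simp add: moebius_def gsq_def)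
qed

lemma gsq_nonneg: "0 \<le> gsq i j"
  using s_diag_pos[of i] s_diag_pos[of j] by (simp add: gsq_def)

lemma gsq_le_1: "gsq x k \<le> 1"
  using psd_diag[OF psd_moebius[of x], of k] unfolding moebius_diag by (simp add: complex_nonneg_iff)

lemma gsq_commute: "gsq i j = gsq j i"
  by (metis gsq_def cnj_s complex_mod_cnj mult.commute)

lemma gsq_self: "gsq i i = 1"
  using moebius_diag[of i i] moebius_zero(1)[of i i] by (simp add: complex_eq_iff)

lemma peak_eq: "peak x i j = s i x / (2 * s x x) * cnj (s j x / (2 * s x x))"
  by (simp add: peak_def power2_eq_square cnj_s)

lemma psd_peak: "psd_on UNIV (peak x)"
proof -
  have "peak x = (\<lambda>i j. s i x / (2 * s x x) * cnj (s j x / (2 * s x x)))" by (intro ext peak_eq)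
  then show ?thesis by (metis psd_rank1)
qed

lemma peak_self: "peak x x x = 1 / 4"
  using s_nonzero[of x x] by (simp add: peak_def power2_eq_square)

text \<open>Put t_i = \<open>1 - s i x / s x x\<close>. The parallelogram identity writes half of 1
  + t_i * cnj t_j as the product for (1 + t) / 2 plus the product for (1 - t) / 2. The latter is the
  peak, so the copeak keeps the former and half of the defect.\<close>

lemma copeak_eq: "copeak x i j = (1 - s i x / (2 * s x x)) * cnj (1 - s j x / (2 * s x x)) + 1 / 2 * defect x i j"
proof -
  define T R where "T = s i x / s x x" and "R = s j x / s x x"
  have e: "s i x / (2 * s x x) = T / 2" "s j x / (2 * s x x) = R / 2" by (simp_all add: T_def R_def)
  have m: "moebius x i j = (1 - T) * cnj (1 - R) + defect x i j"
    unfolding moebius_eq T_def R_def by simp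
  show ?thesis unfolding copeak_def peak_eq e m by (simp add: field_simps)
qed

lemma psd_copeak: "psd_on UNIV (copeak x)"
proof -
  have "copeak x = (\<lambda>i j. (1 - s i x / (2 * s x x)) * cnj (1 - s j x / (2 * s x x)) + 1 / 2 * defect x i j)"
    by (intro ext copeak_eq)
  moreover have "psd_on UNIV (\<lambda>i j. 1 / 2 * defect x i j)"
    by (rule psd_scale[OF psd_defect]) (simp add: complex_nonneg_iff)
  ultimately show ?thesis
    using psd_add[OF psd_rank1[of UNIV "\<lambda>i. 1 - s i x / (2 * s x x)"]] by simp
qed

lemma psd_peak_copeak_complement: "psd_on UNIV (\<lambda>i j. (1 - peak x i j - copeak x i j) * s i j)"
proof -
  have "(1 - peak x i j - copeak x i j) * s i j = 1 / 2 * ((1 - moebius x i j) * s i j)" for i j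
    by (simp add: copeak_def field_simps)
  then show ?thesis
    using psd_scale[OF psd_moebius_complement[of x], of "1 / 2"] by (simp only: complex_nonneg_iff) simp
qed

text \<open>The ordering \<open>s k k \<le> s x x\<close> is what makes \<open>peak x\<close> quadratically small at \<open>k\<close>.\<close>
lemma copeak_diag_ge:
  assumes "Re (s k k) \<le> Re (s x x)"
  shows "4 powr (- gsq x k) \<le> Re (copeak x k k)"
proof -
  have "peak x k k = complex_of_real ((cmod (s x k))\<^sup>2 / (4 * (Re (s x x))\<^sup>2))"
  proof -
    have "s k x * s x k = complex_of_real ((cmod (s x k))\<^sup>2)"
      using complex_norm_square[of "s x k"] by (simp add: cnj_s mult.commute)
    moreover have "(s x x)\<^sup>2 = complex_of_real ((Re (s x x))\<^sup>2)" by (metis s_diag_real of_real_power)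
    ultimately show ?thesis by (simp add: peak_def)
  qed
  then have eq: "Re (copeak x k k) = 1 - gsq x k / 2 - (cmod (s x k))\<^sup>2 / (4 * (Re (s x x))\<^sup>2)"
    by (simp add: copeak_def moebius_diag field_simps)
  have "(cmod (s x k))\<^sup>2 / (4 * (Re (s x x))\<^sup>2) \<le> (cmod (s x k))\<^sup>2 / (4 * (Re (s x x) * Re (s k k)))"
    using assms s_diag_pos[of x] s_diag_pos[of k] by (intro divide_left_mono) (auto simp: power2_eq_square)
  also have "\<dots> = gsq x k / 4" by (simp add: gsq_def)
  finally show ?thesis using eq powr_4_le_three_quarters[OF gsq_nonneg gsq_le_1, of x k] by linarith
qed

text \<open>By 1 - M * m = (1 - M) + M * (1 - m), composing contractive rows gives a contractive
  row; the factor M is absorbed by the Schur product.\<close>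

lemma psd_prod_moebius_complement:
  assumes "finite J"
  shows "psd_on UNIV (\<lambda>i j. (1 - (\<Prod>x\<in>J. moebius x i j)) * s i j)"
  using assms
proof (induction J rule: finite_induct)
  case empty
  show ?case by (simp add: psd_on_def hform_def)
next
  case (insert y J)
  have "psd_on UNIV (\<lambda>i j. (1 - (\<Prod>x\<in>J. moebius x i j)) * s i j
      + (\<Prod>x\<in>J. moebius x i j) * ((1 - moebius y i j) * s i j))"
    by (intro psd_add insert.IH psd_mult psd_prod insert.hyps psd_moebius psd_moebius_complement)
  then show ?case using insert.hyps by (simp add: algebra_simps)
qed

text \<open>The product of the Moebius kernels of all points of \<open>F\<close> vanishes on
  \<open>F\<close>, so there \<open>s\<close> coincides with a complement kernel already known to be
  positive. This replaces the geometric series in \<open>U\<close>.\<close>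

lemma psd_s: "psd_on UNIV s"
  unfolding psd_on_def
proof (intro allI impI)
  fix F :: "'i set" and c assume F: "finite F"
  have "(\<Prod>x\<in>F. moebius x i j) = 0" if "i \<in> F" for i j
    using prod_zero[OF F, of "\<lambda>x. moebius x i j"] that moebius_zero(1) by blast
  then have "hform F s c = hform F (\<lambda>i j. (1 - (\<Prod>x\<in>F. moebius x i j)) * s i j) c"
    using F by (intro hform_cong) auto
  then show "0 \<le> hform F s c"
    using psd_onD[OF psd_prod_moebius_complement[OF F] F] by simp
qed

end

section \<open>From the complete Pick kernel to the pair: lower bounds for the form of
  \<open>l\<close>\<close>

locale pick_pair = pick_kernel U s for U s :: "'i \<Rightarrow> 'i \<Rightarrow> complex" +
  fixes g l :: "'i \<Rightarrow> 'i \<Rightarrow> complex"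
  assumes psd_g: "psd_on UNIV g" and l_eq: "\<And>i j. l i j = s i j * g i j"
begin

lemma psd_times_l:
  assumes "psd_on UNIV (\<lambda>i j. K i j * s i j)"
  shows "psd_on UNIV (\<lambda>i j. K i j * l i j)"
proof -
  have "(\<lambda>i j. K i j * l i j) = (\<lambda>i j. K i j * s i j * g i j)" by (simp add: l_eq mult.assoc)
  then show ?thesis using psd_mult[OF assms psd_g] by simp
qed

lemma psd_l: "psd_on UNIV l"
  using psd_times_l[of "\<lambda>_ _. 1"] psd_s by simp

text \<open>The product of the copeaks of the points treated so far is absorbed into \<open>D\<close>; the points are
  treated in the order of decreasing \<open>s k k\<close>.\<close>
lemma hform_l_telescope:
  fixes \<epsilon> :: real and Q :: "'i \<Rightarrow> 'i set" and P :: "'i \<Rightarrow> 'i \<Rightarrow> 'i \<Rightarrow> complex"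
  assumes "finite A" "0 \<le> \<epsilon>"
    and sep: "\<And>k. k \<in> A \<Longrightarrow> psd_on (Q k) (\<lambda>i j. l i j - (if i = k \<and> j = k then \<epsilon> * l k k else 0))"
    and Q: "\<And>k. k \<in> A \<Longrightarrow> k \<in> Q k"
    and P: "\<And>k. k \<in> A \<Longrightarrow> psd_on UNIV (P k)"
      "\<And>k. k \<in> A \<Longrightarrow> psd_on UNIV (\<lambda>i j. (1 - P k i j) * s i j)"
      "\<And>k i j. k \<in> A \<Longrightarrow> i \<in> A \<Longrightarrow> j \<in> A \<Longrightarrow> i \<notin> Q k \<or> j \<notin> Q k \<Longrightarrow> P k i j = 0"
    and "B \<subseteq> A" "psd_on UNIV D"
  shows "(\<Sum>k\<in>B. \<epsilon> / 4 * (cmod (c k))\<^sup>2 * Re (l k k) * Re (D k k) * Re (P k k k) * 4 powr (- (\<Sum>i\<in>B. gsq i k)))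
    \<le> Re (hform A (\<lambda>i j. D i j * l i j) c)"
proof -
  have "finite B" using assms(1,8) finite_subset by blast
  then show ?thesis using assms(8,9)
  \<comment> \<open>The ranking inserts the point with the largest \<open>s x x\<close> last, so the
    point peeled off dominates all of \<open>S\<close> and its copeak is controlled there.
    \<open>D\<close> is arbitrary because it absorbs that copeak.\<close>
  proof (induction B arbitrary: D rule: finite_ranking_induct[where f = "\<lambda>k. Re (s k k)"])
    case empty
    then show ?case
      using psd_onD[OF psd_mult[OF empty.prems(2) psd_l] assms(1)] by (simp add: complex_nonneg_iff)
  next
    case (insert x S)
    show ?case
    proof (cases "x \<in> S")
      case True
      then show ?thesis using insert.IH insert.prems by (simp add: insert_absorb)
    next
      case xS: False
      have x: "x \<in> A" and S: "S \<subseteq> A" using insert.prems by auto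
      define D' where "D' = (\<lambda>i j. D i j * copeak x i j)"
      define R where "R = (\<lambda>i j. D i j * (peak x i j * P x i j))"
      have psdD': "psd_on UNIV D'" unfolding D'_def by (intro psd_mult insert.prems psd_copeak)
      have psdR: "psd_on UNIV R" unfolding R_def by (intro psd_mult insert.prems psd_peak P x)
      have rest: "psd_on UNIV (\<lambda>i j. (1 - peak x i j * P x i j - copeak x i j) * s i j)"
      proof -
        have "(\<lambda>i j. (1 - peak x i j * P x i j - copeak x i j) * s i j) =
           (\<lambda>i j. (1 - peak x i j - copeak x i j) * s i j + peak x i j * ((1 - P x i j) * s i j))"
          by (simp add: algebra_simps)
        then show ?thesis
          using psd_add[OF psd_peak_copeak_complement psd_mult[OF psd_peak P(2)[OF x]], of x x] by simp
      qed
      \<comment> \<open>\<open>l\<close> is split along the row made of the peak times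
        \<open>P x\<close>, the copeak and a remainder: separation at \<open>x\<close> handles the
        first part, the induction with \<open>D'\<close> the second, and the third is
        nonnegative.\<close>
      have decomp: "hform A (\<lambda>i j. D i j * l i j) c = hform A (\<lambda>i j. R i j * l i j) c
          + hform A (\<lambda>i j. D' i j * l i j) c
          + hform A (\<lambda>i j. D i j * ((1 - peak x i j * P x i j - copeak x i j) * l i j)) c"
        unfolding hform_add[symmetric] by (simp add: R_def D'_def algebra_simps)
      have nn: "0 \<le> Re (hform A (\<lambda>i j. D i j * ((1 - peak x i j * P x i j - copeak x i j) * l i j)) c)"
        using psd_onD[OF psd_mult[OF insert.prems(2) psd_times_l[OF rest]] assms(1)]
        by (simp add: complex_nonneg_iff)
      have IH: "(\<Sum>k\<in>S. \<epsilon> / 4 * (cmod (c k))\<^sup>2 * Re (l k k) * Re (D' k k) * Re (P k k k) * 4 powr (- (\<Sum>i\<in>S. gsq i k)))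
          \<le> Re (hform A (\<lambda>i j. D' i j * l i j) c)"
        by (rule insert.IH[OF S psdD'])
      have pos: "0 \<le> Re (l k k)" "0 \<le> Re (D k k)" "Im (D k k) = 0" "Im (l k k) = 0"
          "k \<in> A \<Longrightarrow> 0 \<le> Re (P k k k)" "k \<in> A \<Longrightarrow> Im (P k k k) = 0" for k
        using psd_diag[OF psd_l, of k] psd_diag[OF insert.prems(2), of k] psd_diag[OF P(1), of k k]
        by (auto simp: complex_nonneg_iff)
      have mono: "(\<Sum>k\<in>S. \<epsilon> / 4 * (cmod (c k))\<^sup>2 * Re (l k k) * Re (D k k) * Re (P k k k) * 4 powr (- (\<Sum>i\<in>insert x S. gsq i k)))
        \<le> (\<Sum>k\<in>S. \<epsilon> / 4 * (cmod (c k))\<^sup>2 * Re (l k k) * Re (D' k k) * Re (P k k k) * 4 powr (- (\<Sum>i\<in>S. gsq i k)))"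
      proof (rule sum_mono)
        fix k assume k: "k \<in> S"
        have "Im (copeak x k k) = 0" using psd_diag[OF psd_copeak, of k x] by (simp add: complex_nonneg_iff)
        then have D': "Re (D' k k) = Re (D k k) * Re (copeak x k k)" by (simp add: D'_def pos)
        have "4 powr (- (\<Sum>i\<in>insert x S. gsq i k)) = 4 powr (- gsq x k) * 4 powr (- (\<Sum>i\<in>S. gsq i k))"
          using insert.hyps xS by (simp add: powr_add[symmetric])
        also have "\<dots> \<le> Re (copeak x k k) * 4 powr (- (\<Sum>i\<in>S. gsq i k))"
          using copeak_diag_ge[of k x] insert.hyps(2)[OF k] by (intro mult_right_mono) auto
        finally have le: "4 powr (- (\<Sum>i\<in>insert x S. gsq i k)) \<le> Re (copeak x k k) * 4 powr (- (\<Sum>i\<in>S. gsq i k))" .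
        have "0 \<le> \<epsilon> / 4 * (cmod (c k))\<^sup>2 * Re (l k k) * Re (D k k) * Re (P k k k)"
          using pos[of k] k S assms(2) by auto
        from mult_left_mono[OF le this]
        show "\<epsilon> / 4 * (cmod (c k))\<^sup>2 * Re (l k k) * Re (D k k) * Re (P k k k) * 4 powr (- (\<Sum>i\<in>insert x S. gsq i k))
          \<le> \<epsilon> / 4 * (cmod (c k))\<^sup>2 * Re (l k k) * Re (D' k k) * Re (P k k k) * 4 powr (- (\<Sum>i\<in>S. gsq i k))"
          unfolding D' by (simp only: mult_ac)
      qed
      \<comment> \<open>\<open>P x\<close> cuts the peak part down to the cluster
        \<open>Q x\<close>, where separation leaves a diagonal term at \<open>x\<close>;
        \<open>peak x x x = 1 / 4\<close> is the origin of the 4 in the bound.\<close>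
      have main: "\<epsilon> / 4 * (cmod (c x))\<^sup>2 * Re (l x x) * Re (D x x) * Re (P x x x) \<le> Re (hform A (\<lambda>i j. R i j * l i j) c)"
      proof -
        let ?e = "\<lambda>i j. if i = x \<and> j = x then \<epsilon> * l x x else 0"
        have E: "x \<in> A \<inter> Q x" using x Q by auto
        have fE: "finite (A \<inter> Q x)" using assms(1) by simp
        have "hform A (\<lambda>i j. R i j * l i j) c = hform (A \<inter> Q x) (\<lambda>i j. R i j * l i j) c"
          using assms(1) P(3)[OF x] by (intro hform_restrict) (auto simp: R_def)
        also have "\<dots> = hform (A \<inter> Q x) (\<lambda>i j. R i j * (l i j - ?e i j)) c + hform (A \<inter> Q x) (\<lambda>i j. R i j * ?e i j) c"
          unfolding hform_add[symmetric] by (simp add: algebra_simps)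
        also have "hform (A \<inter> Q x) (\<lambda>i j. R i j * ?e i j) c = hform {x} (\<lambda>i j. R i j * ?e i j) c"
          using fE E by (intro hform_restrict) auto
        also have "\<dots> = c x * cnj (c x) * (R x x * (\<epsilon> * l x x))" by (simp add: hform_def)
        finally have eq: "hform A (\<lambda>i j. R i j * l i j) c =
          hform (A \<inter> Q x) (\<lambda>i j. R i j * (l i j - ?e i j)) c + c x * cnj (c x) * (R x x * (\<epsilon> * l x x))" .
        have "0 \<le> hform (A \<inter> Q x) (\<lambda>i j. R i j * (l i j - ?e i j)) c"
          by (rule psd_onD[OF psd_mult[OF psd_on_subset[OF psdR subset_UNIV] sep[OF x]]]) (use assms(1) in auto)
        moreover have "Re (c x * cnj (c x) * (R x x * (\<epsilon> * l x x))) =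
            \<epsilon> / 4 * (cmod (c x))\<^sup>2 * Re (l x x) * Re (D x x) * Re (P x x x)"
        proof -
          have "D x x = complex_of_real (Re (D x x))" "P x x x = complex_of_real (Re (P x x x))"
            "l x x = complex_of_real (Re (l x x))" using pos[of x] x by (auto simp: complex_eq_iff)
          then obtain d p q where dpq: "D x x = complex_of_real d" "P x x x = complex_of_real p"
            "l x x = complex_of_real q" by metis
          have "c x * cnj (c x) = complex_of_real ((cmod (c x))\<^sup>2)" by (simp only: complex_norm_square)
          then have "c x * cnj (c x) * (R x x * (\<epsilon> * l x x)) = complex_of_real ((cmod (c x))\<^sup>2 * (d * (p / 4) * (\<epsilon> * q)))"
            unfolding R_def peak_self dpq by simp
          then have "Re (c x * cnj (c x) * (R x x * (\<epsilon> * l x x))) = (cmod (c x))\<^sup>2 * (d * (p / 4) * (\<epsilon> * q))"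
            by (simp only: Re_complex_of_real)
          then show ?thesis by (simp only: dpq Re_complex_of_real) (simp only: mult_ac times_divide_eq_left times_divide_eq_right)
        qed
        ultimately show ?thesis unfolding eq by (simp add: complex_nonneg_iff)
      qed
      have "\<epsilon> / 4 * (cmod (c x))\<^sup>2 * Re (l x x) * Re (D x x) * Re (P x x x) * 4 powr (- (\<Sum>i\<in>insert x S. gsq i x))
          \<le> \<epsilon> / 4 * (cmod (c x))\<^sup>2 * Re (l x x) * Re (D x x) * Re (P x x x) * 1"
      proof (rule mult_left_mono)
        have "0 \<le> (\<Sum>i\<in>insert x S. gsq i x)" by (intro sum_nonneg gsq_nonneg)
        then show "4 powr (- (\<Sum>i\<in>insert x S. gsq i x)) \<le> 1" by (simp add: powr_minus_divide ge_one_powr_ge_zero)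
        show "0 \<le> \<epsilon> / 4 * (cmod (c x))\<^sup>2 * Re (l x x) * Re (D x x) * Re (P x x x)"
          using pos[of x] x assms(2) by auto
      qed
      then show ?thesis
        unfolding decomp using nn IH mono main insert.hyps(1) xS
        by (subst sum.insert) auto
    qed
  qed
qed

text \<open>Of 16 = 4 * 4, one factor pays for the copeaks and one for the Moebius factors that
  annihilate the points outside the cluster of \<open>k\<close>. At such a point \<open>gsq\<close>
  is at most 1/2, exactly the range where 1 - gsq is at least 4 powr (- gsq).\<close>

lemma hform_l_lower_bound:
  fixes \<epsilon> C :: real
  assumes "finite A" "0 \<le> \<epsilon>"
    and sep: "\<And>k. k \<in> A \<Longrightarrow> psd_on {i\<in>A. 1 / 2 < gsq k i} (\<lambda>i j. l i j - (if i = k \<and> j = k then \<epsilon> * l k k else 0))"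
    and C: "\<And>k. k \<in> A \<Longrightarrow> (\<Sum>i\<in>A. gsq i k) \<le> C"
  shows "\<epsilon> / 4 * 16 powr (- C) * (\<Sum>k\<in>A. (cmod (c k))\<^sup>2 * Re (l k k)) \<le> Re (hform A l c)"
proof -
  define Q where "Q = (\<lambda>k. {i\<in>A. 1 / 2 < gsq k i})"
  define P where "P = (\<lambda>k i j. \<Prod>x\<in>A - Q k. moebius x i j)"
  have Pd: "4 powr (- C) \<le> Re (P k k k)" if k: "k \<in> A" for k
  proof -
    have fin: "finite (A - Q k)" using assms(1) by simp
    have "P k k k = complex_of_real (\<Prod>x\<in>A - Q k. 1 - gsq x k)"
      by (simp only: P_def moebius_diag of_real_prod)
    then have "Re (P k k k) = (\<Prod>x\<in>A - Q k. 1 - gsq x k)" by (metis Re_complex_of_real)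
    also have "\<dots> \<ge> (\<Prod>x\<in>A - Q k. 4 powr (- gsq x k))"
      by (rule prod_mono) (auto simp: Q_def gsq_commute[of k] intro!: powr_4_le_half gsq_nonneg)
    also have "(\<Prod>x\<in>A - Q k. 4 powr (- gsq x k)) = 4 powr (- (\<Sum>x\<in>A - Q k. gsq x k))"
      by (simp add: powr_sum[symmetric] sum_negf[symmetric])
    also have "(\<Sum>x\<in>A - Q k. gsq x k) \<le> (\<Sum>x\<in>A. gsq x k)"
      using assms(1) by (intro sum_mono2) (auto simp: gsq_nonneg)
    then have "4 powr (- C) \<le> 4 powr (- (\<Sum>x\<in>A - Q k. gsq x k))"
      using C[OF k] by (intro powr_mono) auto
    finally show ?thesis .
  qed
  have nn: "0 \<le> Re (l k k)" for k using psd_diag[OF psd_l, of k] by (simp add: complex_nonneg_iff)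
  have "\<epsilon> / 4 * 16 powr (- C) * (\<Sum>k\<in>A. (cmod (c k))\<^sup>2 * Re (l k k))
     = (\<Sum>k\<in>A. \<epsilon> / 4 * (cmod (c k))\<^sup>2 * Re (l k k) * (4 powr (- C) * 4 powr (- C)))"
  proof -
    have "16 powr (- C) = 4 powr (- C) * 4 powr (- C)" by (simp add: powr_mult[symmetric])
    then show ?thesis by (simp add: sum_distrib_left mult_ac)
  qed
  also have "\<dots> \<le> (\<Sum>k\<in>A. \<epsilon> / 4 * (cmod (c k))\<^sup>2 * Re (l k k) * (Re (P k k k) * 4 powr (- (\<Sum>i\<in>A. gsq i k))))"
  proof (intro sum_mono mult_left_mono mult_mono)
    fix k assume k: "k \<in> A"
    show "4 powr (- C) \<le> Re (P k k k)" by (rule Pd[OF k])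
    then show "0 \<le> Re (P k k k)" by (meson order_trans powr_ge_zero)
    show "4 powr (- C) \<le> 4 powr (- (\<Sum>i\<in>A. gsq i k))" using C[OF k] by (intro powr_mono) auto
    show "0 \<le> \<epsilon> / 4 * (cmod (c k))\<^sup>2 * Re (l k k)" using nn[of k] assms(2) by auto
  qed simp
  also have "\<dots> = (\<Sum>k\<in>A. \<epsilon> / 4 * (cmod (c k))\<^sup>2 * Re (l k k) * Re ((1::complex)) * Re (P k k k) * 4 powr (- (\<Sum>i\<in>A. gsq i k)))"
    by (simp add: mult_ac)
  also have "\<dots> \<le> Re (hform A (\<lambda>i j. 1 * l i j) c)"
  proof (rule hform_l_telescope[where Q = Q and P = P and B = A])
    show "psd_on UNIV (P k)" for k unfolding P_def using assms(1) by (intro psd_prod psd_moebius) auto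
    show "psd_on UNIV (\<lambda>i j. (1 - P k i j) * s i j)" for k
      unfolding P_def using assms(1) by (intro psd_prod_moebius_complement) auto
    show "P k i j = 0" if "i \<in> A" "j \<in> A" "i \<notin> Q k \<or> j \<notin> Q k" for k i j
      unfolding P_def using that assms(1) moebius_zero prod_zero[of "A - Q k" "\<lambda>x. moebius x i j"] by blast
    show "k \<in> Q k" if "k \<in> A" for k using that by (simp add: Q_def gsq_self)
  qed (use assms(1,2) sep in \<open>auto simp: Q_def psd_one\<close>)
  finally show ?thesis by simp
qed

end

section \<open>Multipliers, Bessel bounds and distances in terms of kernels\<close>

lemma combo_norm2_eq: "combo_norm2 k n x a = Re (hform {..<n} (\<lambda>i j. k (x i) (x j)) (\<lambda>i. cnj (a i)))"
  unfolding combo_norm2_def hform_def by (subst sum.swap) (simp add: mult_ac)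

lemma psd_tuple: "psd_on UNIV k \<Longrightarrow> psd_on UNIV (\<lambda>i j. k (x i) (x j))"
  by (rule psd_pullback) auto

lemma psd_hform_nonneg: "psd_on UNIV k \<Longrightarrow> finite F \<Longrightarrow> 0 \<le> Re (hform F (\<lambda>i j. k (x i) (x j)) c)"
  using psd_onD[OF psd_tuple, of k F x c] by (simp add: complex_nonneg_iff)

lemma combo_norm2_nonneg: "psd_on UNIV k \<Longrightarrow> 0 \<le> combo_norm2 k n x a"
  unfolding combo_norm2_eq by (rule psd_hform_nonneg) auto

lemma sum_cauchy_complex:
  "cmod (\<Sum>t<(N::nat). p t * cnj (q t)) \<le> sqrt (\<Sum>t<N. (cmod (p t))\<^sup>2) * sqrt (\<Sum>t<N. (cmod (q t))\<^sup>2)"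
proof -
  have "cmod (\<Sum>t<N. p t * cnj (q t)) \<le> (\<Sum>t<N. \<bar>cmod (p t)\<bar> * \<bar>cmod (q t)\<bar>)"
    by (rule order_trans[OF norm_sum]) (simp add: norm_mult)
  also have "\<dots> \<le> L2_set (\<lambda>t. cmod (p t)) {..<N} * L2_set (\<lambda>t. cmod (q t)) {..<N}"
    by (rule L2_set_mult_ineq)
  finally show ?thesis by (simp add: L2_set_def)
qed

text \<open>In a Gram model of the finitely many points involved, the pairing is an inner product
  and Cauchy-Schwarz applies. This places kernel combinations in the space with the expected norm
  bound.\<close>

lemma combo_pairing_combo_le:
  assumes k: "psd_on UNIV k"
  shows "cmod (combo_pairing (\<lambda>z. \<Sum>i<n. a i * k z (x i)) m y b)
    \<le> sqrt (combo_norm2 k n x a) * sqrt (combo_norm2 k m y b)"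
proof -
  let ?S = "x ` {..<n} \<union> y ` {..<m}"
  obtain N v where v: "\<forall>z\<in>?S. \<forall>w\<in>?S. k z w = (\<Sum>t<(N::nat). v t z * cnj (v t w))"
    using psd_gram[of ?S k] psd_on_subset[OF k] by auto
  define p where "p = (\<lambda>t. \<Sum>j<m. cnj (b j) * v t (y j))"
  define q where "q = (\<lambda>t. \<Sum>i<n. cnj (a i) * v t (x i))"
  have norms: "combo_norm2 k n x a = (\<Sum>t<N. (cmod (q t))\<^sup>2)" "combo_norm2 k m y b = (\<Sum>t<N. (cmod (p t))\<^sup>2)"
  proof -
    have "hform {..<n} (\<lambda>i j. k (x i) (x j)) (\<lambda>i. cnj (a i)) = (\<Sum>t<N. q t * cnj (q t))"
      unfolding q_def using v by (intro hform_gram) auto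
    also have "\<dots> = (\<Sum>t<N. complex_of_real ((cmod (q t))\<^sup>2))" by (simp only: complex_norm_square)
    finally show "combo_norm2 k n x a = (\<Sum>t<N. (cmod (q t))\<^sup>2)"
      unfolding combo_norm2_eq by (simp only: of_real_sum[symmetric] Re_complex_of_real)
    have "hform {..<m} (\<lambda>i j. k (y i) (y j)) (\<lambda>i. cnj (b i)) = (\<Sum>t<N. p t * cnj (p t))"
      unfolding p_def using v by (intro hform_gram) auto
    also have "\<dots> = (\<Sum>t<N. complex_of_real ((cmod (p t))\<^sup>2))" by (simp only: complex_norm_square)
    finally show "combo_norm2 k m y b = (\<Sum>t<N. (cmod (p t))\<^sup>2)"
      unfolding combo_norm2_eq by (simp only: of_real_sum[symmetric] Re_complex_of_real)
  qed
  have "combo_pairing (\<lambda>z. \<Sum>i<n. a i * k z (x i)) m y b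
      = (\<Sum>j<m. \<Sum>i<n. \<Sum>t<N. cnj (b j) * v t (y j) * cnj (cnj (a i) * v t (x i)))"
    unfolding combo_pairing_def sum_distrib_left
    by (intro sum.cong refl) (use v in \<open>simp add: sum_distrib_left mult_ac\<close>)
  also have "\<dots> = (\<Sum>t<N. \<Sum>j<m. \<Sum>i<n. cnj (b j) * v t (y j) * cnj (cnj (a i) * v t (x i)))"
    by (simp only: sum.swap[of _ "{..<N}"])
  also have "\<dots> = (\<Sum>t<N. p t * cnj (q t))"
    by (simp only: p_def q_def cnj_sum sum_product)
  finally show ?thesis using sum_cauchy_complex[of p q N] unfolding norms by (simp add: mult.commute)
qed

section \<open>The norm as a functional norm, and multipliers as bounds on adjoints\<close>

lemma rkhs_norm_le:
  assumes "0 \<le> C" "\<And>n x a. cmod (combo_pairing f n x a) \<le> C * sqrt (combo_norm2 k n x a)"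
  shows "in_rkhs k f" "rkhs_norm k f \<le> C"
proof -
  show "in_rkhs k f" using assms(2) by (auto simp: in_rkhs_def)
  show "rkhs_norm k f \<le> C" unfolding rkhs_norm_def
    by (rule cInf_lower) (use assms in \<open>auto intro: bdd_belowI[of _ 0]\<close>)
qed

lemma rkhs_bound_nonempty:
  assumes "psd_on UNIV k" "in_rkhs k f"
  shows "{C. C \<ge> 0 \<and> (\<forall>n x a. cmod (combo_pairing f n x a) \<le> C * sqrt (combo_norm2 k n x a))} \<noteq> {}"
proof -
  obtain C where C: "cmod (combo_pairing f n x a) \<le> C * sqrt (combo_norm2 k n x a)" for n x a
    using assms(2) by (auto simp: in_rkhs_def)
  have "cmod (combo_pairing f n x a) \<le> max C 0 * sqrt (combo_norm2 k n x a)" for n x a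
    by (rule order_trans[OF C]) (simp add: mult_right_mono combo_norm2_nonneg[OF assms(1)])
  then show ?thesis by (auto intro!: exI[of _ "max C 0"])
qed

lemma rkhs_norm_nonneg:
  assumes "psd_on UNIV k" "in_rkhs k f"
  shows "0 \<le> rkhs_norm k f"
  unfolding rkhs_norm_def by (rule cInf_greatest[OF rkhs_bound_nonempty[OF assms]]) auto

text \<open>The infimum defining the norm is itself admissible. Combinations of norm zero are
  treated apart, since one cannot divide by their norm.\<close>

lemma combo_pairing_le_rkhs_norm:
  assumes "psd_on UNIV k" "in_rkhs k f"
  shows "cmod (combo_pairing f n x a) \<le> rkhs_norm k f * sqrt (combo_norm2 k n x a)"
proof (cases "combo_norm2 k n x a = 0")
  case True
  then show ?thesis using assms(2) unfolding in_rkhs_def by (metis mult_zero_right real_sqrt_zero)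
next
  case False
  then have pos: "0 < sqrt (combo_norm2 k n x a)" using combo_norm2_nonneg[OF assms(1), of n x a] by simp
  have "cmod (combo_pairing f n x a) / sqrt (combo_norm2 k n x a) \<le> rkhs_norm k f"
    unfolding rkhs_norm_def
    by (rule cInf_greatest[OF rkhs_bound_nonempty[OF assms]]) (use pos in \<open>auto simp: pos_divide_le_eq\<close>)
  then show ?thesis using pos by (simp add: pos_divide_le_eq)
qed

lemma kernel_combo_in_rkhs:
  assumes "psd_on UNIV k"
  shows "in_rkhs k (\<lambda>z. \<Sum>i<n. a i * k z (x i))"
    "rkhs_norm k (\<lambda>z. \<Sum>i<n. a i * k z (x i)) \<le> sqrt (combo_norm2 k n x a)"
  by (rule rkhs_norm_le[of "sqrt (combo_norm2 k n x a)"];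
      simp add: combo_norm2_nonneg[OF assms] combo_pairing_combo_le[OF assms])+

lemma combo_pairing_self:
  "Re (combo_pairing (\<lambda>z. \<Sum>i<n. a i * k z (x i)) n x a) = combo_norm2 k n x a"
  unfolding combo_pairing_def combo_norm2_def sum_distrib_left
  by (subst sum.swap) (simp add: mult_ac)

text \<open>The adjoint of multiplication by \<phi> sends l_w to cnj (\<phi> w) s_w. The assumption
  on the kernel says that this adjoint has norm at most \<open>M\<close> on kernel combinations, and
  the claim follows by duality.\<close>

lemma is_multiplierI:
  assumes "psd_on UNIV s" "psd_on UNIV l" "0 < M"
    and K: "psd_on UNIV (\<lambda>z w. complex_of_real (M\<^sup>2) * l z w - \<phi> z * cnj (\<phi> w) * s z w)"
  shows "is_multiplier s l \<phi>"
  unfolding is_multiplier_def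
proof (intro exI[of _ M] allI impI)
  fix f assume f: "in_rkhs s f"
  have le: "sqrt (combo_norm2 s n x (\<lambda>i. a i * cnj (\<phi> (x i)))) \<le> M * sqrt (combo_norm2 l n x a)" for n x a
  proof -
    have "0 \<le> Re (hform {..<n} (\<lambda>i j. complex_of_real (M\<^sup>2) * l (x i) (x j) - \<phi> (x i) * cnj (\<phi> (x j)) * s (x i) (x j)) (\<lambda>i. cnj (a i)))"
      using psd_hform_nonneg[OF K, of "{..<n}" x] by simp
    also have "hform {..<n} (\<lambda>i j. complex_of_real (M\<^sup>2) * l (x i) (x j) - \<phi> (x i) * cnj (\<phi> (x j)) * s (x i) (x j)) (\<lambda>i. cnj (a i))
       = complex_of_real (M\<^sup>2) * hform {..<n} (\<lambda>i j. l (x i) (x j)) (\<lambda>i. cnj (a i))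
          - hform {..<n} (\<lambda>i j. s (x i) (x j)) (\<lambda>i. cnj (a i) * \<phi> (x i))"
      unfolding hform_diff hform_scale by (subst hform_rescale) simp
    finally have "combo_norm2 s n x (\<lambda>i. a i * cnj (\<phi> (x i))) \<le> M\<^sup>2 * combo_norm2 l n x a"
      unfolding combo_norm2_eq by simp
    then have "sqrt (combo_norm2 s n x (\<lambda>i. a i * cnj (\<phi> (x i)))) \<le> sqrt (M\<^sup>2 * combo_norm2 l n x a)" by simp
    then show ?thesis using assms(3) by (simp add: real_sqrt_mult)
  qed
  have bound: "cmod (combo_pairing (\<lambda>z. \<phi> z * f z) n x a) \<le> M * rkhs_norm s f * sqrt (combo_norm2 l n x a)" for n x a
  proof -
    have "combo_pairing (\<lambda>z. \<phi> z * f z) n x a = combo_pairing f n x (\<lambda>i. a i * cnj (\<phi> (x i)))"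
      by (simp add: combo_pairing_def mult_ac)
    also have "cmod \<dots> \<le> rkhs_norm s f * sqrt (combo_norm2 s n x (\<lambda>i. a i * cnj (\<phi> (x i))))"
      by (rule combo_pairing_le_rkhs_norm[OF assms(1) f])
    also have "\<dots> \<le> rkhs_norm s f * (M * sqrt (combo_norm2 l n x a))"
      by (rule mult_left_mono[OF le rkhs_norm_nonneg[OF assms(1) f]])
    finally show ?thesis by (simp add: mult_ac)
  qed
  have "0 \<le> M * rkhs_norm s f" using assms(3) rkhs_norm_nonneg[OF assms(1) f] by simp
  then show "in_rkhs l (\<lambda>z. \<phi> z * f z) \<and> rkhs_norm l (\<lambda>z. \<phi> z * f z) \<le> M * rkhs_norm s f"
    using rkhs_norm_le[OF _ bound] by blast
qed

text \<open>The multiplier is tested on the image \<open>f\<close> of a combination of kernel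
  functions of \<open>l\<close> under the adjoint: its squared norm \<open>q\<close> equals the
  pairing of \<phi> * f with that combination, so q <= M * sqrt q * sqrt r. The maximum with 0 is
  taken because the constant in the definition carries no sign.\<close>

lemma is_multiplierD:
  fixes s l :: "'a \<Rightarrow> 'a \<Rightarrow> complex"
  assumes s: "psd_on UNIV s" and l: "psd_on UNIV l" and "is_multiplier s l \<phi>"
  obtains M where "0 \<le> M" "\<And>n (x :: nat \<Rightarrow> 'a) c. Re (hform {..<n} (\<lambda>i j. s (x i) (x j)) (\<lambda>i. c i * \<phi> (x i)))
      \<le> M\<^sup>2 * Re (hform {..<n} (\<lambda>i j. l (x i) (x j)) c)"
proof -
  obtain M0 where M0: "\<And>f. in_rkhs s f \<Longrightarrow> in_rkhs l (\<lambda>z. \<phi> z * f z)"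
    "\<And>f. in_rkhs s f \<Longrightarrow> rkhs_norm l (\<lambda>z. \<phi> z * f z) \<le> M0 * rkhs_norm s f"
    using assms(3) by (auto simp: is_multiplier_def)
  define M where "M = max M0 0"
  have "Re (hform {..<n} (\<lambda>i j. s (x i) (x j)) (\<lambda>i. c i * \<phi> (x i)))
      \<le> M\<^sup>2 * Re (hform {..<n} (\<lambda>i j. l (x i) (x j)) c)" for n and x :: "nat \<Rightarrow> 'a" and c
  proof -
    define a where "a = (\<lambda>i. cnj (c i))"
    define d where "d = (\<lambda>i. a i * cnj (\<phi> (x i)))"
    define f where "f = (\<lambda>z. \<Sum>i<n. d i * s z (x i))"
    define q r where "q = combo_norm2 s n x d" and "r = combo_norm2 l n x a"
    have q: "q = Re (hform {..<n} (\<lambda>i j. s (x i) (x j)) (\<lambda>i. c i * \<phi> (x i)))"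
      by (simp add: q_def combo_norm2_eq d_def a_def)
    have r: "r = Re (hform {..<n} (\<lambda>i j. l (x i) (x j)) c)"
      by (simp add: r_def combo_norm2_eq a_def)
    have q0: "0 \<le> q" "0 \<le> r" by (auto simp: q_def r_def combo_norm2_nonneg s l)
    have f: "in_rkhs s f" "rkhs_norm s f \<le> sqrt q"
      using kernel_combo_in_rkhs[OF s, of d x n] by (auto simp: f_def q_def)
    have "q = Re (combo_pairing f n x d)" by (simp add: q_def f_def combo_pairing_self)
    also have "combo_pairing f n x d = combo_pairing (\<lambda>z. \<phi> z * f z) n x a"
      by (simp add: combo_pairing_def d_def mult_ac)
    also have "Re \<dots> \<le> cmod \<dots>" by (rule complex_Re_le_cmod)
    also have "\<dots> \<le> rkhs_norm l (\<lambda>z. \<phi> z * f z) * sqrt r"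
      unfolding r_def by (rule combo_pairing_le_rkhs_norm[OF l M0(1)[OF f(1)]])
    also have "\<dots> \<le> (M * sqrt q) * sqrt r"
    proof (rule mult_right_mono)
      have "M0 * rkhs_norm s f \<le> M * rkhs_norm s f"
        by (rule mult_right_mono) (auto simp: M_def rkhs_norm_nonneg[OF s f(1)])
      also have "\<dots> \<le> M * sqrt q" by (rule mult_left_mono[OF f(2)]) (simp add: M_def)
      finally show "rkhs_norm l (\<lambda>z. \<phi> z * f z) \<le> M * sqrt q" using M0(2)[OF f(1)] by linarith
    qed (use q0 in simp)
    finally have "sqrt q * sqrt q \<le> (M * sqrt r) * sqrt q" using q0 by (simp add: mult_ac)
    moreover have "0 \<le> M * sqrt r" using q0 by (simp add: M_def)
    ultimately have "sqrt q \<le> M * sqrt r" using q0 mult_right_le_imp_le[of "sqrt q" "sqrt q" "M * sqrt r"]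
      by (cases "q = 0") auto
    then have "(sqrt q)\<^sup>2 \<le> (M * sqrt r)\<^sup>2" by (rule power_mono) (use q0 in simp)
    then show ?thesis using q0 unfolding q r by (simp add: power_mult_distrib)
  qed
  then show thesis using that[of M] by (simp add: M_def)
qed

section \<open>Normalized Gram matrices, the Carleson condition and distances to spans\<close>

definition ngram :: "('a \<Rightarrow> 'a \<Rightarrow> complex) \<Rightarrow> (nat \<Rightarrow> 'a) \<Rightarrow> nat \<Rightarrow> nat \<Rightarrow> complex" where
  "ngram k x i j = k (x i) (x j) / complex_of_real (kfun_norm k (x i) * kfun_norm k (x j))"

definition pos_kernel :: "('a \<Rightarrow> 'a \<Rightarrow> complex) \<Rightarrow> bool" where
  "pos_kernel k \<longleftrightarrow> psd_on UNIV k \<and> (\<forall>z. 0 < Re (k z z))"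

lemma pos_kernelD: "pos_kernel k \<Longrightarrow> psd_on UNIV k" "pos_kernel k \<Longrightarrow> 0 < Re (k z z)"
  by (auto simp: pos_kernel_def)

lemma kfun_norm_pos: "pos_kernel k \<Longrightarrow> 0 < kfun_norm k z"
  by (simp add: kfun_norm_def pos_kernelD)

lemma kfun_norm_square: "pos_kernel k \<Longrightarrow> (kfun_norm k z)\<^sup>2 = Re (k z z)"
  using pos_kernelD(2)[of k z] by (simp add: kfun_norm_def)

lemma hform_ngram:
  "hform F (ngram k x) c = hform F (\<lambda>i j. k (x i) (x j)) (\<lambda>i. c i / complex_of_real (kfun_norm k (x i)))"
  unfolding hform_def ngram_def by (simp add: field_simps)

lemma psd_ngram: "psd_on UNIV k \<Longrightarrow> psd_on UNIV (ngram k x)"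
  unfolding psd_on_def[of UNIV "ngram k x"] hform_ngram using psd_onD[OF psd_tuple] by blast

lemma ngram_diag: "pos_kernel k \<Longrightarrow> ngram k x i i = 1"
proof -
  assume k: "pos_kernel k"
  have "k (x i) (x i) = complex_of_real ((kfun_norm k (x i))\<^sup>2)"
    unfolding kfun_norm_square[OF k] by (rule psd_diag_real[OF pos_kernelD(1)[OF k]]) simp
  then show ?thesis using kfun_norm_pos[OF k, of "x i"] by (simp add: ngram_def power2_eq_square)
qed

lemma cmod_ngram_square: "pos_kernel k \<Longrightarrow>
  (cmod (ngram k x i j))\<^sup>2 = (cmod (k (x i) (x j)))\<^sup>2 / (Re (k (x i) (x i)) * Re (k (x j) (x j)))"
  using kfun_norm_pos[of k "x i"] kfun_norm_pos[of k "x j"]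
  by (simp add: ngram_def norm_divide norm_mult power_divide power_mult_distrib kfun_norm_square)

text \<open>Both estimates concern the embedding of f to the sequence f(x_i) / |s_{x_i}|: evaluating
  it at a kernel function bounds the columns, and its adjoint gives the Bessel inequality through
  the self-pairing estimate q <= |c| * sqrt (C * q).\<close>

lemma carleson_imp_bessel:
  assumes s: "pos_kernel s" and "carleson_condition s x"
  obtains C where "0 < C" "\<And>I k. finite I \<Longrightarrow> (\<Sum>i\<in>I. (cmod (ngram s x i k))\<^sup>2) \<le> C"
    "\<And>n c. Re (hform {..<n} (ngram s x) c) \<le> C * (\<Sum>i<n. (cmod (c i))\<^sup>2)"
proof -
  note s1 = pos_kernelD(1)[OF s]
  obtain C where C: "0 < C"
    "\<And>f. in_rkhs s f \<Longrightarrow> summable (\<lambda>i. (cmod (f (x i)))\<^sup>2 / (kfun_norm s (x i))\<^sup>2)"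
    "\<And>f. in_rkhs s f \<Longrightarrow> (\<Sum>i. (cmod (f (x i)))\<^sup>2 / (kfun_norm s (x i))\<^sup>2) \<le> C * (rkhs_norm s f)\<^sup>2"
    using assms(2) by (auto simp: carleson_condition_def)
  have part: "(\<Sum>i\<in>I. (cmod (f (x i)))\<^sup>2 / (kfun_norm s (x i))\<^sup>2) \<le> C * q"
    if "in_rkhs s f" "rkhs_norm s f \<le> sqrt q" "0 \<le> q" "finite I" for I f q
  proof -
    have "(\<Sum>i\<in>I. (cmod (f (x i)))\<^sup>2 / (kfun_norm s (x i))\<^sup>2) \<le> (\<Sum>i. (cmod (f (x i)))\<^sup>2 / (kfun_norm s (x i))\<^sup>2)"
      by (rule sum_le_suminf[OF C(2)[OF that(1)] that(4)]) simp
    also have "\<dots> \<le> C * (rkhs_norm s f)\<^sup>2" by (rule C(3)[OF that(1)])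
    also have "(rkhs_norm s f)\<^sup>2 \<le> (sqrt q)\<^sup>2"
      by (rule power_mono[OF that(2) rkhs_norm_nonneg[OF s1 that(1)]])
    finally show ?thesis using C(1) that(3) by (simp add: mult_left_mono)
  qed
  show thesis
  proof (rule that[OF C(1)])
    fix I :: "nat set" and k assume I: "finite I"
    have e: "combo_norm2 s (Suc 0) (\<lambda>_. x k) (\<lambda>_. 1) = Re (s (x k) (x k))" by (simp add: combo_norm2_def)
    have "(\<Sum>i\<in>I. (cmod (s (x i) (x k)))\<^sup>2 / (kfun_norm s (x i))\<^sup>2) \<le> C * Re (s (x k) (x k))"
      using part[of "\<lambda>z. s z (x k)" "Re (s (x k) (x k))" I]
        kernel_combo_in_rkhs[OF s1, where n = 1 and x = "\<lambda>_. x k" and a = "\<lambda>_. 1"] I pos_kernelD(2)[OF s, of "x k"]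
      by (simp add: e)
    then have "(\<Sum>i\<in>I. (cmod (s (x i) (x k)))\<^sup>2 / (kfun_norm s (x i))\<^sup>2) / Re (s (x k) (x k)) \<le> C"
      using pos_kernelD(2)[OF s, of "x k"] by (simp add: field_simps)
    then show "(\<Sum>i\<in>I. (cmod (ngram s x i k))\<^sup>2) \<le> C"
      by (simp add: cmod_ngram_square[OF s] kfun_norm_square[OF s] sum_divide_distrib)
  next
    fix n and c :: "nat \<Rightarrow> complex"
    define a where "a = (\<lambda>i. cnj (c i) / complex_of_real (kfun_norm s (x i)))"
    define f where "f = (\<lambda>z. \<Sum>i<n. a i * s z (x i))"
    define q where "q = combo_norm2 s n x a"
    have q: "q = Re (hform {..<n} (ngram s x) c)"
      by (simp add: q_def combo_norm2_eq hform_ngram a_def)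
    have q0: "0 \<le> q" by (simp add: q_def combo_norm2_nonneg[OF s1])
    have f: "in_rkhs s f" "rkhs_norm s f \<le> sqrt q"
      using kernel_combo_in_rkhs[OF s1, of a x n] by (auto simp: f_def q_def)
    have "q = Re (combo_pairing f n x a)" by (simp add: q_def f_def combo_pairing_self)
    also have "\<dots> \<le> cmod (combo_pairing f n x a)" by (rule complex_Re_le_cmod)
    also have "\<dots> \<le> (\<Sum>i<n. \<bar>cmod (c i)\<bar> * \<bar>cmod (f (x i)) / kfun_norm s (x i)\<bar>)"
      unfolding combo_pairing_def
      using kfun_norm_pos[OF s]
      by (intro order_trans[OF norm_sum] sum_mono) (auto simp: a_def norm_mult norm_divide abs_of_pos)
    also have "\<dots> \<le> L2_set (\<lambda>i. cmod (c i)) {..<n} * L2_set (\<lambda>i. cmod (f (x i)) / kfun_norm s (x i)) {..<n}"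
      by (rule L2_set_mult_ineq)
    also have "L2_set (\<lambda>i. cmod (f (x i)) / kfun_norm s (x i)) {..<n} \<le> sqrt (C * q)"
      unfolding L2_set_def using part[OF f q0, of "{..<n}"] by (simp add: power_divide)
    finally have le: "q \<le> L2_set (\<lambda>i. cmod (c i)) {..<n} * sqrt (C * q)"
      by (simp add: mult_left_mono)
    have "q * q \<le> (L2_set (\<lambda>i. cmod (c i)) {..<n} * sqrt (C * q))\<^sup>2"
      using power_mono[OF le q0, of 2] by (simp add: power2_eq_square)
    also have "\<dots> = (C * (\<Sum>i<n. (cmod (c i))\<^sup>2)) * q"
      using q0 C(1) by (simp add: power_mult_distrib L2_set_def sum_nonneg)
    finally have "q \<le> C * (\<Sum>i<n. (cmod (c i))\<^sup>2)"
      using q0 C(1) by (cases "q = 0") (auto simp: mult_le_cancel_right sum_nonneg)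
    then show "Re (hform {..<n} (ngram s x) c) \<le> C * (\<Sum>i<n. (cmod (c i))\<^sup>2)" by (simp add: q)
  qed
qed

text \<open>Duality in the other direction: a partial sum T is the pairing of f with a combination
  whose squared norm is at most C * T, so T <= |f| * sqrt (C * T), which bounds T uniformly.\<close>

lemma bessel_imp_carleson:
  assumes s: "pos_kernel s" and "0 < C"
    and bessel: "\<And>n c. Re (hform {..<n} (ngram s x) c) \<le> C * (\<Sum>i<n. (cmod (c i))\<^sup>2)"
  shows "carleson_condition s x"
  unfolding carleson_condition_def
proof (intro exI[of _ C] conjI allI impI)
  show "0 < C" by fact
  fix f assume f: "in_rkhs s f"
  note s1 = pos_kernelD(1)[OF s]
  define t where "t = (\<lambda>i. (cmod (f (x i)))\<^sup>2 / (kfun_norm s (x i))\<^sup>2)"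
  have part: "(\<Sum>i<n. t i) \<le> C * (rkhs_norm s f)\<^sup>2" for n
  proof -
    define T where "T = (\<Sum>i<n. t i)"
    have T0: "0 \<le> T" by (auto simp: T_def t_def intro!: sum_nonneg)
    define a where "a = (\<lambda>i. f (x i) / complex_of_real ((kfun_norm s (x i))\<^sup>2))"
    define c where "c = (\<lambda>i. cnj (f (x i)) / complex_of_real (kfun_norm s (x i)))"
    have "combo_norm2 s n x a = Re (hform {..<n} (ngram s x) c)"
      by (simp add: combo_norm2_eq hform_ngram a_def c_def power2_eq_square)
    also have "\<dots> \<le> C * (\<Sum>i<n. (cmod (c i))\<^sup>2)" by (rule bessel)
    also have "(\<Sum>i<n. (cmod (c i))\<^sup>2) = T"
      unfolding T_def t_def c_def by (simp add: norm_divide power_divide)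
    finally have n2: "combo_norm2 s n x a \<le> C * T" .
    have "combo_pairing f n x a = complex_of_real T"
      unfolding combo_pairing_def T_def t_def a_def of_real_sum
    proof (rule sum.cong[OF refl])
      fix i
      have "cnj (f (x i)) * f (x i) = complex_of_real ((cmod (f (x i)))\<^sup>2)"
        by (metis complex_norm_square mult.commute)
      then show "cnj (f (x i) / complex_of_real ((kfun_norm s (x i))\<^sup>2)) * f (x i) =
          complex_of_real ((cmod (f (x i)))\<^sup>2 / (kfun_norm s (x i))\<^sup>2)" by simp
    qed
    then have "T = cmod (combo_pairing f n x a)" using T0 by simp
    also have "\<dots> \<le> rkhs_norm s f * sqrt (combo_norm2 s n x a)"
      by (rule combo_pairing_le_rkhs_norm[OF s1 f])
    also have "\<dots> \<le> rkhs_norm s f * sqrt (C * T)"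
      using n2 by (intro mult_left_mono) (auto simp: rkhs_norm_nonneg[OF s1 f])
    finally have le: "T \<le> rkhs_norm s f * sqrt (C * T)" .
    have "T * T \<le> (rkhs_norm s f * sqrt (C * T))\<^sup>2"
      using power_mono[OF le T0, of 2] by (simp add: power2_eq_square)
    also have "\<dots> = (C * (rkhs_norm s f)\<^sup>2) * T"
      using T0 assms(2) by (simp add: power_mult_distrib)
    finally show ?thesis using T0 assms(2)
      unfolding T_def[symmetric] by (cases "T = 0") (auto simp: mult_le_cancel_right)
  qed
  have sm: "summable t"
    by (rule summableI_nonneg_bounded[OF _ part]) (simp add: t_def)
  then show "summable (\<lambda>i. (cmod (f (x i)))\<^sup>2 / (kfun_norm s (x i))\<^sup>2)" by (simp add: t_def)
  show "(\<Sum>i. (cmod (f (x i)))\<^sup>2 / (kfun_norm s (x i))\<^sup>2) \<le> C * (rkhs_norm s f)\<^sup>2"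
    using suminf_le_const[OF sm part] by (simp add: t_def)
qed

text \<open>The distance fixes the coefficient of the first normalized function to be 1; scaling an
  arbitrary \<open>a\<close> by \<open>r\<close> reaches that normalization. The result is
  homogeneous and can be used inside forms.\<close>

lemma dist_to_span_geD:
  assumes k: "pos_kernel k" and "0 < n" "0 \<le> \<epsilon>" "\<epsilon> \<le> dist_to_span k n mu"
  shows "\<epsilon>\<^sup>2 * (cmod (a 0))\<^sup>2 * Re (k (mu 0) (mu 0)) \<le> combo_norm2 k n mu a"
proof (cases "a 0 = 0")
  case True
  then show ?thesis by (simp add: combo_norm2_nonneg[OF pos_kernelD(1)[OF k]])
next
  case False
  let ?N = "\<lambda>j. complex_of_real (kfun_norm k (mu j))"
  have N: "?N j \<noteq> 0" for j using kfun_norm_pos[OF k, of "mu j"] by simp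
  define r where "r = 1 / (a 0 * ?N 0)"
  define c where "c = (\<lambda>j. - a j * r * ?N j)"
  have e: "(\<lambda>j. (if j = 0 then 1 else - c j) / ?N j) = (\<lambda>j. r * a j)"
    using N False by (auto simp: c_def r_def fun_eq_iff)
  have "dist_to_span k n mu \<le> sqrt (combo_norm2 k n mu (\<lambda>j. (if j = 0 then 1 else - c j) / ?N j))"
    unfolding dist_to_span_def
    by (rule cInf_lower) (auto intro!: bdd_belowI[of _ 0] combo_norm2_nonneg[OF pos_kernelD(1)[OF k]])
  then have "\<epsilon> \<le> sqrt (combo_norm2 k n mu (\<lambda>j. r * a j))" using assms(4) unfolding e by simp
  then have "\<epsilon>\<^sup>2 \<le> combo_norm2 k n mu (\<lambda>j. r * a j)"
    using assms(3) combo_norm2_nonneg[OF pos_kernelD(1)[OF k], of n mu "\<lambda>j. r * a j"]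
    by (metis power_mono real_sqrt_pow2)
  also have "combo_norm2 k n mu (\<lambda>j. r * a j) = (cmod r)\<^sup>2 * combo_norm2 k n mu a"
  proof -
    have "(\<Sum>i<n. \<Sum>j<n. r * a i * cnj (r * a j) * k (mu j) (mu i))
        = complex_of_real ((cmod r)\<^sup>2) * (\<Sum>i<n. \<Sum>j<n. a i * cnj (a j) * k (mu j) (mu i))"
      by (simp add: complex_norm_square sum_distrib_left mult_ac del: of_real_power)
    then show ?thesis unfolding combo_norm2_def by (simp del: of_real_power)
  qed
  also have "(cmod r)\<^sup>2 = 1 / ((cmod (a 0))\<^sup>2 * Re (k (mu 0) (mu 0)))"
    using kfun_norm_pos[OF k, of "mu 0"]
    by (simp add: r_def norm_divide norm_mult power_divide power_mult_distrib kfun_norm_square[OF k])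
  finally show ?thesis using False pos_kernelD(2)[OF k, of "mu 0"] by (simp add: field_simps)
qed

lemma dist_to_span_geI:
  assumes k: "pos_kernel k" and "0 \<le> \<epsilon>"
    and "\<And>a. \<epsilon>\<^sup>2 * (cmod (a 0))\<^sup>2 * Re (k (mu 0) (mu 0)) \<le> combo_norm2 k n mu a"
  shows "\<epsilon> \<le> dist_to_span k n mu"
  unfolding dist_to_span_def
proof (rule cInf_greatest)
  fix r assume "r \<in> range (\<lambda>c::nat \<Rightarrow> complex. sqrt (combo_norm2 k n mu
          (\<lambda>j. (if j = 0 then 1 else - c j) / complex_of_real (kfun_norm k (mu j)))))"
  then obtain c where r: "r = sqrt (combo_norm2 k n mu
          (\<lambda>j. (if j = 0 then 1 else - c j) / complex_of_real (kfun_norm k (mu j))))" by blast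
  let ?a = "\<lambda>j. (if j = 0 then 1 else - c j) / complex_of_real (kfun_norm k (mu j))"
  have "\<epsilon>\<^sup>2 * (cmod (?a 0))\<^sup>2 * Re (k (mu 0) (mu 0)) = \<epsilon>\<^sup>2"
    using kfun_norm_pos[OF k, of "mu 0"] pos_kernelD(2)[OF k, of "mu 0"]
    by (simp add: norm_divide power_divide kfun_norm_square[OF k])
  then have "\<epsilon>\<^sup>2 \<le> combo_norm2 k n mu ?a" using assms(3)[of ?a] by (simp only:)
  then show "\<epsilon> \<le> r" unfolding r by (rule real_le_rsqrt)
qed auto

section \<open>Pick extension\<close>

lemma psd_on_supported:
  assumes "psd_on B K" "\<And>i j. i \<in> A \<Longrightarrow> j \<in> A \<Longrightarrow> i \<notin> B \<or> j \<notin> B \<Longrightarrow> K i j = 0"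
  shows "psd_on A K"
  unfolding psd_on_def
proof (intro allI impI)
  fix F c assume F: "finite F" "F \<subseteq> A"
  have "hform F K c = hform (F \<inter> B) K c"
    using F assms(2) by (intro hform_restrict) (auto simp: subset_iff)
  then show "0 \<le> hform F K c" using psd_onD[OF assms(1), of "F \<inter> B"] F by simp
qed

text \<open>Positivity of Q - v cnj v says that v has norm at most 1 in the space of
  \<open>Q\<close> on \<open>F\<close>; \<open>t\<close> is the value at \<open>x\<close> of its
  extension of least norm. With the projection coefficients \<open>a\<close>, the extended form is
  the form on \<open>F\<close> at \<open>c i + c x * a i\<close> plus |c x|^2 times the squared
  distance of \<open>x\<close> from the span of \<open>F\<close>.\<close>

lemma psd_minus_rank1_extend:
  assumes F: "finite F" "x \<notin> F" and Q: "psd_on (insert x F) Q"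
    and v: "psd_on F (\<lambda>i j. Q i j - v i * cnj (v j))"
  shows "\<exists>t. psd_on (insert x F) (\<lambda>i j. Q i j - (v(x := t)) i * cnj ((v(x := t)) j))"
proof -
  obtain a where a: "\<forall>j\<in>F. Q x j = (\<Sum>i\<in>F. a i * Q i j)"
    using psd_row_projection[OF F(1) Q] by blast
  define t where "t = (\<Sum>i\<in>F. a i * v i)"
  define w where "w = v(x := t)"
  define L where "L = (\<lambda>i j. Q i j - w i * cnj (w j))"
  have wF: "w i = v i" if "i \<in> F" for i using that F(2) by (auto simp: w_def)
  have wx: "w x = t" by (simp add: w_def)
  have row: "L x j = (\<Sum>i\<in>F. a i * L i j)" if "j \<in> F" for j
  proof -
    have "(\<Sum>i\<in>F. a i * L i j) = (\<Sum>i\<in>F. a i * Q i j) - (\<Sum>i\<in>F. a i * v i) * cnj (w j)"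
      by (simp add: L_def wF algebra_simps sum_subtractf sum_distrib_left sum_distrib_right)
    then show ?thesis using a that by (simp add: L_def wx t_def)
  qed
  have herm: "L j i = cnj (L i j)" if "i \<in> insert x F" "j \<in> insert x F" for i j
    unfolding L_def psd_hermitian[OF Q that] by simp
  have col: "L i x = (\<Sum>j\<in>F. cnj (a j) * L i j)" if "i \<in> F" for i
  proof -
    have "L i x = cnj (L x i)" using herm[of x i] that by blast
    also have "\<dots> = (\<Sum>j\<in>F. cnj (a j) * cnj (L j i))" by (simp add: row[OF that])
    also have "\<dots> = (\<Sum>j\<in>F. cnj (a j) * L i j)"
    proof (rule sum.cong[OF refl])
      fix j assume "j \<in> F"
      then have "L i j = cnj (L j i)" using herm[of j i] that by blast
      then show "cnj (a j) * cnj (L j i) = cnj (a j) * L i j" by simp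
    qed
    finally show ?thesis .
  qed
  have "psd_on (insert x F) L"
  proof (rule psd_on_finiteI)
    show "finite (insert x F)" using F by simp
    fix c
    define d where "d = (\<lambda>i. c i + c x * a i)"
    have exp: "hform F L d = hform F L c + (\<Sum>j\<in>F. c x * cnj (c j) * L x j)
        + (\<Sum>i\<in>F. c i * cnj (c x) * L i x) + c x * cnj (c x) * hform F L a"
    proof -
      have "(\<Sum>j\<in>F. c x * cnj (c j) * L x j) = (\<Sum>j\<in>F. \<Sum>i\<in>F. c x * cnj (c j) * (a i * L i j))"
        by (intro sum.cong refl) (simp add: row sum_distrib_left)
      also have "\<dots> = (\<Sum>i\<in>F. \<Sum>j\<in>F. c x * cnj (c j) * (a i * L i j))" by (rule sum.swap)
      finally have 1: "(\<Sum>j\<in>F. c x * cnj (c j) * L x j) = (\<Sum>i\<in>F. \<Sum>j\<in>F. c x * cnj (c j) * (a i * L i j))" .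
      have 2: "(\<Sum>i\<in>F. c i * cnj (c x) * L i x) = (\<Sum>i\<in>F. \<Sum>j\<in>F. c i * cnj (c x) * (cnj (a j) * L i j))"
        by (intro sum.cong refl) (simp add: col sum_distrib_left)
      show ?thesis
        unfolding 1 2 by (simp add: hform_def d_def sum_distrib_left sum.distrib algebra_simps)
    qed
    have La: "hform F L a = hform F Q a - t * cnj t"
    proof -
      have "hform F L a = hform F (\<lambda>i j. Q i j - v i * cnj (v j)) a"
        by (rule hform_cong) (simp_all add: L_def wF)
      then show ?thesis by (simp add: hform_diff hform_rank1 t_def)
    qed
    have "0 \<le> hform (insert x F) Q (\<lambda>i. if i = x then 1 else - a i)"
      by (rule psd_onD[OF Q]) (use F in auto)
    also have "\<dots> = Q x x - hform F Q a"
    proof -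
      have r: "(\<Sum>j\<in>F. cnj (a j) * Q x j) = hform F Q a"
      proof -
        have "(\<Sum>j\<in>F. cnj (a j) * Q x j) = (\<Sum>j\<in>F. \<Sum>i\<in>F. a i * cnj (a j) * Q i j)"
          using a by (intro sum.cong refl) (simp add: sum_distrib_left mult_ac)
        then show ?thesis unfolding hform_def by (subst sum.swap) simp
      qed
      have "Q i x = cnj (Q x i)" if "i \<in> F" for i using psd_hermitian[OF Q, of x i] that by auto
      then have "(\<Sum>i\<in>F. a i * Q i x) = cnj (\<Sum>i\<in>F. cnj (a i) * Q x i)" by (simp add: mult.commute)
      also have "\<dots> = hform F Q a"
        unfolding r using psd_onD[OF Q F(1), of a] by (auto simp: complex_nonneg_iff complex_eq_iff)
      finally have c: "(\<Sum>i\<in>F. a i * Q i x) = hform F Q a" .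
      have ix: "i \<noteq> x" if "i \<in> F" for i using that F by auto
      have "(\<Sum>j\<in>F. (if x = x then 1 else - a x) * cnj (if j = x then 1 else - a j) * Q x j) = - (\<Sum>j\<in>F. cnj (a j) * Q x j)"
        unfolding sum_negf[symmetric] by (intro sum.cong refl) (simp add: ix)
      moreover have "(\<Sum>i\<in>F. (if i = x then 1 else - a i) * cnj (if x = x then 1 else - a x) * Q i x) = - (\<Sum>j\<in>F. a j * Q j x)"
        unfolding sum_negf[symmetric] by (intro sum.cong refl) (simp add: ix)
      moreover have "hform F Q (\<lambda>i. if i = x then 1 else - a i) = hform F Q a"
        unfolding hform_def by (intro sum.cong refl) (simp add: ix)
      ultimately show ?thesis unfolding hform_insert[OF F] r c by simp
    qed
    finally have "0 \<le> Q x x - hform F Q a" .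
    then have "0 \<le> c x * cnj (c x) * (Q x x - hform F Q a)"
      by (intro mult_nonneg_nonneg mult_cnj_nonneg)
    moreover have "0 \<le> hform F L d"
    proof -
      have "hform F L d = hform F (\<lambda>i j. Q i j - v i * cnj (v j)) d"
        by (rule hform_cong) (simp_all add: L_def wF)
      then show ?thesis using psd_onD[OF v F(1), of d] by simp
    qed
    moreover have "hform (insert x F) L c = hform F L d + c x * cnj (c x) * (Q x x - hform F Q a)"
      unfolding hform_insert[OF F] exp La by (simp add: L_def wx algebra_simps)
    ultimately show "0 \<le> hform (insert x F) L c" by simp
  qed
  then show ?thesis unfolding L_def w_def by blast
qed

context pick_pair
begin

text \<open>Positivity on a set expresses that \<phi>, restricted to it, multiplies the restricted
  space of \<open>s\<close> into that of \<open>l\<close> with squared norm at most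
  \<open>m\<close>.\<close>

definition mult_kernel :: "complex \<Rightarrow> ('i \<Rightarrow> complex) \<Rightarrow> 'i \<Rightarrow> 'i \<Rightarrow> complex" where
  "mult_kernel m \<phi> i j = m * l i j - \<phi> i * cnj (\<phi> j) * s i j"

text \<open>\<open>moebius x\<close> vanishes in row and column \<open>x\<close>, so
  \<open>Q\<close> does not see the unknown value; what \<open>moebius x\<close> takes away from
  \<open>s\<close> is the rank-one kernel of s_x. The unknown value therefore enters only through a
  rank-one term.\<close>

lemma pick_extend_finite:
  assumes F: "finite F" "x \<notin> F" and m: "0 \<le> m" and K: "psd_on F (mult_kernel m \<phi>)"
  shows "\<exists>t. psd_on (insert x F) (mult_kernel m (\<phi>(x := t)))"
proof -
  define r where "r = complex_of_real (sqrt (Re (s x x)))"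
  have r: "r \<noteq> 0" "r * r = s x x" "cnj r = r"
  proof -
    show "r \<noteq> 0" "cnj r = r" using s_diag_pos[of x] by (auto simp: r_def)
    have "r * r = complex_of_real (Re (s x x))"
      using s_diag_pos[of x] by (simp add: r_def flip: of_real_mult)
    then show "r * r = s x x" using s_diag_real[of x] by metis
  qed
  define Q where "Q = (\<lambda>i j. m * l i j - \<phi> i * cnj (\<phi> j) * (s i j * moebius x i j))"
  define v where "v = (\<lambda>i. \<phi> i * s i x / r)"
  have compl: "s i j * moebius x i j + s i x * cnj (s j x) / (r * r) = s i j" for i j
    using moebius_complement[of x i j] r(2) by (simp add: algebra_simps divide_inverse)
  have vv: "\<phi> i * cnj (\<phi> j) * (s i j * moebius x i j) + v i * cnj (v j) = \<phi> i * cnj (\<phi> j) * s i j" for i j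
  proof -
    have "v i * cnj (v j) = \<phi> i * cnj (\<phi> j) * (s i x * cnj (s j x) / (r * r))"
      by (simp add: v_def r(3))
    then show ?thesis by (simp only: distrib_left[symmetric] compl)
  qed
  \<comment> \<open>\<open>Q\<close> is the given kernel times \<open>moebius x\<close>, which
    extends by zero to \<open>x\<close>, plus \<open>m\<close> times a complement kernel for
    \<open>l\<close>.\<close>
  have Q: "psd_on (insert x F) Q"
  proof -
    have "Q i j = moebius x i j * mult_kernel m \<phi> i j + m * ((1 - moebius x i j) * l i j)" for i j
      by (simp add: Q_def mult_kernel_def algebra_simps)
    then have Qe: "Q = (\<lambda>i j. moebius x i j * mult_kernel m \<phi> i j + m * ((1 - moebius x i j) * l i j))"
      by (intro ext)
    have "psd_on F (\<lambda>i j. moebius x i j * mult_kernel m \<phi> i j)"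
      by (rule psd_mult[OF psd_on_subset[OF psd_moebius subset_UNIV] K])
    then have "psd_on (insert x F) (\<lambda>i j. moebius x i j * mult_kernel m \<phi> i j)"
      by (rule psd_on_supported) (auto simp: moebius_zero)
    moreover have "psd_on (insert x F) (\<lambda>i j. m * ((1 - moebius x i j) * l i j))"
      by (intro psd_on_subset[OF psd_scale[OF psd_times_l[OF psd_moebius_complement] m] subset_UNIV])
    ultimately show ?thesis unfolding Qe by (rule psd_add)
  qed
  have "psd_on F (\<lambda>i j. Q i j - v i * cnj (v j))"
  proof -
    have "Q i j - v i * cnj (v j) = mult_kernel m \<phi> i j" for i j
      using vv[of i j] by (simp add: Q_def mult_kernel_def algebra_simps)
    then show ?thesis using K by simp
  qed
  then obtain t where t: "psd_on (insert x F) (\<lambda>i j. Q i j - (v(x := t)) i * cnj ((v(x := t)) j))"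
    using psd_minus_rank1_extend[OF F Q] by blast
  define \<psi> where "\<psi> = \<phi>(x := t / r)"
  have w: "v(x := t) = (\<lambda>i. \<psi> i * s i x / r)"
    using r(1) by (auto simp: \<psi>_def v_def fun_eq_iff r(2)[symmetric])
  have "Q i j - (v(x := t)) i * cnj ((v(x := t)) j) = mult_kernel m \<psi> i j" for i j
  proof -
    have q: "Q i j = m * l i j - \<psi> i * cnj (\<psi> j) * (s i j * moebius x i j)"
      by (auto simp: Q_def \<psi>_def moebius_zero)
    have "\<psi> i * s i x / r * cnj (\<psi> j * s j x / r) = \<psi> i * cnj (\<psi> j) * (s i x * cnj (s j x) / (r * r))"
      by (simp add: r(3))
    then have "\<psi> i * cnj (\<psi> j) * (s i j * moebius x i j) + \<psi> i * s i x / r * cnj (\<psi> j * s j x / r)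
        = \<psi> i * cnj (\<psi> j) * s i j" by (simp only: distrib_left[symmetric] compl)
    then show ?thesis unfolding w q mult_kernel_def by (simp only: diff_diff_eq)
  qed
  then show ?thesis using t unfolding \<psi>_def by auto
qed

text \<open>The values admissible for the finite subsets of \<open>A\<close> form a directed family
  of closed sets in the disc allowed by the diagonal entry at \<open>x\<close>; compactness yields a
  value admissible for all of them.\<close>

lemma pick_extend_one:
  assumes x: "x \<notin> A" and m: "0 \<le> m" and K: "psd_on A (mult_kernel m \<phi>)"
  shows "\<exists>t. psd_on (insert x A) (mult_kernel m (\<phi>(x := t)))"
proof -
  define T where "T = (\<lambda>F. {t. psd_on (insert x F) (mult_kernel m (\<phi>(x := t)))})"
  define R where "R = Re (m * l x x) / Re (s x x)"
  have mono: "T E \<subseteq> T F" if "F \<subseteq> E" for E F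
    using that by (auto simp: T_def intro: psd_on_subset)
  have bound: "T F \<subseteq> cball 0 (sqrt R)" for F
  proof
    fix t assume "t \<in> T F"
    then have "0 \<le> mult_kernel m (\<phi>(x := t)) x x" by (auto simp: T_def intro: psd_diag)
    then have "0 \<le> Re (m * l x x - t * cnj t * s x x)" by (simp add: mult_kernel_def complex_nonneg_iff)
    moreover have "Re (t * cnj t * s x x) = (cmod t)\<^sup>2 * Re (s x x)"
    proof -
      have "t * cnj t * s x x = complex_of_real ((cmod t)\<^sup>2 * Re (s x x))"
        using s_diag_real[of x] complex_norm_square[of t] by (metis of_real_mult)
      then show ?thesis by (metis Re_complex_of_real)
    qed
    ultimately have "(cmod t)\<^sup>2 \<le> R" using s_diag_pos[of x] by (simp add: R_def field_simps)
    then show "t \<in> cball 0 (sqrt R)" using real_le_rsqrt by auto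
  qed
  have closed: "closed (T F)" if F: "finite F" for F
  proof -
    have "T F = (\<Inter>c. {t. 0 \<le> hform (insert x F) (mult_kernel m (\<phi>(x := t))) c})"
      using F by (auto simp: T_def intro: psd_on_finiteI psd_onD)
    moreover have "closed {t. 0 \<le> hform (insert x F) (mult_kernel m (\<phi>(x := t))) c}" for c
    proof -
      have cont: "continuous_on UNIV (\<lambda>t. hform (insert x F) (mult_kernel m (\<phi>(x := t))) c)"
      proof -
        have "continuous_on UNIV (\<lambda>t. (\<phi>(x := t)) i)" for i by (cases "i = x") (auto intro: continuous_intros)
        then show ?thesis unfolding hform_def mult_kernel_def by (intro continuous_intros)
      qed
      have "{t. 0 \<le> hform (insert x F) (mult_kernel m (\<phi>(x := t))) c} =
        {t. Im (hform (insert x F) (mult_kernel m (\<phi>(x := t))) c) = 0} \<inter>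
        {t. 0 \<le> Re (hform (insert x F) (mult_kernel m (\<phi>(x := t))) c)}"
        by (auto simp: complex_nonneg_iff)
      also have "closed \<dots>"
        by (intro closed_Int closed_Collect_eq closed_Collect_le continuous_intros cont)
      finally show ?thesis .
    qed
    ultimately show ?thesis by auto
  qed
  have "cball 0 (sqrt R) \<inter> \<Inter> (T ` {F. finite F \<and> F \<subseteq> A}) \<noteq> {}"
  proof (rule compact_imp_fip)
    show "compact (cball (0::complex) (sqrt R))" by simp
    show "closed S" if "S \<in> T ` {F. finite F \<and> F \<subseteq> A}" for S using that closed by auto
    fix \<F>' assume "finite \<F>'" "\<F>' \<subseteq> T ` {F. finite F \<and> F \<subseteq> A}"
    then obtain \<G> where \<G>: "finite \<G>" "\<G> \<subseteq> {F. finite F \<and> F \<subseteq> A}" "\<F>' = T ` \<G>"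
      by (meson finite_subset_image)
    define E where "E = \<Union> \<G>"
    have E: "finite E" "E \<subseteq> A" "x \<notin> E" using \<G> x by (auto simp: E_def)
    obtain t where "t \<in> T E"
      using pick_extend_finite[OF E(1,3) m psd_on_subset[OF K E(2)]] by (auto simp: T_def)
    moreover have "T E \<subseteq> T F" if "F \<in> \<G>" for F
      by (rule mono) (use that in \<open>auto simp: E_def\<close>)
    then have "T E \<subseteq> \<Inter> \<F>'" using \<G>(3) by auto
    ultimately show "cball 0 (sqrt R) \<inter> \<Inter> \<F>' \<noteq> {}" using bound[of E] by blast
  qed
  then obtain t where t: "\<And>F. finite F \<Longrightarrow> F \<subseteq> A \<Longrightarrow> t \<in> T F" by blast
  have "psd_on (insert x A) (mult_kernel m (\<phi>(x := t)))"
    unfolding psd_on_def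
  proof (intro allI impI)
    fix F c assume F: "finite F" "F \<subseteq> insert x A"
    have "t \<in> T (F - {x})" using t[of "F - {x}"] F by auto
    then have "psd_on (insert x (F - {x})) (mult_kernel m (\<phi>(x := t)))" by (simp add: T_def)
    then show "0 \<le> hform F (mult_kernel m (\<phi>(x := t))) c" by (rule psd_onD) (use F in auto)
  qed
  then show ?thesis by blast
qed

text \<open>Partial functions are encoded as graphs and \<open>L\<close> is a kernel on pairs.
  Positivity and single-valuedness involve finitely many pairs at a time, so unions of chains are
  upper bounds; a maximal graph cannot miss a point by the one-point extension.\<close>

lemma pick_extension:
  assumes m: "0 \<le> m" and K: "psd_on B (mult_kernel m \<phi>)"
  obtains \<psi> where "\<And>i. i \<in> B \<Longrightarrow> \<psi> i = \<phi> i" "psd_on UNIV (mult_kernel m \<psi>)"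
proof -
  define L where "L = (\<lambda>p q. m * l (fst p) (fst q) - snd p * cnj (snd q) * s (fst p) (fst q))"
  define G0 where "G0 = (\<lambda>i. (i, \<phi> i)) ` B"
  define \<A> where "\<A> = {G. G0 \<subseteq> G \<and> single_valued G \<and> psd_on G L}"
  have pull: "psd_on G L" if "\<And>p. p \<in> G \<Longrightarrow> snd p = h (fst p)" "psd_on (fst ` G) (mult_kernel m h)" for G h
  proof -
    have "psd_on G (\<lambda>p q. mult_kernel m h (fst p) (fst q))" by (rule psd_pullback[OF that(2)]) auto
    then show ?thesis using that(1) by (subst psd_on_cong) (auto simp: L_def mult_kernel_def)
  qed
  have "\<exists>M\<in>\<A>. \<forall>X\<in>\<A>. M \<subseteq> X \<longrightarrow> X = M"
  proof (rule subset_Zorn_nonempty)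
    have "G0 \<in> \<A>" unfolding \<A>_def
    proof (intro CollectI conjI)
      show "psd_on G0 L" by (rule pull[of G0 \<phi>]) (use K in \<open>auto simp: G0_def image_image\<close>)
    qed (auto simp: G0_def single_valued_def)
    then show "\<A> \<noteq> {}" by blast
    fix \<C> assume \<C>: "\<C> \<noteq> {}" "subset.chain \<A> \<C>"
    have sub: "\<C> \<subseteq> \<A>" using \<C>(2) by (auto simp: subset_chain_def)
    have fin: "\<exists>Y\<in>\<C>. F \<subseteq> Y" if "finite F" "F \<subseteq> \<Union> \<C>" for F
      by (rule finite_subset_Union_chain[OF that \<C>]) blast
    have "single_valued (\<Union> \<C>)"
      unfolding single_valued_def
    proof (intro allI impI)
      fix i t u assume "(i, t) \<in> \<Union> \<C>" "(i, u) \<in> \<Union> \<C>"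
      then have "\<exists>Y\<in>\<C>. {(i, t), (i, u)} \<subseteq> Y" by (intro fin) auto
      then obtain Y where Y: "Y \<in> \<C>" "(i, t) \<in> Y" "(i, u) \<in> Y" by blast
      then have "single_valued Y" using sub unfolding \<A>_def by blast
      then show "t = u" using Y(2,3) by (rule single_valuedD)
    qed
    moreover have "psd_on (\<Union> \<C>) L"
      unfolding psd_on_def
    proof (intro allI impI)
      fix F c assume F: "finite F" "F \<subseteq> \<Union> \<C>"
      obtain Y where Y: "Y \<in> \<C>" "F \<subseteq> Y" using fin[OF F] by blast
      then have "psd_on Y L" using sub unfolding \<A>_def by blast
      then show "0 \<le> hform F L c" using psd_onD F(1) Y(2) by blast
    qed
    moreover have "G0 \<subseteq> \<Union> \<C>" using \<C>(1) sub unfolding \<A>_def by blast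
    ultimately show "\<Union> \<C> \<in> \<A>" by (simp add: \<A>_def)
  qed
  then obtain G where G: "G0 \<subseteq> G" "single_valued G" "psd_on G L"
    and max: "\<And>X. X \<in> \<A> \<Longrightarrow> G \<subseteq> X \<Longrightarrow> X = G" by (auto simp: \<A>_def)
  define f where "f = (\<lambda>i. SOME t. (i, t) \<in> G)"
  have f: "t = f i" if "(i, t) \<in> G" for i t
    using single_valuedD[OF G(2) that someI[of "\<lambda>t. (i, t) \<in> G", OF that]] unfolding f_def .
  have fG: "(i, f i) \<in> G" if iG: "i \<in> fst ` G" for i
  proof -
    obtain p where "p \<in> G" "i = fst p" using iG by blast
    then have "(i, snd p) \<in> G" by simp
    then show ?thesis using f by metis
  qed
  have psdf: "psd_on (fst ` G) (mult_kernel m f)"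
  proof -
    have "psd_on (fst ` G) (\<lambda>i j. L (i, f i) (j, f j))" by (rule psd_pullback[OF G(3)]) (use fG in blast)
    moreover have "L (i, f i) (j, f j) = mult_kernel m f i j" for i j
      by (simp add: L_def mult_kernel_def)
    ultimately show ?thesis by simp
  qed
  have full: "fst ` G = UNIV"
  proof (rule ccontr)
    assume "fst ` G \<noteq> UNIV"
    then obtain x where x: "x \<notin> fst ` G" by blast
    obtain t where t: "psd_on (insert x (fst ` G)) (mult_kernel m (f(x := t)))"
      using pick_extend_one[OF x m psdf] by blast
    have "psd_on (insert (x, t) G) L"
    proof (rule pull[where h = "f(x := t)"])
      fix p assume "p \<in> insert (x, t) G"
      then consider "p = (x, t)" | "p \<in> G" by blast
      then show "snd p = (f(x := t)) (fst p)"
      proof cases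
        case 2
        then have "fst p \<noteq> x" using x by auto
        then show ?thesis using f[of "fst p" "snd p"] 2 by simp
      qed simp
    qed (use t in simp)
    moreover have "single_valued (insert (x, t) G)"
    proof (rule single_valuedI)
      fix i u v assume "(i, u) \<in> insert (x, t) G" "(i, v) \<in> insert (x, t) G"
      moreover have "i \<noteq> x" if "(i, z) \<in> G" for z using that x by (metis fst_conv imageI)
      ultimately show "u = v" using f by blast
    qed
    ultimately have "insert (x, t) G \<in> \<A>" using G(1) unfolding \<A>_def by blast
    then have "insert (x, t) G = G" using max by blast
    then have "(x, t) \<in> G" by blast
    then show False using x by (metis fst_conv imageI)
  qed
  show thesis
  proof (rule that)
    show "f i = \<phi> i" if "i \<in> B" for i 
    proof -
      have "(i, \<phi> i) \<in> G" using G(1) that unfolding G0_def by blast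
      then show ?thesis using f by metis
    qed
    show "psd_on UNIV (mult_kernel m f)" using psdf full by simp
  qed
qed

end

section \<open>Consequences of interpolation\<close>

lemma hform_scale_arg: "hform F K (\<lambda>i. r * c i) = complex_of_real ((cmod r)\<^sup>2) * hform F K c"
  by (simp add: hform_def complex_norm_square sum_distrib_left mult_ac del: of_real_power)

lemma sqrt_hform_triangle:
  assumes "psd_on A K" "finite F" "F \<subseteq> A"
  shows "sqrt (Re (hform F K (\<lambda>i. c i + d i))) \<le> sqrt (Re (hform F K c)) + sqrt (Re (hform F K d))"
proof -
  obtain N v where v: "\<forall>i\<in>F. \<forall>j\<in>F. K i j = (\<Sum>m<(N::nat). v m i * cnj (v m j))"
    using psd_gram[OF assms(2) psd_on_subset[OF assms(1,3)]] by blast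
  define p where "p = (\<lambda>c m. \<Sum>i\<in>F. c i * v m i)"
  have eq: "sqrt (Re (hform F K c)) = L2_set (\<lambda>m. cmod (p c m)) {..<N}" for c
  proof -
    have "hform F K c = (\<Sum>m<N. p c m * cnj (p c m))" unfolding p_def using v by (intro hform_gram) auto
    also have "\<dots> = (\<Sum>m<N. complex_of_real ((cmod (p c m))\<^sup>2))" by (simp only: complex_norm_square)
    finally have "Re (hform F K c) = (\<Sum>m<N. (cmod (p c m))\<^sup>2)"
      by (simp only: of_real_sum[symmetric] Re_complex_of_real)
    then show ?thesis by (simp add: L2_set_def)
  qed
  have "p (\<lambda>i. c i + d i) m = p c m + p d m" for m by (simp add: p_def sum.distrib algebra_simps)
  then have "L2_set (\<lambda>m. cmod (p (\<lambda>i. c i + d i) m)) {..<N} \<le> L2_set (\<lambda>m. cmod (p c m) + cmod (p d m)) {..<N}"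
    by (intro L2_set_mono) (auto simp: norm_triangle_ineq)
  also have "\<dots> \<le> L2_set (\<lambda>m. cmod (p c m)) {..<N} + L2_set (\<lambda>m. cmod (p d m)) {..<N}"
    by (rule L2_set_triangle_ineq)
  finally show ?thesis by (simp only: eq)
qed

text \<open>A gliding hump: a bad \<open>w\<close> is glued from blocks, each of which only uses finitely many coordinates.\<close>
lemma uniform_diagonal_bound:
  fixes S L :: "nat \<Rightarrow> nat \<Rightarrow> complex"
  assumes S: "psd_on UNIV S" and L: "psd_on UNIV L"
    and pointwise: "\<And>w. (\<And>i. cmod (w i) \<le> 1) \<Longrightarrow>
      \<exists>M\<ge>0. \<forall>n c. Re (hform {..<n} S (\<lambda>i. c i * w i)) \<le> M\<^sup>2 * Re (hform {..<n} L c)"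
  shows "\<exists>M\<ge>0. \<forall>w. (\<forall>i. cmod (w i) \<le> 1) \<longrightarrow>
      (\<forall>n c. Re (hform {..<n} S (\<lambda>i. c i * w i)) \<le> M\<^sup>2 * Re (hform {..<n} L c))"
proof -
  define NS where "NS = (\<lambda>n c. sqrt (Re (hform {..<n} S c)))"
  define NL where "NL = (\<lambda>n c. sqrt (Re (hform {..<n} L c)))"
  have S0: "0 \<le> Re (hform {..<n} S c)" for n c
    using psd_onD[OF S, of "{..<n}" c] by (simp add: complex_nonneg_iff)
  have L0: "0 \<le> Re (hform {..<n} L c)" for n c
    using psd_onD[OF L, of "{..<n}" c] by (simp add: complex_nonneg_iff)
  have NL0: "0 \<le> NL n c" for n c by (simp add: NL_def L0)
  have tri: "NS n (\<lambda>i. c i + d i) \<le> NS n c + NS n d" for n c d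
    unfolding NS_def by (rule sqrt_hform_triangle[OF S]) auto
  have pw: "\<exists>M\<ge>0. \<forall>n c. NS n (\<lambda>i. c i * w i) \<le> M * NL n c" if w: "\<And>i. cmod (w i) \<le> 1" for w
  proof -
    obtain M where M: "0 \<le> M" "\<And>n c. Re (hform {..<n} S (\<lambda>i. c i * w i)) \<le> M\<^sup>2 * Re (hform {..<n} L c)"
      using pointwise[of w] w by blast
    have "NS n (\<lambda>i. c i * w i) \<le> M * NL n c" for n c
    proof -
      have "NS n (\<lambda>i. c i * w i) \<le> sqrt (M\<^sup>2 * Re (hform {..<n} L c))" unfolding NS_def by (simp add: M(2))
      then show ?thesis using M(1) by (simp add: NL_def real_sqrt_mult)
    qed
    then show ?thesis using M(1) by blast
  qed
  have "\<forall>i. \<exists>M\<ge>0. \<forall>n c. NS n (\<lambda>j. c j * (if j = i then 1 else 0)) \<le> M * NL n c"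
    by (intro allI pw) auto
  then obtain E where E: "\<And>i. 0 \<le> E i" "\<And>i n c. NS n (\<lambda>j. c j * (if j = i then 1 else 0)) \<le> E i * NL n c"
    by metis
  \<comment> \<open>\<open>K m\<close> bounds multiplication by any unit-bounded sequence supported
    below \<open>m\<close>; it is doubled below because differences of two unit-bounded sequences
    are cut off there.\<close>
  define K where "K = (\<lambda>m::nat. \<Sum>i<m. E i)"
  have low: "NS n (\<lambda>i. c i * (if i < m then u i else 0)) \<le> 2 * K m * NL n c"
    if u: "\<And>i. cmod (u i) \<le> 2" for u n c m
  proof (induction m)
    case 0
    show ?case by (simp add: NS_def K_def hform_def)
  next
    case (Suc m)
    have "NS n (\<lambda>i. c i * (if i < Suc m then u i else 0))
        = NS n (\<lambda>i. c i * (if i < m then u i else 0) + u m * (c i * (if i = m then 1 else 0)))"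
      by (intro arg_cong[where f = "NS n"] ext) (auto simp: less_Suc_eq)
    also have "\<dots> \<le> NS n (\<lambda>i. c i * (if i < m then u i else 0)) + NS n (\<lambda>i. u m * (c i * (if i = m then 1 else 0)))"
      by (rule tri)
    also have "NS n (\<lambda>i. u m * (c i * (if i = m then 1 else 0))) = cmod (u m) * NS n (\<lambda>i. c i * (if i = m then 1 else 0))"
      unfolding NS_def hform_scale_arg by (simp add: real_sqrt_mult)
    also have "\<dots> \<le> 2 * (E m * NL n c)"
      by (intro mult_mono u E(2)) (auto simp: NS_def S0)
    finally show ?case using Suc.IH by (simp add: K_def algebra_simps)
  qed
  have "\<exists>M\<ge>0. \<forall>w n c. (\<forall>i. cmod (w i) \<le> 1) \<longrightarrow> NS n (\<lambda>i. c i * w i) \<le> M * NL n c"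
  proof (rule ccontr)
    assume "\<not> ?thesis"
    then have "\<forall>M. \<exists>w n c. 0 \<le> M \<longrightarrow> (\<forall>i. cmod (w i) \<le> 1) \<and> M * NL n c < NS n (\<lambda>i. c i * w i)"
      by (metis not_le)
    then obtain W Nf Cf where W: "\<And>M i. 0 \<le> M \<Longrightarrow> cmod (W M i) \<le> 1"
      "\<And>M. 0 \<le> M \<Longrightarrow> M * NL (Nf M) (Cf M) < NS (Nf M) (\<lambda>i. Cf M i * W M i)"
      by metis
    \<comment> \<open>The surplus \<open>2 * K m\<close> pays for replacing the first
      \<open>m\<close> coordinates of a bad sequence by those already fixed, and
      \<open>real k\<close> is left to beat any constant. Block \<open>k\<close> runs from
      \<open>m k\<close> to \<open>m (Suc k)\<close>, far enough to cover the coordinates used by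
      its bad combination.\<close>
    define B where "B = (\<lambda>k m::nat. real k + 2 * K m)"
    define m where "m = rec_nat 0 (\<lambda>k mk. max (Suc mk) (Nf (B k mk)))"
    have mS: "m (Suc k) = max (Suc (m k)) (Nf (B k (m k)))" for k by (simp add: m_def)
    have smono: "strict_mono m" by (rule strict_mono_Suc_iff[THEN iffD2]) (simp add: mS less_max_iff_disj)
    have B0: "0 \<le> B k j" for k j using E(1) by (auto simp: B_def K_def intro!: add_nonneg_nonneg sum_nonneg)
    define w where "w = (\<lambda>i. let k = (LEAST k. i < m (Suc k)) in W (B k (m k)) i)"
    have wk: "w i = W (B k (m k)) i" if "m k \<le> i" "i < m (Suc k)" for i k
    proof -
      have "(LEAST k. i < m (Suc k)) = k"
      proof (rule Least_equality)
        fix j assume j: "i < m (Suc j)"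
        show "k \<le> j"
        proof (rule ccontr)
          assume "\<not> k \<le> j"
          then have "m (Suc j) \<le> m k" using smono by (simp add: strict_mono_less_eq)
          then show False using j that by simp
        qed
      qed (rule that)
      then show ?thesis by (simp add: w_def Let_def)
    qed
    have w1: "cmod (w i) \<le> 1" for i by (simp add: w_def Let_def W(1)[OF B0])
    obtain M where M: "0 \<le> M" "\<And>n c. NS n (\<lambda>i. c i * w i) \<le> M * NL n c" using pw[of w] w1 by blast
    obtain k :: nat where k: "M < real k" using reals_Archimedean2 by blast
    define b n c where "b = B k (m k)" and "n = Nf b" and "c = Cf b"
    have b0: "0 \<le> b" by (simp add: b_def B0)
    have "NS n (\<lambda>i. c i * W b i) = NS n (\<lambda>i. c i * w i + c i * (if i < m k then W b i - w i else 0))"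
      unfolding NS_def
    proof (intro arg_cong[where f = "\<lambda>z. sqrt (Re z)"] hform_cong refl)
      fix i assume "i \<in> {..<n}"
      then have "i < m (Suc k)" by (simp add: mS n_def b_def less_max_iff_disj)
      then show "c i * W b i = c i * w i + c i * (if i < m k then W b i - w i else 0)"
        using wk[of k i] by (auto simp: b_def algebra_simps)
    qed
    also have "\<dots> \<le> NS n (\<lambda>i. c i * w i) + NS n (\<lambda>i. c i * (if i < m k then W b i - w i else 0))"
      by (rule tri)
    also have "\<dots> \<le> M * NL n c + 2 * K (m k) * NL n c"
    proof (intro add_mono M(2) low)
      fix i
      show "cmod (W b i - w i) \<le> 2"
        using norm_triangle_ineq4[of "W b i" "w i"] W(1)[OF b0, of i] w1[of i] by linarith
    qed
    also have "\<dots> \<le> b * NL n c"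
      using k NL0[of n c] mult_right_mono[of M "real k" "NL n c"] by (simp add: b_def B_def algebra_simps)
    finally show False using W(2)[OF b0] by (simp add: n_def c_def)
  qed
  then obtain M where M: "0 \<le> M" "\<And>w n c. (\<And>i. cmod (w i) \<le> 1) \<Longrightarrow> NS n (\<lambda>i. c i * w i) \<le> M * NL n c"
    by blast
  show ?thesis
  proof (intro exI[of _ M] conjI allI impI)
    fix w :: "nat \<Rightarrow> complex" and n c assume w: "\<forall>i. cmod (w i) \<le> 1"
    have "(NS n (\<lambda>i. c i * w i))\<^sup>2 \<le> (M * NL n c)\<^sup>2"
      by (intro power_mono M(2)) (use w in \<open>auto simp: NS_def S0\<close>)
    then show "Re (hform {..<n} S (\<lambda>i. c i * w i)) \<le> M\<^sup>2 * Re (hform {..<n} L c)"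
      by (simp add: NS_def NL_def S0 L0 power_mult_distrib)
  qed (rule M(1))
qed

text \<open>The mean over all signs leaves only the diagonal. Here the signs are chosen greedily:
  each new one makes its cross terms nonpositive.\<close>

lemma exists_signs_hform_le:
  fixes n :: nat
  shows "\<exists>\<sigma>. (\<forall>i. \<sigma> i = 1 \<or> \<sigma> i = -1) \<and> Re (hform {..<n} K (\<lambda>i. c i * \<sigma> i)) \<le> (\<Sum>i<n. (cmod (c i))\<^sup>2 * Re (K i i))"
proof (induction n)
  case 0
  show ?case by (intro exI[of _ "\<lambda>_. 1"]) (simp add: hform_def)
next
  case (Suc n)
  then obtain \<sigma> where \<sigma>: "\<forall>i. \<sigma> i = 1 \<or> \<sigma> i = -1"
    "Re (hform {..<n} K (\<lambda>i. c i * \<sigma> i)) \<le> (\<Sum>i<n. (cmod (c i))\<^sup>2 * Re (K i i))" by blast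
  define Y Z where "Y = (\<Sum>j<n. c n * cnj (c j * \<sigma> j) * K n j)"
    and "Z = (\<Sum>i<n. c i * \<sigma> i * cnj (c n) * K i n)"
  define X where "X = Re (Y + Z)"
  define \<tau> where "\<tau> = \<sigma>(n := if X \<le> 0 then 1 else -1)"
  have less: "{..<Suc n} = insert n {..<n}" by auto
  have \<tau>n: "\<tau> i = \<sigma> i" if "i < n" for i using that by (simp add: \<tau>_def)
  have 1: "(\<Sum>j<n. c n * \<tau> n * cnj (c j * \<tau> j) * K n j) = \<tau> n * Y"
    unfolding Y_def sum_distrib_left by (intro sum.cong refl) (simp add: \<tau>n)
  have 2: "(\<Sum>i<n. c i * \<tau> i * cnj (c n * \<tau> n) * K i n) = cnj (\<tau> n) * Z"
    unfolding Z_def sum_distrib_left by (intro sum.cong refl) (simp add: \<tau>n)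
  have 3: "hform {..<n} K (\<lambda>i. c i * \<tau> i) = hform {..<n} K (\<lambda>i. c i * \<sigma> i)"
    by (rule hform_cong) (auto simp: \<tau>n)
  have "c n * \<tau> n * cnj (c n * \<tau> n) = complex_of_real ((cmod (c n))\<^sup>2)"
    using complex_norm_square[of "c n"] by (simp add: \<tau>_def)
  then have 4: "Re (c n * \<tau> n * cnj (c n * \<tau> n) * K n n) = (cmod (c n))\<^sup>2 * Re (K n n)"
    by (simp del: of_real_power)
  have "hform {..<Suc n} K (\<lambda>i. c i * \<tau> i) = c n * \<tau> n * cnj (c n * \<tau> n) * K n n
      + \<tau> n * Y + cnj (\<tau> n) * Z + hform {..<n} K (\<lambda>i. c i * \<sigma> i)"
    unfolding less 1[symmetric] 2[symmetric] 3[symmetric] by (rule hform_insert) auto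
  moreover have "Re (\<tau> n * Y) + Re (cnj (\<tau> n) * Z) = (if X \<le> 0 then X else - X)"
    by (simp add: \<tau>_def X_def)
  ultimately have "Re (hform {..<Suc n} K (\<lambda>i. c i * \<tau> i))
      = (cmod (c n))\<^sup>2 * Re (K n n) + (if X \<le> 0 then X else - X) + Re (hform {..<n} K (\<lambda>i. c i * \<sigma> i))"
    by (simp only: plus_complex.simps 4)
  also have "\<dots> \<le> (\<Sum>i<Suc n. (cmod (c i))\<^sup>2 * Re (K i i))" using \<sigma>(2) by simp
  finally show ?case using \<sigma>(1) by (intro exI[of _ \<tau>]) (auto simp: \<tau>_def)
qed

text \<open>Two choices of \<open>w\<close> in the uniform bound: signs, which undo those that make
  the form of \<open>l\<close> at most its diagonal, give the Bessel bound for \<open>s\<close>; the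
  indicator of one index separates its kernel function of \<open>l\<close> from all the
  others.\<close>

lemma interpolating_imp_bounds:
  assumes s: "pos_kernel s" and l: "pos_kernel l" and "interpolating_mult s l x"
  shows "\<exists>M>0. (\<forall>n c. Re (hform {..<n} (ngram s x) c) \<le> M\<^sup>2 * (\<Sum>i<n. (cmod (c i))\<^sup>2)) \<and>
    (\<forall>n c. \<forall>i<n. (cmod (c i))\<^sup>2 \<le> M\<^sup>2 * Re (hform {..<n} (ngram l x) c))"
proof -
  have pw: "\<exists>M\<ge>0. \<forall>n c. Re (hform {..<n} (ngram s x) (\<lambda>i. c i * w i)) \<le> M\<^sup>2 * Re (hform {..<n} (ngram l x) c)"
    if w: "\<And>i. cmod (w i) \<le> 1" for w
  proof -
    obtain \<phi> where \<phi>: "is_multiplier s l \<phi>"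
      "\<And>i. \<phi> (x i) = w i * complex_of_real (kfun_norm l (x i) / kfun_norm s (x i))"
      using assms(3)[unfolded interpolating_mult_def, rule_format, of w] w by blast
    obtain M where M: "0 \<le> M" "\<And>n (x :: nat \<Rightarrow> 'a) c. Re (hform {..<n} (\<lambda>i j. s (x i) (x j)) (\<lambda>i. c i * \<phi> (x i)))
      \<le> M\<^sup>2 * Re (hform {..<n} (\<lambda>i j. l (x i) (x j)) c)"
      by (rule is_multiplierD[OF pos_kernelD(1)[OF s] pos_kernelD(1)[OF l] \<phi>(1)]) blast
    have "Re (hform {..<n} (ngram s x) (\<lambda>i. c i * w i)) \<le> M\<^sup>2 * Re (hform {..<n} (ngram l x) c)" for n c
    proof -
      define d where "d = (\<lambda>i. c i / complex_of_real (kfun_norm l (x i)))"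
      have "d i * \<phi> (x i) = c i * w i / complex_of_real (kfun_norm s (x i))" for i
        using kfun_norm_pos[OF l, of "x i"] by (simp add: d_def \<phi>(2))
      then show ?thesis using M(2)[of n x d] by (simp add: hform_ngram d_def)
    qed
    then show ?thesis using M(1) by blast
  qed
  obtain M0 where M0: "0 \<le> M0" "\<And>w n c. (\<And>i. cmod (w i) \<le> 1) \<Longrightarrow>
      Re (hform {..<n} (ngram s x) (\<lambda>i. c i * w i)) \<le> M0\<^sup>2 * Re (hform {..<n} (ngram l x) c)"
    using uniform_diagonal_bound[OF psd_ngram[OF pos_kernelD(1)[OF s]] psd_ngram[OF pos_kernelD(1)[OF l]] pw]
    by blast
  define M where "M = M0 + 1"
  have M: "0 < M" using M0(1) by (simp add: M_def)
  have L0: "0 \<le> Re (hform {..<n} (ngram l x) c)" for n c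
    using psd_onD[OF psd_ngram[OF pos_kernelD(1)[OF l]], of "{..<n}"] by (simp add: complex_nonneg_iff)
  have bound: "Re (hform {..<n} (ngram s x) (\<lambda>i. c i * w i)) \<le> M\<^sup>2 * Re (hform {..<n} (ngram l x) c)"
    if "\<And>i. cmod (w i) \<le> 1" for w n c
  proof (rule order_trans[OF M0(2)[of w, OF that]])
    have "M0\<^sup>2 \<le> M\<^sup>2" by (rule power_mono) (use M0(1) in \<open>auto simp: M_def\<close>)
    then show "M0\<^sup>2 * Re (hform {..<n} (ngram l x) c) \<le> M\<^sup>2 * Re (hform {..<n} (ngram l x) c)"
      by (rule mult_right_mono[OF _ L0])
  qed
  show ?thesis
  proof (intro exI[of _ M] conjI allI impI)
    show "0 < M" by (rule M)
    fix n and c :: "nat \<Rightarrow> complex"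
    obtain \<sigma> where \<sigma>: "\<forall>i. \<sigma> i = 1 \<or> \<sigma> i = -1"
      "Re (hform {..<n} (ngram l x) (\<lambda>i. c i * \<sigma> i)) \<le> (\<Sum>i<n. (cmod (c i))\<^sup>2 * Re (ngram l x i i))"
      using exists_signs_hform_le by blast
    have c1: "c i * \<sigma> i * \<sigma> i = c i" "cmod (\<sigma> i) \<le> 1" for i using \<sigma>(1)[rule_format, of i] by auto
    have "Re (hform {..<n} (ngram s x) c) = Re (hform {..<n} (ngram s x) (\<lambda>i. c i * \<sigma> i * \<sigma> i))" by (simp add: c1)
    also have "\<dots> \<le> M\<^sup>2 * Re (hform {..<n} (ngram l x) (\<lambda>i. c i * \<sigma> i))"
      by (rule bound) (rule c1)
    also have "\<dots> \<le> M\<^sup>2 * (\<Sum>i<n. (cmod (c i))\<^sup>2)"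
      using \<sigma>(2) by (intro mult_left_mono) (auto simp: ngram_diag[OF l])
    finally show "Re (hform {..<n} (ngram s x) c) \<le> M\<^sup>2 * (\<Sum>i<n. (cmod (c i))\<^sup>2)" .
  next
    fix n i :: nat and c :: "nat \<Rightarrow> complex" assume i: "i < n"
    have "hform {..<n} (ngram s x) (\<lambda>j. c j * (if j = i then 1 else 0)) = hform {i} (ngram s x) (\<lambda>j. c j * (if j = i then 1 else 0))"
      using i by (intro hform_restrict) auto
    also have "\<dots> = complex_of_real ((cmod (c i))\<^sup>2)"
      by (simp add: hform_def ngram_diag[OF s] complex_norm_square del: of_real_power)
    finally have "(cmod (c i))\<^sup>2 = Re (hform {..<n} (ngram s x) (\<lambda>j. c j * (if j = i then 1 else 0)))" by simp
    also have "\<dots> \<le> M\<^sup>2 * Re (hform {..<n} (ngram l x) c)" by (rule bound) auto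
    finally show "(cmod (c i))\<^sup>2 \<le> M\<^sup>2 * Re (hform {..<n} (ngram l x) c)" .
  qed
qed

section \<open>Separation from all other points implies weak and n-weak separation\<close>

lemma strongly_separated_on_finite:
  fixes A :: "nat set"
  assumes "\<And>n c i. i < n \<Longrightarrow> (cmod (c i))\<^sup>2 \<le> M\<^sup>2 * Re (hform {..<n} K c)" and A: "finite A" "i \<in> A"
  shows "(cmod (c i))\<^sup>2 \<le> M\<^sup>2 * Re (hform A K c)"
proof -
  have "\<exists>n. A \<subseteq> {..<n}" using A(1) by (simp only: finite_nat_iff_bounded)
  then obtain n where n: "A \<subseteq> {..<n}" ..
  define d where "d = (\<lambda>i. if i \<in> A then c i else 0)"
  have "hform {..<n} K d = hform A K d" by (rule hform_restrict) (use n in \<open>auto simp: d_def\<close>)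
  also have "\<dots> = hform A K c" by (rule hform_cong) (auto simp: d_def)
  finally have eq: "hform {..<n} K d = hform A K c" .
  have "i < n" "d i = c i" using n A(2) by (auto simp: d_def)
  then show ?thesis using assms(1)[of i n d] by (simp only: eq)
qed

lemma strongly_separated_imp_weakly_separated:
  assumes l: "pos_kernel l" and M: "0 < M"
    and sep: "\<And>n c i. i < n \<Longrightarrow> (cmod (c i))\<^sup>2 \<le> M\<^sup>2 * Re (hform {..<n} (ngram l x) c)"
  shows "weakly_separated l x"
  unfolding weakly_separated_def
proof (intro exI[of _ "1 / M"] conjI allI impI)
  show "0 < 1 / M" using M by simp
  fix i j :: nat assume ij: "i \<noteq> j"
  define z where "z = ngram l x i j"
  have h: "ngram l x j i = cnj z"
    unfolding z_def by (rule psd_hermitian[OF psd_ngram[OF pos_kernelD(1)[OF l]]]) auto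
  have zz: "z * cnj z = complex_of_real ((cmod z)\<^sup>2)" by (simp only: complex_norm_square)
  \<comment> \<open>These coefficients describe the residual after projecting one normalized kernel
    function onto the other.\<close>
  have "hform {i, j} (ngram l x) (\<lambda>t. if t = i then 1 else - z) = 1 - z * cnj z"
    using ij by (simp add: hform_def h ngram_diag[OF l] z_def[symmetric] mult.commute)
  then have "Re (hform {i, j} (ngram l x) (\<lambda>t. if t = i then 1 else - z)) = 1 - (cmod z)\<^sup>2"
    unfolding zz by (simp del: of_real_power)
  moreover have "(cmod ((\<lambda>t. if t = i then 1 else - z) i))\<^sup>2 \<le> M\<^sup>2 * Re (hform {i, j} (ngram l x) (\<lambda>t. if t = i then 1 else - z))"
    by (rule strongly_separated_on_finite[OF sep]) auto
  ultimately have "1 \<le> M\<^sup>2 * (1 - (cmod z)\<^sup>2)" by (simp only:) simp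
  then have "(1 / M)\<^sup>2 \<le> 1 - (cmod z)\<^sup>2" using M by (simp add: field_simps)
  then show "1 / M \<le> kdist l (x i) (x j)"
    unfolding kdist_def z_def cmod_ngram_square[OF l] by (rule real_le_rsqrt)
qed

lemma hform_reindex: "inj_on p F \<Longrightarrow> hform (p ` F) K c = hform F (\<lambda>i j. K (p i) (p j)) (\<lambda>i. c (p i))"
  by (simp add: hform_def sum.reindex)

lemma strongly_separated_imp_n_weakly_separated:
  assumes l: "pos_kernel l" and M: "0 < M" and n: "0 < n"
    and sep: "\<And>n c i. i < n \<Longrightarrow> (cmod (c i))\<^sup>2 \<le> M\<^sup>2 * Re (hform {..<n} (ngram l x) c)"
  shows "n_weakly_separated l n x"
  unfolding n_weakly_separated_def
proof (intro exI[of _ "1 / M"] conjI allI impI)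
  show "0 < 1 / M" using M by simp
  fix mu :: "nat \<Rightarrow> 'a" assume mu: "inj_on mu {..<n} \<and> mu ` {..<n} \<subseteq> range x"
  then have "\<forall>j\<in>{..<n}. \<exists>i. mu j = x i" by blast
  then obtain p where p: "\<And>j. j < n \<Longrightarrow> mu j = x (p j)" by (metis lessThan_iff)
  have inj: "inj_on p {..<n}" using mu p by (metis (mono_tags, lifting) inj_on_def lessThan_iff)
  show "1 / M \<le> dist_to_span l n mu"
  proof (rule dist_to_span_geI[OF l])
    fix a :: "nat \<Rightarrow> complex"
    \<comment> \<open>Coefficients are moved from positions to indices along \<open>p\<close>; the
      values of \<open>c\<close> off the image of \<open>p\<close> never enter the form.\<close>
    define c where "c = (\<lambda>i. let j = the_inv_into {..<n} p i in cnj (a j) * complex_of_real (kfun_norm l (mu j)))"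
    have cp: "c (p j) = cnj (a j) * complex_of_real (kfun_norm l (mu j))" if "j < n" for j
      using that by (simp add: c_def the_inv_into_f_f[OF inj])
    have "hform (p ` {..<n}) (ngram l x) c = hform {..<n} (\<lambda>i j. l (mu i) (mu j)) (\<lambda>i. cnj (a i))"
      unfolding hform_ngram hform_reindex[OF inj]
    proof (intro hform_cong)
      fix i assume "i \<in> {..<n}"
      then show "c (p i) / complex_of_real (kfun_norm l (x (p i))) = cnj (a i)"
        using kfun_norm_pos[OF l, of "mu i"] by (simp add: cp p)
    qed (simp add: p)
    then have e: "Re (hform (p ` {..<n}) (ngram l x) c) = combo_norm2 l n mu a" by (simp add: combo_norm2_eq)
    have "(cmod (c (p 0)))\<^sup>2 \<le> M\<^sup>2 * Re (hform (p ` {..<n}) (ngram l x) c)"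
      by (rule strongly_separated_on_finite[OF sep]) (use n in auto)
    moreover have "(cmod (c (p 0)))\<^sup>2 = (cmod (a 0))\<^sup>2 * Re (l (mu 0) (mu 0))"
      using cp[OF n] by (simp add: norm_mult power_mult_distrib kfun_norm_square[OF l])
    ultimately show "(1 / M)\<^sup>2 * (cmod (a 0))\<^sup>2 * Re (l (mu 0) (mu 0)) \<le> combo_norm2 l n mu a"
      using M unfolding e by (simp add: field_simps)
  qed (use M in simp)
qed

section \<open>Sparse blocks\<close>

text \<open>The arithmetic-geometric mean inequality separates \<open>c i\<close> from
  \<open>c j\<close>, and equal moduli of \<open>K i j\<close> and \<open>K j i\<close> make row and
  column sums agree.\<close>

lemma hform_schur_test:
  assumes I: "finite I" and sym: "\<And>i j. cmod (K j i) = cmod (K i j)"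
    and row: "\<And>i. i \<in> I \<Longrightarrow> (\<Sum>j\<in>I. cmod (K i j)) \<le> R"
  shows "Re (hform I K c) \<le> R * (\<Sum>i\<in>I. (cmod (c i))\<^sup>2)"
proof -
  let ?x = "\<lambda>i. (cmod (c i))\<^sup>2"
  have "Re (hform I K c) \<le> (\<Sum>i\<in>I. \<Sum>j\<in>I. (?x i / 2 + ?x j / 2) * cmod (K i j))"
    unfolding hform_def Re_sum
  proof (intro sum_mono)
    fix i j
    have "Re (c i * cnj (c j) * K i j) \<le> cmod (c i * cnj (c j) * K i j)" by (rule complex_Re_le_cmod)
    also have "\<dots> = (cmod (c i) * cmod (c j)) * cmod (K i j)" by (simp add: norm_mult)
    also have "\<dots> \<le> (?x i / 2 + ?x j / 2) * cmod (K i j)"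
    proof (rule mult_right_mono)
      have "0 \<le> (cmod (c i) - cmod (c j))\<^sup>2" by simp
      then show "cmod (c i) * cmod (c j) \<le> ?x i / 2 + ?x j / 2" by (simp add: power2_diff)
    qed simp
    finally show "Re (c i * cnj (c j) * K i j) \<le> (?x i / 2 + ?x j / 2) * cmod (K i j)" .
  qed
  also have "\<dots> = (\<Sum>i\<in>I. \<Sum>j\<in>I. ?x i / 2 * cmod (K i j)) + (\<Sum>i\<in>I. \<Sum>j\<in>I. ?x j / 2 * cmod (K i j))"
    by (simp add: sum.distrib algebra_simps)
  also have "(\<Sum>i\<in>I. \<Sum>j\<in>I. ?x j / 2 * cmod (K i j)) = (\<Sum>i\<in>I. \<Sum>j\<in>I. ?x i / 2 * cmod (K i j))"
    by (subst sum.swap) (simp add: sym)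
  also have "(\<Sum>i\<in>I. \<Sum>j\<in>I. ?x i / 2 * cmod (K i j)) + (\<Sum>i\<in>I. \<Sum>j\<in>I. ?x i / 2 * cmod (K i j))
      = (\<Sum>i\<in>I. ?x i * (\<Sum>j\<in>I. cmod (K i j)))"
    by (simp add: sum_distrib_left sum_distrib_right sum.distrib[symmetric] mult.commute)
  also have "\<dots> \<le> (\<Sum>i\<in>I. ?x i * R)" by (intro sum_mono mult_left_mono row) auto
  finally show ?thesis by (simp add: sum_distrib_left mult.commute)
qed

text \<open>Splitting off a maximal common part \<open>F\<close> of infinitely many blocks leaves blocks that escape to infinity.\<close>
lemma sparse_blocks:
  fixes \<gamma> :: "nat \<Rightarrow> nat \<Rightarrow> real" and B :: "nat \<Rightarrow> nat set"
  assumes \<gamma>: "\<And>i j. 0 \<le> \<gamma> i j" "\<And>i j. \<gamma> i j \<le> 1" "\<And>i j. \<gamma> i j = \<gamma> j i" "\<And>j. (\<lambda>i. \<gamma> i j) \<longlonglongrightarrow> 0"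
    and B: "\<And>k. finite (B k)" "\<And>k. card (B k) \<le> N" "\<And>k. k \<in> B k"
  obtains I where "infinite I" "\<And>k0. \<exists>k\<ge>k0. B k \<subseteq> I"
    "\<And>i J. i \<in> I \<Longrightarrow> finite J \<Longrightarrow> J \<subseteq> I \<Longrightarrow> (\<Sum>j\<in>J. \<gamma> i j) \<le> 4 * real N"
proof -
  let ?P = "\<lambda>F. finite F \<and> infinite {k. F \<subseteq> B k}"
  have cardP: "card F \<le> N" if "?P F" for F
  proof -
    have "{k. F \<subseteq> B k} \<noteq> {}" using that by (metis finite.emptyI)
    then obtain k where "F \<subseteq> B k" by blast
    then show ?thesis using card_mono[OF B(1)] B(2) le_trans by blast
  qed
  have "?P {}" by simp
  moreover have "\<forall>F. ?P F \<longrightarrow> card F < Suc N" using cardP by (simp add: less_Suc_eq_le)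
  ultimately have "\<exists>F. ?P F \<and> (\<forall>F'. ?P F' \<longrightarrow> card F' \<le> card F)"
    by (rule ex_has_greatest_nat[of ?P "{}" card])
  then obtain F where F: "finite F" "infinite {k. F \<subseteq> B k}" and Fmax: "\<And>F'. ?P F' \<Longrightarrow> card F' \<le> card F"
    by blast
  \<comment> \<open>By maximality of \<open>F\<close>, any other index lies in only finitely many
    blocks containing \<open>F\<close>; hence some blocks have a remainder that avoids a given
    initial segment.\<close>
  have esc: "finite {k. F \<subseteq> B k \<and> i \<in> B k}" if "i \<notin> F" for i
  proof (rule ccontr)
    assume "infinite {k. F \<subseteq> B k \<and> i \<in> B k}"
    then have "?P (insert i F)" using F(1) by (simp add: conj_commute)
    then show False using Fmax[of "insert i F"] F(1) that by simp
  qed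
  have "\<exists>k\<ge>p. F \<subseteq> B k \<and> B k \<inter> {..<p} \<subseteq> F" for p
  proof -
    have "finite ({..<p} \<union> (\<Union>i\<in>{..<p} - F. {k. F \<subseteq> B k \<and> i \<in> B k}))" using esc by auto
    then obtain k where "k \<in> {k. F \<subseteq> B k}" "k \<notin> {..<p} \<union> (\<Union>i\<in>{..<p} - F. {k. F \<subseteq> B k \<and> i \<in> B k})"
      using F(2) by (meson finite_subset subsetI)
    then show ?thesis by (intro exI[of _ k]) auto
  qed
  then obtain \<kappa> where \<kappa>: "\<And>p. p \<le> \<kappa> p" "\<And>p. F \<subseteq> B (\<kappa> p)" "\<And>p. B (\<kappa> p) \<inter> {..<p} \<subseteq> F" by metis
  have "\<exists>p\<ge>m. \<forall>i\<ge>p. \<forall>j<m. \<gamma> i j \<le> (1/2) ^ m" for m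
  proof -
    have "\<forall>\<^sub>F i in sequentially. \<forall>j\<in>{..<m}. \<gamma> i j < (1/2) ^ m"
      by (intro eventually_ball_finite ballI order_tendstoD(2)[OF \<gamma>(4)]) auto
    then obtain p where "\<forall>i\<ge>p. \<forall>j\<in>{..<m}. \<gamma> i j < (1/2) ^ m" by (auto simp: eventually_sequentially)
    then show ?thesis by (intro exI[of _ "max m p"]) (auto intro: less_imp_le)
  qed
  then obtain p where p: "\<And>m. m \<le> p m" "\<And>m i j. p m \<le> i \<Longrightarrow> j < m \<Longrightarrow> \<gamma> i j \<le> (1/2) ^ m" by metis
  define b where "b = (\<lambda>m. B (\<kappa> (p m)))"
  \<comment> \<open>Stage t starts beyond \<open>F\<close> and all earlier blocks, and
    \<open>p (m t)\<close> places the next remainder so far out that its entries against indices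
    below \<open>m t\<close> are at most (1/2)^(m t).\<close>
  define m where "m = rec_nat (Suc (Max (insert 0 F))) (\<lambda>_ mk. Suc (Max (b mk)))"
  have m0: "i < m 0" if "i \<in> F" for i using that F(1) by (simp add: m_def less_Suc_eq_le)
  have mb: "i < m (Suc t)" if "i \<in> b (m t)" for i t
    using that B(1) by (auto simp: m_def b_def less_Suc_eq_le)
  have \<kappa>b: "\<kappa> (p n) \<in> b n" "n \<le> \<kappa> (p n)" for n
    using B(3) p(1)[of n] \<kappa>(1)[of "p n"] by (auto simp: b_def)
  have smono: "strict_mono m"
    unfolding strict_mono_Suc_iff using mb \<kappa>b by (meson le_less_trans)
  have mt: "t \<le> m t" for t using smono by (rule seq_suble)
  define C where "C = (\<lambda>t. b (m t) - F)"
  have C: "finite (C t)" "card (C t) \<le> N" for t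
  proof -
    show "finite (C t)" using B(1) by (simp add: C_def b_def)
    have "card (C t) \<le> card (b (m t))" unfolding C_def b_def by (rule card_mono) (use B(1) in auto)
    then show "card (C t) \<le> N" using B(2) le_trans unfolding b_def by blast
  qed
  have Clow: "p (m t) \<le> i" if "i \<in> C t" for i t
    using \<kappa>(3)[of "p (m t)"] that by (force simp: C_def b_def)
  have Cup: "i < m (Suc t)" if "i \<in> C t" for i t using mb that by (auto simp: C_def)
  have Clow': "m t \<le> i" if "i \<in> C t" for i t using p(1) Clow[OF that] le_trans by blast
  have Cdisj: "t = t'" if "i \<in> C t" "i \<in> C t'" for i t t'
  proof -
    have "m t < m (Suc t')" "m t' < m (Suc t)" using Clow' Cup that by (meson le_less_trans)+
    then have "t < Suc t'" "t' < Suc t" using smono by (simp_all only: strict_mono_less)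
    then show ?thesis by simp
  qed
  define I where "I = F \<union> (\<Union>t. C t)"
  have half: "(1/2::real) ^ m k \<le> (1/2) ^ t" if "t \<le> k" for t k
    using mt[of k] that by (intro power_decreasing) auto
  have small: "\<gamma> i j \<le> (1/2) ^ t" if i: "i \<in> I" and j: "j \<in> C t" "i \<notin> C t" for i j t
  proof -
    consider "i \<in> F" | t' where "i \<in> C t'" "t' < t" | t' where "i \<in> C t'" "t < t'"
      using i j(2) by (auto simp: I_def) (metis linorder_neqE_nat)
    then show ?thesis
    proof cases
      case 1
      have "m 0 \<le> m t" using smono by (simp add: strict_mono_less_eq)
      then have "\<gamma> j i \<le> (1/2) ^ m t" using p(2)[OF Clow[OF j(1)]] m0[OF 1] by simp
      then show ?thesis using half[OF order_refl, of t] \<gamma>(3)[of i j] by linarith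
    next
      case (2 t')
      have "m (Suc t') \<le> m t" using smono 2 by (simp only: strict_mono_less_eq)
      then have "\<gamma> j i \<le> (1/2) ^ m t" using p(2)[OF Clow[OF j(1)]] Cup[OF 2(1)] by simp
      then show ?thesis using half[OF order_refl, of t] \<gamma>(3)[of i j] by linarith
    next
      case (3 t')
      have "m (Suc t) \<le> m t'" using smono 3 by (simp only: strict_mono_less_eq)
      then have "\<gamma> i j \<le> (1/2) ^ m t'" using p(2)[OF Clow[OF 3(1)]] Cup[OF j(1)] by simp
      then show ?thesis using half[OF less_imp_le[OF 3(2)]] by linarith
    qed
  qed
  \<comment> \<open>The 4 is 1 + 2 + 1: \<open>N\<close> for the common part \<open>F\<close>,
    \<open>2 * N\<close> for the geometric sum over the blocks, and \<open>N\<close> for the block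
    containing \<open>i\<close>, whose entries are only bounded by 1.\<close>
  have row: "(\<Sum>j\<in>J. \<gamma> i j) \<le> 4 * real N" if i: "i \<in> I" and J: "finite J" "J \<subseteq> I" for i J
  proof -
    obtain T where T: "\<And>j. j \<in> J \<Longrightarrow> j < T"
      using J(1) by (metis finite_nat_set_iff_bounded)
    have sub: "J \<subseteq> F \<union> (\<Union>t\<in>{..<T}. C t)"
    proof
      fix j assume j: "j \<in> J"
      then consider "j \<in> F" | t where "j \<in> C t" using J(2) by (auto simp: I_def)
      then show "j \<in> F \<union> (\<Union>t\<in>{..<T}. C t)"
      proof cases
        case (2 t)
        have "t < T" using mt[of t] Clow'[OF 2] T[OF j] by simp
        then show ?thesis using 2 by auto
      qed simp
    qed
    have "(\<Sum>j\<in>J. \<gamma> i j) \<le> (\<Sum>j\<in>F \<union> (\<Union>t\<in>{..<T}. C t). \<gamma> i j)"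
      using F(1) C(1) \<gamma>(1) sub by (intro sum_mono2) auto
    also have "\<dots> = (\<Sum>j\<in>F. \<gamma> i j) + (\<Sum>j\<in>(\<Union>t\<in>{..<T}. C t). \<gamma> i j)"
      using F(1) C(1) by (intro sum.union_disjoint) (auto simp: C_def)
    also have "(\<Sum>j\<in>(\<Union>t\<in>{..<T}. C t). \<gamma> i j) = (\<Sum>t<T. \<Sum>j\<in>C t. \<gamma> i j)"
      using C(1) Cdisj by (intro sum.UNION_disjoint) auto
    also have "(\<Sum>j\<in>F. \<gamma> i j) \<le> real N"
      using sum_bounded_above[of F "\<gamma> i" 1] \<gamma>(2) cardP[of F] F by (simp add: order_trans)
    also have "(\<Sum>t<T. \<Sum>j\<in>C t. \<gamma> i j) \<le> (\<Sum>t<T. real N * (1/2) ^ t + (if i \<in> C t then real N else 0))"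
    proof (rule sum_mono)
      fix t
      have cN: "real (card (C t)) \<le> real N" using C(2) by simp
      show "(\<Sum>j\<in>C t. \<gamma> i j) \<le> real N * (1/2) ^ t + (if i \<in> C t then real N else 0)"
      proof (cases "i \<in> C t")
        case True
        have "(\<Sum>j\<in>C t. \<gamma> i j) \<le> real N"
          using sum_bounded_above[of "C t" "\<gamma> i" 1] \<gamma>(2) cN by (simp add: order_trans)
        then show ?thesis using True by (simp add: add_increasing)
      next
        case False
        have "(\<Sum>j\<in>C t. \<gamma> i j) \<le> real (card (C t)) * (1/2) ^ t"
          by (rule sum_bounded_above) (use small[OF i _ False] in auto)
        also have "\<dots> \<le> real N * (1/2) ^ t" using cN by (intro mult_right_mono) auto
        finally show ?thesis using False by simp
      qed
    qed
    also have "\<dots> = real N * (\<Sum>t<T. (1/2) ^ t) + (\<Sum>t<T. if i \<in> C t then real N else 0)"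
      by (simp add: sum.distrib sum_distrib_left)
    also have "(\<Sum>t<T. (1/2::real) ^ t) \<le> 2" by (simp add: sum_gp_strict)
    also have "(\<Sum>t<T. if i \<in> C t then real N else 0) \<le> real N"
    proof (cases "\<exists>t<T. i \<in> C t")
      case True
      then obtain t where t: "t < T" "i \<in> C t" by blast
      have "(\<Sum>t'<T. if i \<in> C t' then real N else 0) = (\<Sum>t'<T. if t' = t then real N else 0)"
        using Cdisj t(2) by (intro sum.cong refl) auto
      then show ?thesis using t(1) by simp
    next
      case False
      then have "(\<Sum>t'<T. if i \<in> C t' then real N else 0) = 0" by (intro sum.neutral) auto
      then show ?thesis by simp
    qed
    finally show ?thesis by (simp add: mult_left_mono)
  qed
  have bI: "b (m t) \<subseteq> I" for t by (auto simp: I_def C_def)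
  have inf: "infinite I"
    unfolding infinite_nat_iff_unbounded_le using bI \<kappa>b mt by (meson le_trans subsetD)
  have blocks: "\<exists>k\<ge>k0. B k \<subseteq> I" for k0
    using bI[of k0] \<kappa>b(2)[of "m k0"] mt[of k0] unfolding b_def by (meson le_trans)
  show thesis using that[OF inf blocks row] .
qed

section \<open>The equivalence\<close>

lemma has_sum_finite_sum:
  fixes f :: "'j \<Rightarrow> 'm \<Rightarrow> 'b::topological_comm_monoid_add"
  assumes "finite F" "\<And>z. z \<in> F \<Longrightarrow> (f z has_sum S z) A"
  shows "((\<lambda>m. \<Sum>z\<in>F. f z m) has_sum (\<Sum>z\<in>F. S z)) A"
  using assms by (induction F rule: finite_induct) (auto intro: has_sum_add)

lemma l2_product_summable:
  assumes "l2_vec u" "l2_vec v"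
  shows "(\<lambda>m. u m * cnj (v m)) summable_on UNIV"
proof -
  have sm: "(\<lambda>m. (cmod (u m))\<^sup>2 + (cmod (v m))\<^sup>2) summable_on UNIV"
    using assms unfolding l2_vec_def by (rule summable_on_add)
  have "(\<lambda>m. norm (u m * cnj (v m))) summable_on UNIV"
  proof (rule Infinite_Sum.abs_summable_on_comparison_test'[OF sm])
    fix m
    have "0 \<le> (cmod (u m) - cmod (v m))\<^sup>2" "0 \<le> cmod (u m) * cmod (v m)" by simp_all
    then show "norm (u m * cnj (v m)) \<le> (cmod (u m))\<^sup>2 + (cmod (v m))\<^sup>2"
      unfolding norm_mult complex_mod_cnj power2_diff by linarith
  qed
  then show ?thesis by (rule abs_summable_summable)
qed

text \<open>Finite sums pass inside the convergent series, so the form is an infinite sum of squared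
  moduli, one for each coordinate.\<close>

lemma psd_l2_inner:
  fixes b :: "'a \<Rightarrow> 'i \<Rightarrow> complex"
  assumes "\<And>z. l2_vec (b z)"
  shows "psd_on UNIV (\<lambda>z w. l2_inner (b z) (b w))"
  unfolding psd_on_def
proof (intro allI impI)
  fix F :: "'a set" and c assume F: "finite F"
  have "((\<lambda>m. \<Sum>z\<in>F. \<Sum>w\<in>F. c z * cnj (c w) * (b z m * cnj (b w m))) has_sum
      hform F (\<lambda>z w. l2_inner (b z) (b w)) c) UNIV"
    unfolding hform_def l2_inner_def
    by (intro has_sum_finite_sum has_sum_cmult_right has_sum_infsum l2_product_summable assms F)
  moreover have "(\<Sum>z\<in>F. \<Sum>w\<in>F. c z * cnj (c w) * (b z m * cnj (b w m)))
      = complex_of_real ((cmod (\<Sum>z\<in>F. c z * b z m))\<^sup>2)" for m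
    unfolding complex_norm_square by (simp add: sum_product cnj_sum mult_ac)
  ultimately have hs: "((\<lambda>m. complex_of_real ((cmod (\<Sum>z\<in>F. c z * b z m))\<^sup>2)) has_sum
      hform F (\<lambda>z w. l2_inner (b z) (b w)) c) UNIV" by simp
  have "((\<lambda>m. (cmod (\<Sum>z\<in>F. c z * b z m))\<^sup>2) has_sum Re (hform F (\<lambda>z w. l2_inner (b z) (b w)) c)) UNIV"
    using has_sum_Re[OF hs] by (simp only: Re_complex_of_real)
  then have "0 \<le> Re (hform F (\<lambda>z w. l2_inner (b z) (b w)) c)"
    by (rule has_sum_nonneg) simp
  moreover have "Im (hform F (\<lambda>z w. l2_inner (b z) (b w)) c) = 0"
  proof -
    have "((\<lambda>m::'i. 0::real) has_sum Im (hform F (\<lambda>z w. l2_inner (b z) (b w)) c)) UNIV"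
    using has_sum_Im[OF hs] by (simp only: Im_complex_of_real)
    then show ?thesis using has_sum_unique has_sum_0 by metis
  qed
  ultimately show "0 \<le> hform F (\<lambda>z w. l2_inner (b z) (b w)) c" by (simp add: complex_nonneg_iff)
qed

lemma normalized_cnp_pick_kernel:
  assumes "normalized_cnp_kernel_via b s"
  shows "pick_kernel (\<lambda>z w. l2_inner (b z) (b w)) s"
  using assms psd_l2_inner[of b] unfolding pick_kernel_def normalized_cnp_kernel_via_def by auto

lemma pick_kernel_pullback: "pick_kernel U s \<Longrightarrow> pick_kernel (\<lambda>i j. U (x i) (x j)) (\<lambda>i j. s (x i) (x j))"
  by (simp add: pick_kernel_def psd_tuple)

lemma pick_pair_pullback:
  "pick_pair U s g l \<Longrightarrow> pick_pair (\<lambda>i j. U (x i) (x j)) (\<lambda>i j. s (x i) (x j)) (\<lambda>i j. g (x i) (x j)) (\<lambda>i j. l (x i) (x j))"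
  by (simp add: pick_pair_def pick_pair_axioms_def pick_kernel_pullback psd_tuple)

text \<open>The distance bound becomes positivity after subtracting a single diagonal entry, a form
  that survives Schur products. \<open>k\<close> is listed first because the distance is measured
  from position 0.\<close>

lemma n_weakly_separated_psd:
  assumes l: "pos_kernel l" and x: "inj x" and \<epsilon>: "0 \<le> \<epsilon>"
    and sep: "\<And>mu. inj_on mu {..<card Q} \<Longrightarrow> mu ` {..<card Q} \<subseteq> range x \<Longrightarrow> \<epsilon> \<le> dist_to_span l (card Q) mu"
    and Q: "finite Q" "k \<in> Q"
  shows "psd_on Q (\<lambda>i j. l (x i) (x j) - (if i = k \<and> j = k then complex_of_real (\<epsilon>\<^sup>2) * l (x k) (x k) else 0))"
proof (rule psd_on_finiteI[OF Q(1)])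
  fix c
  note l1 = pos_kernelD(1)[OF l]
  obtain ys where ys: "distinct ys" "set ys = Q - {k}" using finite_distinct_list[of "Q - {k}"] Q(1) by auto
  define p where "p = (\<lambda>j. (k # ys) ! j)"
  have d: "distinct (k # ys)" "set (k # ys) = Q" using ys Q(2) by auto
  have len: "length (k # ys) = card Q" using distinct_card[OF d(1)] d(2) by simp
  have inj: "inj_on p {..<card Q}"
    unfolding p_def using d(1) len by (auto simp: inj_on_def nth_eq_iff_index_eq simp del: nth.simps)
  have img: "p ` {..<card Q} = Q"
    unfolding p_def using nth_image[of "card Q" "k # ys"] len d(2)
    by (metis atLeast0LessThan nth_image order_refl take_all)
  define mu where "mu = (\<lambda>j. x (p j))"
  have "inj_on mu {..<card Q}" using inj x unfolding mu_def inj_on_def by (metis UNIV_I)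
  moreover have "mu ` {..<card Q} \<subseteq> range x" by (auto simp: mu_def)
  ultimately have dist: "\<epsilon> \<le> dist_to_span l (card Q) mu" by (rule sep)
  have c0: "0 < card Q" using Q by (auto simp: card_gt_0_iff)
  define h where "h = hform Q (\<lambda>i j. l (x i) (x j)) c"
  have "h = hform {..<card Q} (\<lambda>i j. l (mu i) (mu j)) (\<lambda>i. c (p i))"
    unfolding h_def mu_def by (subst img[symmetric]) (rule hform_reindex[OF inj])
  then have "Re h = combo_norm2 l (card Q) mu (\<lambda>j. cnj (c (p j)))" by (simp add: combo_norm2_eq)
  then have ge: "\<epsilon>\<^sup>2 * (cmod (c k))\<^sup>2 * Re (l (x k) (x k)) \<le> Re h"
    using dist_to_span_geD[OF l c0 \<epsilon> dist, of "\<lambda>j. cnj (c (p j))"] by (simp add: mu_def p_def)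
  have imh: "Im h = 0" unfolding h_def using psd_onD[OF psd_tuple[OF l1] Q(1)] by (simp add: complex_nonneg_iff)
  have "hform Q (\<lambda>i j. l (x i) (x j) - (if i = k \<and> j = k then complex_of_real (\<epsilon>\<^sup>2) * l (x k) (x k) else 0)) c
      = h - hform Q (\<lambda>i j. if i = k \<and> j = k then complex_of_real (\<epsilon>\<^sup>2) * l (x k) (x k) else 0) c"
    unfolding h_def by (rule hform_diff)
  also have "hform Q (\<lambda>i j. if i = k \<and> j = k then complex_of_real (\<epsilon>\<^sup>2) * l (x k) (x k) else 0) c
      = hform {k} (\<lambda>i j. if i = k \<and> j = k then complex_of_real (\<epsilon>\<^sup>2) * l (x k) (x k) else 0) c"
    by (rule hform_restrict) (use Q in auto)
  also have "\<dots> = c k * cnj (c k) * (complex_of_real (\<epsilon>\<^sup>2) * l (x k) (x k))" by (simp add: hform_def)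
  also have "\<dots> = complex_of_real (\<epsilon>\<^sup>2 * (cmod (c k))\<^sup>2 * Re (l (x k) (x k)))"
  proof -
    have "c k * cnj (c k) = complex_of_real ((cmod (c k))\<^sup>2)" by (simp only: complex_norm_square)
    moreover have "l (x k) (x k) = complex_of_real (Re (l (x k) (x k)))"
      by (rule psd_diag_real[OF l1]) simp
    ultimately show ?thesis by (metis (no_types, opaque_lifting) mult.assoc mult.commute of_real_mult)
  qed
  finally show "0 \<le> hform Q (\<lambda>i j. l (x i) (x j) - (if i = k \<and> j = k then complex_of_real (\<epsilon>\<^sup>2) * l (x k) (x k) else 0)) c"
    using ge imh by (simp add: complex_nonneg_iff del: of_real_mult of_real_power)
qed

lemma gram_lower_bound:
  assumes pair: "pick_pair U s g l" and l: "pos_kernel l" and x: "inj x"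
    and C: "\<And>I k. finite I \<Longrightarrow> (\<Sum>i\<in>I. (cmod (ngram s x i k))\<^sup>2) \<le> C"
    and s: "pos_kernel s"
    and sep: "\<And>n. 3 \<le> n \<Longrightarrow> n_weakly_separated l n x"
  obtains \<delta> where "0 < \<delta>" "\<And>A c. finite A \<Longrightarrow>
    \<delta> * (\<Sum>k\<in>A. (cmod (c k))\<^sup>2 * Re (l (x k) (x k))) \<le> Re (hform A (\<lambda>i j. l (x i) (x j)) c)"
proof -
  interpret P: pick_pair "\<lambda>i j. U (x i) (x j)" "\<lambda>i j. s (x i) (x j)" "\<lambda>i j. g (x i) (x j)" "\<lambda>i j. l (x i) (x j)"
    by (rule pick_pair_pullback[OF pair])
  have gsq: "P.gsq i k = (cmod (ngram s x i k))\<^sup>2" for i k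
    by (simp add: P.gsq_def cmod_ngram_square[OF s])
  \<comment> \<open>A cluster has at most \<open>2 * C\<close> points, since each contributes more
    than 1/2 to a sum bounded by \<open>C\<close>; adding 3 enters the range where separation is
    assumed.\<close>
  define N where "N = nat \<lceil>2 * C\<rceil> + 3"
  obtain \<epsilon> where \<epsilon>: "0 < \<epsilon>"
    "\<And>mu. inj_on mu {..<N} \<Longrightarrow> mu ` {..<N} \<subseteq> range x \<Longrightarrow> \<epsilon> \<le> dist_to_span l N mu"
    using sep[of N] unfolding n_weakly_separated_def N_def by auto
  show thesis
  proof (rule that[of "\<epsilon>\<^sup>2 / 4 * 16 powr (- C)"])
    show "0 < \<epsilon>\<^sup>2 / 4 * 16 powr (- C)" using \<epsilon>(1) by simp
    fix A :: "nat set" and c assume A: "finite A"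
    show "\<epsilon>\<^sup>2 / 4 * 16 powr (- C) * (\<Sum>k\<in>A. (cmod (c k))\<^sup>2 * Re (l (x k) (x k))) \<le> Re (hform A (\<lambda>i j. l (x i) (x j)) c)"
    proof (rule P.hform_l_lower_bound[OF A])
      show "0 \<le> \<epsilon>\<^sup>2" by simp
      show "(\<Sum>i\<in>A. P.gsq i k) \<le> C" for k unfolding gsq by (rule C[OF A])
      fix k assume k: "k \<in> A"
      define Q where "Q = {i\<in>A. 1 / 2 < P.gsq k i}"
      have Q: "finite Q" "k \<in> Q" using A k by (auto simp: Q_def P.gsq_self)
      have "real (card Q) * (1 / 2) \<le> (\<Sum>i\<in>Q. P.gsq i k)"
        by (rule sum_bounded_below) (auto simp: Q_def P.gsq_commute)
      also have "\<dots> \<le> C" unfolding gsq by (rule C[OF Q(1)])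
      finally have "card Q \<le> N" unfolding N_def by linarith
      \<comment> \<open>Separation concerns exactly \<open>N\<close> points, so the cluster is
        padded with arbitrary further indices; restricting the resulting positive kernel removes
        them again.\<close>
      have "infinite (UNIV - Q)" using Q(1) by simp
      then obtain R where R: "finite R" "card R = N - card Q" "R \<subseteq> UNIV - Q"
        using infinite_arbitrarily_large by blast
      define Q' where "Q' = Q \<union> R"
      have "card Q' = card Q + card R" unfolding Q'_def using Q(1) R by (intro card_Un_disjoint) auto
      then have card: "card Q' = N" using R(2) \<open>card Q \<le> N\<close> by simp
      have "psd_on Q' (\<lambda>i j. l (x i) (x j) - (if i = k \<and> j = k then complex_of_real (\<epsilon>\<^sup>2) * l (x k) (x k) else 0))"
        by (rule n_weakly_separated_psd[OF l x]) (use \<epsilon> card Q R(1) in \<open>auto simp: Q'_def\<close>)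
      then show "psd_on {i\<in>A. 1 / 2 < P.gsq k i}
         (\<lambda>i j. l (x i) (x j) - (if i = k \<and> j = k then complex_of_real (\<epsilon>\<^sup>2) * l (x k) (x k) else 0))"
        by (rule psd_on_subset) (auto simp: Q'_def Q_def)
    qed
  qed
qed

lemma bessel_on_finite:
  fixes A :: "nat set"
  assumes "\<And>n c. Re (hform {..<n} K c) \<le> C * (\<Sum>i<n. (cmod (c i))\<^sup>2)" "finite A"
  shows "Re (hform A K c) \<le> C * (\<Sum>i\<in>A. (cmod (c i))\<^sup>2)"
proof -
  have "\<exists>n. A \<subseteq> {..<n}" using assms(2) by (simp only: finite_nat_iff_bounded)
  then obtain n where n: "A \<subseteq> {..<n}" ..
  define d where "d = (\<lambda>i. if i \<in> A then c i else 0)"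
  have "hform {..<n} K d = hform A K d" by (rule hform_restrict) (use n in \<open>auto simp: d_def\<close>)
  also have "\<dots> = hform A K c" by (rule hform_cong) (auto simp: d_def)
  finally have eq: "hform {..<n} K d = hform A K c" .
  have "(\<Sum>i<n. (cmod (d i))\<^sup>2) = (\<Sum>i\<in>A. (cmod (d i))\<^sup>2)"
    by (rule sum.mono_neutral_right) (use n in \<open>auto simp: d_def\<close>)
  also have "\<dots> = (\<Sum>i\<in>A. (cmod (c i))\<^sup>2)" by (rule sum.cong) (auto simp: d_def)
  finally show ?thesis using assms(1)[of n d] by (simp only: eq)
qed

lemma bounds_imp_interpolating:
  fixes s l :: "'a \<Rightarrow> 'a \<Rightarrow> complex"
  assumes pair: "pick_pair U s g l" and l: "pos_kernel l" and s: "pos_kernel s" and x: "inj x"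
    and C: "0 < C" "\<And>n c. Re (hform {..<n} (ngram s x) c) \<le> C * (\<Sum>i<n. (cmod (c i))\<^sup>2)"
    and \<delta>: "0 < \<delta>" "\<And>A c. finite A \<Longrightarrow>
      \<delta> * (\<Sum>k\<in>A. (cmod (c k))\<^sup>2 * Re (l (x k) (x k))) \<le> Re (hform A (\<lambda>i j. l (x i) (x j)) c)"
  shows "interpolating_mult s l x"
  unfolding interpolating_mult_def
proof (intro allI impI)
  fix w :: "nat \<Rightarrow> complex" assume "\<exists>B. \<forall>i. cmod (w i) \<le> B"
  then obtain B0 where B0: "\<And>i. cmod (w i) \<le> B0" by blast
  define B where "B = max B0 1"
  have B: "0 < B" "\<And>i. cmod (w i) \<le> B" using B0 by (auto simp: B_def intro: le_max_iff_disj[THEN iffD2])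
  interpret P: pick_pair U s g l by (rule pair)
  \<comment> \<open>The form of \<open>s\<close> costs the Bessel constant and the square of the
    bound on \<open>w\<close>; passing to the form of \<open>l\<close> costs 1 / \<delta>.\<close>
  define M where "M = sqrt (C * B\<^sup>2 / \<delta>)"
  have M: "0 < M" "M\<^sup>2 = C * B\<^sup>2 / \<delta>" using C(1) B(1) \<delta>(1) by (auto simp: M_def)
  define \<phi> where "\<phi> = (\<lambda>z. let i = inv x z in w i * complex_of_real (kfun_norm l (x i) / kfun_norm s (x i)))"
  have \<phi>: "\<phi> (x i) = w i * complex_of_real (kfun_norm l (x i) / kfun_norm s (x i))" for i
    using x by (simp add: \<phi>_def)
  have "psd_on (range x) (P.mult_kernel (complex_of_real (M\<^sup>2)) \<phi>)"
    unfolding psd_on_def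
  proof (intro allI impI)
    fix F and c :: "'a \<Rightarrow> complex" assume F: "finite F" "F \<subseteq> range x"
    define I where "I = x -` F"
    have I: "finite I" "x ` I = F" using F x by (auto simp: I_def intro: finite_vimageI)
    have injI: "inj_on x I" using x by (rule inj_on_subset) simp
    define d where "d = (\<lambda>i. c (x i))"
    let ?l = "hform I (\<lambda>i j. l (x i) (x j)) d" and ?s = "hform I (\<lambda>i j. s (x i) (x j)) (\<lambda>i. d i * \<phi> (x i))"
    have "hform F (P.mult_kernel (complex_of_real (M\<^sup>2)) \<phi>) c = complex_of_real (M\<^sup>2) * ?l - ?s"
      unfolding I(2)[symmetric] hform_reindex[OF injI] P.mult_kernel_def hform_diff hform_scale
      by (subst hform_rescale) (simp add: d_def)
    moreover have "0 \<le> ?l" "0 \<le> ?s"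
      using psd_onD[OF psd_tuple[OF pos_kernelD(1)[OF l]] I(1)] psd_onD[OF psd_tuple[OF pos_kernelD(1)[OF s]] I(1)] by auto
    moreover have "Re ?s \<le> M\<^sup>2 * Re ?l"
    proof -
      define e where "e = (\<lambda>i. d i * w i * complex_of_real (kfun_norm l (x i)))"
      have "?s = hform I (ngram s x) e"
        unfolding hform_ngram e_def by (intro hform_cong) (simp_all add: \<phi>)
      then have "Re ?s \<le> C * (\<Sum>i\<in>I. (cmod (e i))\<^sup>2)" using bessel_on_finite[OF C(2) I(1)] by simp
      also have "\<dots> \<le> C * (\<Sum>i\<in>I. B\<^sup>2 * ((cmod (d i))\<^sup>2 * Re (l (x i) (x i))))"
      proof (intro mult_left_mono sum_mono)
        fix i
        have "(cmod (e i))\<^sup>2 = (cmod (w i))\<^sup>2 * ((cmod (d i))\<^sup>2 * Re (l (x i) (x i)))"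
          by (simp add: e_def norm_mult power_mult_distrib kfun_norm_square[OF l])
        also have "\<dots> \<le> B\<^sup>2 * ((cmod (d i))\<^sup>2 * Re (l (x i) (x i)))"
          using B(2)[of i] pos_kernelD(2)[OF l, of "x i"] by (intro mult_right_mono power_mono) auto
        finally show "(cmod (e i))\<^sup>2 \<le> B\<^sup>2 * ((cmod (d i))\<^sup>2 * Re (l (x i) (x i)))" .
      qed (use C(1) in simp)
      also have "\<dots> = M\<^sup>2 * (\<delta> * (\<Sum>i\<in>I. (cmod (d i))\<^sup>2 * Re (l (x i) (x i))))"
        using \<delta>(1) by (simp add: M(2) sum_distrib_left mult_ac)
      also have "\<dots> \<le> M\<^sup>2 * Re ?l" by (rule mult_left_mono[OF \<delta>(2)[OF I(1)]]) simp
      finally show ?thesis .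
    qed
    ultimately show "0 \<le> hform F (P.mult_kernel (complex_of_real (M\<^sup>2)) \<phi>) c"
      by (simp add: complex_nonneg_iff del: of_real_power)
  qed
  moreover have "0 \<le> complex_of_real (M\<^sup>2)" by (simp add: complex_nonneg_iff del: of_real_power)
  ultimately obtain \<psi> where \<psi>: "\<And>z. z \<in> range x \<Longrightarrow> \<psi> z = \<phi> z"
      "psd_on UNIV (P.mult_kernel (complex_of_real (M\<^sup>2)) \<psi>)"
    using P.pick_extension by blast
  have "is_multiplier s l \<psi>"
    by (rule is_multiplierI[OF pos_kernelD(1)[OF s] pos_kernelD(1)[OF l] M(1)])
      (use \<psi>(2) in \<open>simp add: P.mult_kernel_def[abs_def] del: of_real_power\<close>)
  then show "\<exists>phi. is_multiplier s l phi \<and>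
      (\<forall>i. phi (x i) = w i * complex_of_real (kfun_norm l (x i) / kfun_norm s (x i)))"
    using \<psi>(1) \<phi> by auto
qed

section \<open>Escape to infinity and the necessity of automatic separation\<close>

lemma kdist_self: "pos_kernel k \<Longrightarrow> kdist k z z = 0"
proof -
  assume k: "pos_kernel k"
  have "k z z = complex_of_real (Re (k z z))" by (rule psd_diag_real[OF pos_kernelD(1)[OF k]]) simp
  then have "cmod (k z z) = Re (k z z)" using pos_kernelD(2)[OF k, of z] by (metis abs_of_pos norm_of_real)
  then show ?thesis using pos_kernelD(2)[OF k, of z] by (simp add: kdist_def power2_eq_square)
qed

lemma weakly_separated_inj:
  assumes "pos_kernel k" "weakly_separated k x"
  shows "inj x"
proof (rule injI, rule ccontr)
  fix i j assume "x i = x j" "i \<noteq> j"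
  then show False using assms kdist_self[of k "x j"] unfolding weakly_separated_def
    by (metis less_le_not_le)
qed

text \<open>At a limit point, joint continuity of the kernel would make the distances between
  consecutive terms tend to 0.\<close>

lemma weakly_separated_no_convergent_subsequence:
  fixes k :: "'a::topological_space \<Rightarrow> 'a \<Rightarrow> complex"
  assumes k: "pos_kernel k" and ws: "weakly_separated k x"
    and cont: "continuous_on UNIV (\<lambda>(z, w). k z w)" and r: "strict_mono r"
  shows "\<not> (x \<circ> r) \<longlonglongrightarrow> a"
proof
  assume lim: "(x \<circ> r) \<longlonglongrightarrow> a"
  obtain \<epsilon> where \<epsilon>: "0 < \<epsilon>" "\<And>i j. i \<noteq> j \<Longrightarrow> \<epsilon> \<le> kdist k (x i) (x j)"
    using ws by (auto simp: weakly_separated_def)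
  have l1: "(\<lambda>i. x (r i)) \<longlonglongrightarrow> a" using lim by (simp add: o_def)
  have l2: "(\<lambda>i. x (r (Suc i))) \<longlonglongrightarrow> a" using LIMSEQ_Suc[OF l1] .
  have kl: "(\<lambda>i. k (u i) (v i)) \<longlonglongrightarrow> k a a" if "u \<longlonglongrightarrow> a" "v \<longlonglongrightarrow> a" for u v
    using continuous_on_tendsto_compose[OF cont tendsto_Pair[OF that]] by simp
  have "(\<lambda>i. kdist k (x (r i)) (x (r (Suc i)))) \<longlonglongrightarrow> kdist k a a"
    unfolding kdist_def
    by (intro tendsto_intros kl l1 l2) (use pos_kernelD(2)[OF k, of a] in auto)
  then have "(\<lambda>i. kdist k (x (r i)) (x (r (Suc i)))) \<longlonglongrightarrow> 0" by (simp add: kdist_self[OF k])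
  moreover have "\<epsilon> \<le> kdist k (x (r i)) (x (r (Suc i)))" for i
    using r by (intro \<epsilon>(2)) (metis n_not_Suc_n strict_mono_eq)
  ultimately have "\<epsilon> \<le> 0" by (intro LIMSEQ_le_const) auto
  then show False using \<epsilon>(1) by simp
qed

text \<open>For fixed \<open>j\<close>, |U z (x j)| is at most q < 1 for every z, so s z (x j) is
  bounded in z and division by the growing norms gives the limit.\<close>

lemma ngram_pick_tendsto_0:
  assumes "pick_kernel U s" and s: "pos_kernel s"
    and lim: "filterlim (\<lambda>i. kfun_norm s (x i)) at_top sequentially"
  shows "(\<lambda>i. cmod (ngram s x i j)) \<longlonglongrightarrow> 0"
proof -
  interpret P: pick_kernel U s by fact
  define q where "q = sqrt (Re (U (x j) (x j)))"
  have q: "q < 1" using P.U_diag[of "x j"] by (simp add: q_def)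
  have sb: "cmod (s z (x j)) \<le> 1 / (1 - q)" for z
  proof -
    have "(cmod (U (x j) z))\<^sup>2 \<le> Re (U (x j) (x j))" by (rule P.cmod_U_square_le)
    moreover have "cmod (U z (x j)) = cmod (U (x j) z)"
      using psd_hermitian[OF P.psd_U, of z "x j"] by simp
    ultimately have "cmod (U z (x j)) \<le> q" unfolding q_def by (metis real_le_rsqrt)
    then have "1 - q \<le> cmod (1 - U z (x j))"
      using norm_triangle_ineq2[of 1 "U z (x j)"] by simp
    then show ?thesis using q by (simp add: P.s_eq norm_divide frac_le)
  qed
  have lim0: "(\<lambda>i. (1 / (1 - q) / kfun_norm s (x j)) / kfun_norm s (x i)) \<longlonglongrightarrow> 0"
    by (rule real_tendsto_divide_at_top[OF tendsto_const lim])
  show ?thesis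
  proof (rule tendsto_sandwich[OF _ _ tendsto_const lim0])
    show "\<forall>\<^sub>F i in sequentially. 0 \<le> cmod (ngram s x i j)" by simp
    have "cmod (ngram s x i j) \<le> (1 / (1 - q) / kfun_norm s (x j)) / kfun_norm s (x i)" for i
    proof -
      have "cmod (ngram s x i j) = cmod (s (x i) (x j)) / kfun_norm s (x j) / kfun_norm s (x i)"
        using kfun_norm_pos[OF s, of "x i"] kfun_norm_pos[OF s, of "x j"]
        by (simp add: ngram_def norm_divide norm_mult)
      also have "\<dots> \<le> (1 / (1 - q) / kfun_norm s (x j)) / kfun_norm s (x i)"
        by (intro divide_right_mono sb less_imp_le[OF kfun_norm_pos[OF s]])
      finally show ?thesis .
    qed
    then show "\<forall>\<^sub>F i in sequentially. cmod (ngram s x i j) \<le> (1 / (1 - q) / kfun_norm s (x j)) / kfun_norm s (x i)"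
      by simp
  qed
qed

lemma n_weakly_separated_of_interpolation:
  assumes pick: "pick_kernel U s" and s: "pos_kernel s" and l: "pos_kernel l"
    and interp: "\<And>x. carleson_condition s x \<Longrightarrow> weakly_separated l x \<Longrightarrow> interpolating_mult s l x"
    and ws: "weakly_separated l x" and lim: "filterlim (\<lambda>i. kfun_norm s (x i)) at_top sequentially"
    and n: "0 < n"
  shows "n_weakly_separated l n x"
proof (rule ccontr)
  assume not: "\<not> n_weakly_separated l n x"
  have inj: "inj x" by (rule weakly_separated_inj[OF l ws])
  have "\<exists>mu. inj_on mu {..<n} \<and> mu ` {..<n} \<subseteq> range x \<and> dist_to_span l n mu < 1 / real (Suc k)" for k
  proof -
    have "0 < 1 / real (Suc k)" by simp
    then show ?thesis using not unfolding n_weakly_separated_def not_le[symmetric] by blast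
  qed
  then obtain mu where mu: "\<And>k. inj_on (mu k) {..<n}" "\<And>k. mu k ` {..<n} \<subseteq> range x"
    "\<And>k. dist_to_span l n (mu k) < 1 / real (Suc k)" by metis
  \<comment> \<open>Inserting \<open>k\<close> into the preimage of the k-th bad configuration keeps
    infinitely many blocks from staying in a bounded range, at the price of one more point.\<close>
  define B where "B = (\<lambda>k. insert k (x -` (mu k ` {..<n})))"
  have Bf: "finite (B k)" for k unfolding B_def using inj by (simp add: finite_vimageI)
  have Bc: "card (B k) \<le> Suc n" for k
  proof -
    have "card (x -` (mu k ` {..<n}) \<inter> UNIV) \<le> card (mu k ` {..<n})"
      by (rule card_vimage_inj_on_le) (use inj in auto)
    also have "\<dots> \<le> n" using card_image_le[of "{..<n}" "mu k"] by simp
    finally show ?thesis unfolding B_def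
      using card_insert_le_m1[of "Suc n" "x -` (mu k ` {..<n})" k] by simp
  qed
  define \<gamma> where "\<gamma> = (\<lambda>i j. cmod (ngram s x i j))"
  have le1: "\<gamma> i j \<le> 1" for i j
  proof -
    have "(\<gamma> i j)\<^sup>2 \<le> 1"
      using psd_cauchy[OF psd_ngram[OF pos_kernelD(1)[OF s]], of i j x] by (simp add: ngram_diag[OF s] \<gamma>_def)
    then have "\<bar>\<gamma> i j\<bar> \<le> 1" by (simp only: abs_square_le_1)
    then show ?thesis by simp
  qed
  have sym: "\<gamma> i j = \<gamma> j i" for i j
    unfolding \<gamma>_def by (metis UNIV_I complex_mod_cnj psd_hermitian psd_ngram[OF pos_kernelD(1)[OF s]])
  have lim0: "(\<lambda>i. \<gamma> i j) \<longlonglongrightarrow> 0" for j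
    unfolding \<gamma>_def by (rule ngram_pick_tendsto_0[OF pick s lim])
  obtain I where I: "infinite I" "\<And>k0. \<exists>k\<ge>k0. B k \<subseteq> I"
    "\<And>i J. i \<in> I \<Longrightarrow> finite J \<Longrightarrow> J \<subseteq> I \<Longrightarrow> (\<Sum>j\<in>J. \<gamma> i j) \<le> 4 * real (Suc n)"
  proof (rule sparse_blocks[of \<gamma> B "Suc n"])
    show "0 \<le> \<gamma> i j" for i j by (simp add: \<gamma>_def)
    show "k \<in> B k" for k by (simp add: B_def)
  qed (rule le1 sym lim0 Bf Bc that; assumption)+
  define e where "e = enumerate I"
  have e: "inj e" "range e = I" using bij_enumerate[OF I(1)] by (auto simp: e_def bij_betw_def)
  define y where "y = x \<circ> e"
  have wsy: "weakly_separated l y"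
    using ws e(1) unfolding weakly_separated_def y_def by (metis comp_apply injD)
  \<comment> \<open>Sparsity bounds absolute row sums, so the Schur test applies along the
    subsequence even where the full sequence has no Bessel bound.\<close>
  have "carleson_condition s y"
  proof (rule bessel_imp_carleson[OF s, of "4 * real (Suc n)"])
    show "Re (hform {..<m} (ngram s y) c) \<le> 4 * real (Suc n) * (\<Sum>i<m. (cmod (c i))\<^sup>2)" for m c
    proof (rule hform_schur_test)
      show "cmod (ngram s y j i) = cmod (ngram s y i j)" for i j
        using sym[of "e i" "e j"] by (simp add: \<gamma>_def ngram_def y_def)
      fix i
      have "(\<Sum>j<m. cmod (ngram s y i j)) = (\<Sum>j\<in>e ` {..<m}. \<gamma> (e i) j)"
        by (subst sum.reindex) (auto simp: \<gamma>_def ngram_def y_def intro: inj_on_subset[OF e(1)])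
      also have "\<dots> \<le> 4 * real (Suc n)" by (rule I(3)) (use e(2) in auto)
      finally show "(\<Sum>j<m. cmod (ngram s y i j)) \<le> 4 * real (Suc n)" .
    qed simp
  qed simp
  then have "interpolating_mult s l y" by (rule interp[OF _ wsy])
  then obtain M where M: "0 < M"
    "\<And>n c i. i < n \<Longrightarrow> (cmod (c i))\<^sup>2 \<le> M\<^sup>2 * Re (hform {..<n} (ngram l y) c)"
    using interpolating_imp_bounds[OF s l] by blast
  obtain \<epsilon> where \<epsilon>: "0 < \<epsilon>"
    "\<And>mu. inj_on mu {..<n} \<Longrightarrow> mu ` {..<n} \<subseteq> range y \<Longrightarrow> \<epsilon> \<le> dist_to_span l n mu"
    using strongly_separated_imp_n_weakly_separated[OF l M(1) n M(2)] unfolding n_weakly_separated_def by blast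
  obtain k0 where k0: "1 / real (Suc k0) < \<epsilon>" using \<epsilon>(1) nat_approx_posE by blast
  obtain k where k: "k0 \<le> k" "B k \<subseteq> I" using I(2) by blast
  \<comment> \<open>A whole bad configuration survives in the subsequence, where separation holds
    with a fixed constant.\<close>
  have "mu k ` {..<n} \<subseteq> range y"
  proof
    fix z assume z: "z \<in> mu k ` {..<n}"
    then obtain i where i: "z = x i" using mu(2) by blast
    then have "i \<in> range e" using z k(2) e(2) by (auto simp: B_def)
    then show "z \<in> range y" by (auto simp: y_def i)
  qed
  then have "\<epsilon> \<le> dist_to_span l n (mu k)" by (rule \<epsilon>(2)[OF mu(1)])
  also have "\<dots> < 1 / real (Suc k)" by (rule mu(3))
  also have "\<dots> \<le> 1 / real (Suc k0)" using k(1) by (simp add: frac_le)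
  finally show False using k0 by simp
qed

theorem theorem4p4:
  fixes l s :: "'a::topological_space \<Rightarrow> 'a \<Rightarrow> complex"
    and b :: "'a \<Rightarrow> 'i \<Rightarrow> complex"
  assumes l_kernel: "psd_kernel l"
    and l_nonzero: "\<forall>z. l z z \<noteq> 0"
    and s_pick: "normalized_cnp_kernel_via b s"
    and quotient_psd: "\<exists>g. psd_kernel g \<and> (\<forall>z w. l z w = s z w * g z w)"
    and Q1: "continuous_on UNIV (\<lambda>(z, w). l z w)"
    and Q2: "\<forall>lam::nat \<Rightarrow> 'a. filterlim (\<lambda>i. kfun_norm l (lam i)) at_top sequentially \<longrightarrow>
               (\<forall>mu. ((\<lambda>i. l (lam i) mu / complex_of_real (kfun_norm l (lam i))) \<longlongrightarrow> 0) sequentially)"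
    and Q3: "\<forall>lam::nat \<Rightarrow> 'a. filterlim (\<lambda>i. kfun_norm l (lam i)) at_top sequentially \<or>
               (\<exists>r x. strict_mono r \<and> (lam \<circ> r) \<longlonglongrightarrow> x)"
    and Q4: "\<forall>lam::nat \<Rightarrow> 'a. filterlim (\<lambda>i. kfun_norm l (lam i)) at_top sequentially \<longrightarrow>
               filterlim (\<lambda>i. kfun_norm s (lam i)) at_top sequentially"
  shows "(\<forall>lam::nat \<Rightarrow> 'a. interpolating_mult s l lam \<longleftrightarrow>
            (carleson_condition s lam \<and> weakly_separated l lam))
         \<longleftrightarrow> automatic_separation l"
proof -
  define U where "U = (\<lambda>z w. l2_inner (b z) (b w))"
  have pick: "pick_kernel U s" unfolding U_def by (rule normalized_cnp_pick_kernel[OF s_pick])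
  obtain g where g: "psd_kernel g" "\<And>z w. l z w = s z w * g z w" using quotient_psd by blast
  have pair: "pick_pair U s g l"
    using pick g by (simp add: pick_pair_def pick_pair_axioms_def psd_kernel_iff)
  have s: "pos_kernel s"
    using pick_kernel.psd_s[OF pick] pick_kernel.s_diag_pos[OF pick] by (simp add: pos_kernel_def)
  have l: "pos_kernel l"
  proof -
    have p: "psd_on UNIV l" using l_kernel by (simp add: psd_kernel_iff)
    have "0 < Re (l z z)" for z
      using psd_diag[OF p, of z] l_nonzero[rule_format, of z] by (auto simp: complex_nonneg_iff complex_eq_iff)
    then show ?thesis using p by (simp add: pos_kernel_def)
  qed
  \<comment> \<open>Since this implication always holds, (i) amounts to the sufficiency of the two
    conditions.\<close>
  have necessary: "carleson_condition s x \<and> weakly_separated l x" if int: "interpolating_mult s l x" for x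
  proof -
    obtain M where M: "0 < M"
      "\<And>n c. Re (hform {..<n} (ngram s x) c) \<le> M\<^sup>2 * (\<Sum>i<n. (cmod (c i))\<^sup>2)"
      "\<And>n c i. i < n \<Longrightarrow> (cmod (c i))\<^sup>2 \<le> M\<^sup>2 * Re (hform {..<n} (ngram l x) c)"
      using interpolating_imp_bounds[OF s l int] by blast
    show ?thesis
      using bessel_imp_carleson[OF s _ M(2)] strongly_separated_imp_weakly_separated[OF l M(1) M(3)] M(1) by simp
  qed
  have sufficient: "interpolating_mult s l x"
    if carl: "carleson_condition s x" and ws: "weakly_separated l x" and auto: "automatic_separation l" for x
  proof -
    have inj: "inj x" by (rule weakly_separated_inj[OF l ws])
    have sep: "n_weakly_separated l n x" if "3 \<le> n" for n
      using auto ws that by (auto simp: automatic_separation_def)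
    obtain C where C: "0 < C" "\<And>I k. finite I \<Longrightarrow> (\<Sum>i\<in>I. (cmod (ngram s x i k))\<^sup>2) \<le> C"
      "\<And>n c. Re (hform {..<n} (ngram s x) c) \<le> C * (\<Sum>i<n. (cmod (c i))\<^sup>2)"
      using carleson_imp_bessel[OF s carl] by blast
    obtain \<delta> where \<delta>: "0 < \<delta>" "\<And>A c. finite A \<Longrightarrow>
        \<delta> * (\<Sum>k\<in>A. (cmod (c k))\<^sup>2 * Re (l (x k) (x k))) \<le> Re (hform A (\<lambda>i j. l (x i) (x j)) c)"
      using gram_lower_bound[OF pair l inj C(2) s sep] by blast
    show ?thesis by (rule bounds_imp_interpolating[OF pair l s inj C(1,3) \<delta>])
  qed
  show ?thesis
  proof
    assume i: "\<forall>lam::nat \<Rightarrow> 'a. interpolating_mult s l lam \<longleftrightarrow> (carleson_condition s lam \<and> weakly_separated l lam)"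
    show "automatic_separation l"
      unfolding automatic_separation_def
    proof (intro allI impI)
      fix lam :: "nat \<Rightarrow> 'a" and n :: nat assume ws: "weakly_separated l lam" and n: "3 \<le> n"
      \<comment> \<open>Weak separation excludes the convergent alternative in \<open>Q3\<close>;
        \<open>Q4\<close> then supplies the growth for \<open>s\<close> on which the sparse
        subsequence rests.\<close>
      have "filterlim (\<lambda>i. kfun_norm l (lam i)) at_top sequentially"
        using Q3 weakly_separated_no_convergent_subsequence[OF l ws Q1] by blast
      then have "filterlim (\<lambda>i. kfun_norm s (lam i)) at_top sequentially" using Q4 by blast
      then show "n_weakly_separated l n lam"
        using n by (intro n_weakly_separated_of_interpolation[OF pick s l _ ws]) (use i in auto)
    qed
  next
    assume "automatic_separation l"
    then show "\<forall>lam::nat \<Rightarrow> 'a. interpolating_mult s l lam \<longleftrightarrow> (carleson_condition s lam \<and> weakly_separated l lam)"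
      using necessary sufficient by blast
  qed
qed

end
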